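(* Let $\Omega:=(0,l)\times(0,L)\subset\mathbb{R}^2$, with $l,L>0$ and $l\ne L$. Then, for any $n\in\mathbb{N}$, the Robin eigenvalue $\lambda_n^\alpha$ is simple for $\alpha$ sufficiently large (depending on $n$).
   Context: For $\alpha>0$, $\{\lambda_n^\alpha\}_{n\in\mathbb{N}}$ are the eigenvalues of the Robin Laplacian on $\Omega$ in nondecreasing order, repeated according to multiplicity, i.e. the $\lambda\in\mathbb{R}$ for which there is $\varphi\in H^1(\Omega)\setminus\{0\}$ with $\int_\Omega\nabla\varphi\cdot\nabla v\,dx+\alpha\int_{\partial\Omega}\varphi v\,dS=\lambda\int_\Omega\varphi v\,dx$ for all $v\in H^1(\Omega)$ (weak form of $-\Delta\varphi=\lambda\varphi$ in $\Omega$, $\partial_\nu\varphi+\alpha\varphi=0$ on $\partial\Omega$). An eigenvalue is simple if its eigenspace is one-dimensional. *)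

theory Defs
  imports "HOL-Analysis.Analysis"
begin

text \<open>
  Elements of \<open>L\<^sup>2(\<Omega>)\<close> and \<open>H\<^sup>1(\<Omega>)\<close> are represented by total functions of which only the values on
  \<open>\<Omega>\<close> matter, up to null sets. Borel measurable representatives are used; every class of Lebesgue
  measurable functions modulo null sets contains one.
\<close>

definition L2 :: "'a::euclidean_space set \<Rightarrow> ('a \<Rightarrow> 'b::euclidean_space) \<Rightarrow> bool" where
  "L2 \<Omega> u \<longleftrightarrow> set_borel_measurable lborel \<Omega> u \<and> set_integrable lborel \<Omega> (\<lambda>x. (norm (u x))\<^sup>2)"

text \<open>\<open>C\<^sup>\<infinity>\<close>: differentiable, and all partial derivatives are again \<open>C\<^sup>\<infinity>\<close> (hence the coinduction).\<close>

coinductive smooth :: "('a::euclidean_space \<Rightarrow> real) \<Rightarrow> bool" where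
  "smooth f" if "\<forall>x. GDERIV f x :> g x" and "\<forall>b\<in>Basis. smooth (\<lambda>x. g x \<bullet> b)"

definition test_function :: "'a::euclidean_space set \<Rightarrow> ('a \<Rightarrow> real) \<Rightarrow> bool" where
  "test_function \<Omega> \<psi> \<longleftrightarrow>
     smooth \<psi> \<and> compact (closure {x. \<psi> x \<noteq> 0}) \<and> closure {x. \<psi> x \<noteq> 0} \<subseteq> \<Omega>"

text \<open>\<open>u \<in> H\<^sup>1(\<Omega>)\<close> with weak gradient \<open>g\<close>; the gradient is unique up to null sets.\<close>

definition H1_gradient :: "'a::euclidean_space set \<Rightarrow> ('a \<Rightarrow> real) \<Rightarrow> ('a \<Rightarrow> 'a) \<Rightarrow> bool" where
  "H1_gradient \<Omega> u g \<longleftrightarrow> L2 \<Omega> u \<and> L2 \<Omega> g \<and>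
     (\<forall>\<psi> D. test_function \<Omega> \<psi> \<longrightarrow> (\<forall>x. GDERIV \<psi> x :> D x) \<longrightarrow>
        (LINT x:\<Omega>|lborel. u x *\<^sub>R D x) = - (LINT x:\<Omega>|lborel. \<psi> x *\<^sub>R g x))"

definition H1 :: "'a::euclidean_space set \<Rightarrow> ('a \<Rightarrow> real) set" where
  "H1 \<Omega> = {u. \<exists>g. H1_gradient \<Omega> u g}"

definition rect :: "real \<Rightarrow> real \<Rightarrow> (real \<times> real) set" where
  "rect l L = {0<..<l} \<times> {0<..<L}"

text \<open>Integration over the boundary of the rectangle with respect to arc length: bottom, top, left
  and right side.\<close>

definition boundary_integral :: "real \<Rightarrow> real \<Rightarrow> (real \<times> real \<Rightarrow> real) \<Rightarrow> real" where
  "boundary_integral l L f =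
     (LINT x:{0..l}|lborel. f (x, 0)) + (LINT x:{0..l}|lborel. f (x, L)) +
     (LINT y:{0..L}|lborel. f (0, y)) + (LINT y:{0..L}|lborel. f (l, y))"

definition boundary_L2 :: "real \<Rightarrow> real \<Rightarrow> (real \<times> real \<Rightarrow> real) \<Rightarrow> bool" where
  "boundary_L2 l L f \<longleftrightarrow>
     L2 {0..l} (\<lambda>x. f (x, 0)) \<and> L2 {0..l} (\<lambda>x. f (x, L)) \<and>
     L2 {0..L} (\<lambda>y. f (0, y)) \<and> L2 {0..L} (\<lambda>y. f (l, y))"

text \<open>
  The graph of the trace operator from \<open>H\<^sup>1(\<Omega>)\<close> to \<open>L\<^sup>2(\<partial>\<Omega>)\<close>, i.e. of the continuous extension of the
  restriction map \<open>w \<mapsto> w|\<^bsub>\<partial>\<Omega>\<^esub>\<close> from functions that are \<open>C\<^sup>1\<close> up to the boundary. By the trace theorem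
  every \<open>u \<in> H\<^sup>1(\<Omega>)\<close> has exactly one trace up to null sets of \<open>\<partial>\<Omega>\<close>.
\<close>

definition has_trace :: "real \<Rightarrow> real \<Rightarrow> (real \<times> real \<Rightarrow> real) \<Rightarrow> (real \<times> real \<Rightarrow> real) \<Rightarrow> bool" where
  "has_trace l L u T \<longleftrightarrow> boundary_L2 l L T \<and>
     (\<exists>g (w :: nat \<Rightarrow> real \<times> real \<Rightarrow> real) Dw.
        H1_gradient (rect l L) u g \<and>
        (\<forall>k x. GDERIV (w k) x :> Dw k x) \<and> (\<forall>k. continuous_on UNIV (Dw k)) \<and>
        (\<lambda>k. LINT x:rect l L|lborel. (w k x - u x)\<^sup>2 + (norm (Dw k x - g x))\<^sup>2) \<longlonglongrightarrow> 0 \<and>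
        (\<lambda>k. boundary_integral l L (\<lambda>x. (w k x - T x)\<^sup>2)) \<longlonglongrightarrow> 0)"

text \<open>
  Weak solutions of \<open>-\<Delta>\<phi> = \<mu>\<phi>\<close> in \<open>\<Omega>\<close>, \<open>\<partial>\<^sub>\<nu>\<phi> + \<alpha>\<phi> = 0\<close> on \<open>\<partial>\<Omega>\<close> (including \<open>\<phi> = 0\<close>). Here \<open>g\<close>, \<open>h\<close> are
  the weak gradients and \<open>T\<close>, \<open>S\<close> the traces of \<open>\<phi>\<close> and \<open>v\<close>, respectively.
\<close>

definition robin_eigenspace :: "real \<Rightarrow> real \<Rightarrow> real \<Rightarrow> real \<Rightarrow> (real \<times> real \<Rightarrow> real) set" where
  "robin_eigenspace l L \<alpha> \<mu> = {\<phi> \<in> H1 (rect l L).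
     \<exists>g T. H1_gradient (rect l L) \<phi> g \<and> has_trace l L \<phi> T \<and>
       (\<forall>v\<in>H1 (rect l L). \<forall>h S. H1_gradient (rect l L) v h \<longrightarrow> has_trace l L v S \<longrightarrow>
          (LINT x:rect l L|lborel. g x \<bullet> h x) + \<alpha> * boundary_integral l L (\<lambda>x. T x * S x)
            = \<mu> * (LINT x:rect l L|lborel. \<phi> x * v x))}"

definition robin_eigenvalue :: "real \<Rightarrow> real \<Rightarrow> real \<Rightarrow> real \<Rightarrow> bool" where
  "robin_eigenvalue l L \<alpha> \<mu> \<longleftrightarrow>
     (\<exists>\<phi>\<in>robin_eigenspace l L \<alpha> \<mu>. \<not> (AE x\<in>rect l L in lborel. \<phi> x = 0))"

text \<open>The linear space \<open>V\<close> of functions, modulo equality almost everywhere on \<open>\<Omega>\<close>, has a basis of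
  \<open>k\<close> elements.\<close>

definition has_ae_dim :: "'a::euclidean_space set \<Rightarrow> ('a \<Rightarrow> real) set \<Rightarrow> nat \<Rightarrow> bool" where
  "has_ae_dim \<Omega> V k \<longleftrightarrow>
     (\<exists>b :: nat \<Rightarrow> 'a \<Rightarrow> real. (\<forall>i<k. b i \<in> V) \<and>
        (\<forall>c. (AE x\<in>\<Omega> in lborel. (\<Sum>i<k. c i * b i x) = 0) \<longrightarrow> (\<forall>i<k. c i = 0)) \<and>
        (\<forall>u\<in>V. \<exists>c. AE x\<in>\<Omega> in lborel. u x = (\<Sum>i<k. c i * b i x)))"

definition robin_simple :: "real \<Rightarrow> real \<Rightarrow> real \<Rightarrow> real \<Rightarrow> bool" where
  "robin_simple l L \<alpha> \<mu> \<longleftrightarrow>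
     robin_eigenvalue l L \<alpha> \<mu> \<and> has_ae_dim (rect l L) (robin_eigenspace l L \<alpha> \<mu>) 1"

text \<open>All eigenvalues in nondecreasing order, repeated according to multiplicity. The numbering starts
  at \<open>0\<close>. Finiteness is demanded since \<open>card\<close> of an infinite set is \<open>0\<close>.\<close>

definition robin_enumeration :: "real \<Rightarrow> real \<Rightarrow> real \<Rightarrow> (nat \<Rightarrow> real) \<Rightarrow> bool" where
  "robin_enumeration l L \<alpha> lam \<longleftrightarrow> mono lam \<and> range lam = {\<mu>. robin_eigenvalue l L \<alpha> \<mu>} \<and>
     (\<forall>\<mu>. robin_eigenvalue l L \<alpha> \<mu> \<longrightarrow> finite {n. lam n = \<mu>} \<and>
        has_ae_dim (rect l L) (robin_eigenspace l L \<alpha> \<mu>) (card {n. lam n = \<mu>}))"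

definition robin_lambda :: "real \<Rightarrow> real \<Rightarrow> real \<Rightarrow> nat \<Rightarrow> real" where
  "robin_lambda l L \<alpha> = (THE lam. robin_enumeration l L \<alpha> lam)"

end

theory Submission
  imports Defs
begin

text \<open>
  Separation of variables reduces the Robin problem on the rectangle to two interval problems. On
  \<open>(0,l)\<close> the modes are \<open>k cos(kx) + \<alpha> sin(kx)\<close>, a multiple of \<open>sin(kx + \<theta>)\<close> with \<open>tan \<theta> = k/\<alpha>\<close>, and
  the condition at the right end says that \<open>k l + 2 arctan(k/\<alpha>)\<close> is a multiple of \<open>\<pi>\<close>. This determines
  one frequency \<open>k\<^sub>i\<close> strictly between \<open>i \<pi>/l\<close> and \<open>(i+1) \<pi>/l\<close> for each \<open>i\<close> (\<open>robin_freq\<close>). The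
  eigenvalues of the rectangle are the sums of squares of two frequencies, one for each side, counted
  by pairs of indices; the enumerated eigenvalue is simple when exactly one pair produces it.

  Simplicity for large \<open>\<alpha>\<close> is a first-order perturbation argument at the Dirichlet problem. As
  \<open>\<alpha> \<rightarrow> \<infinity>\<close>, the eigenvalue of a pair, with squared Dirichlet frequencies \<open>A\<close> and \<open>B\<close> in the two
  directions, equals \<open>A + B - (4/\<alpha>) (A/l + B/L) + o(1/\<alpha>)\<close> (\<open>rect_value_asymptotics\<close>). Two pairs with
  the same \<open>A + B\<close> and the same \<open>A/l + B/L\<close> have the same \<open>A\<close> and \<open>B\<close>, because \<open>l \<noteq> L\<close>
  (\<open>dirichlet_value_correction_inj\<close>). So any two pairs eventually produce different eigenvalues. The
  bounds on the frequencies are uniform in \<open>\<alpha>\<close>; hence the \<open>n\<close>-th eigenvalue stays below its Dirichlet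
  bound, only a fixed finite set of pairs can produce it, and finitely many comparisons suffice.

  The main work is to show that the weak eigenspaces contain nothing but the product modes. Green's
  formula for \<open>H\<^sup>1\<close> functions with traces (\<open>green_H1\<close>), applied to the gradient of a mode, makes an
  eigenfunction orthogonal to every mode of a different eigenvalue. It remains to know that the modes
  are complete. On an interval this follows from a dimension count: let \<open>r\<close> be orthogonal to the first
  \<open>N\<close> modes. Some nontrivial combination \<open>g\<close> of \<open>r\<close> and these modes vanishes at the midpoints of \<open>N\<close>
  equal cells, and so \<open>\<integral>g'\<^sup>2 \<ge> \<kappa>\<^sup>2 \<integral>g\<^sup>2\<close> if \<open>0 < \<kappa> < N \<pi>/l\<close>. For \<open>\<kappa>\<close> above the first \<open>N\<close> frequencies
  the Robin form minus \<open>\<kappa>\<^sup>2 \<integral>g\<^sup>2\<close> is negative on each of these modes, and it is diagonal in \<open>r\<close> and the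
  modes; hence it must be nonnegative on \<open>r\<close> (\<open>shifted_energy_nonneg\<close>).
  As \<open>N\<close> grows, the remainders of the mode expansion of a \<open>C\<^sup>1\<close> function tend to zero, even uniformly
  (\<open>robin_modes_uniformly_dense\<close>). An integrable function on the rectangle that is orthogonal to all
  product modes is therefore orthogonal to all products of \<open>C\<^sup>1\<close> functions, in particular to smooth
  approximations of indicator functions of boxes, and it vanishes almost everywhere
  (\<open>rect_modes_complete\<close>).
\<close>

section \<open>Homogeneous linear systems\<close>

text \<open>
  Gaussian elimination, by induction on the number of equations. It supplies the combinations that
  vanish at prescribed points, and it shows that the dimension of a space of functions is well defined.
\<close>

lemma homogeneous_system_nontrivial_solution:
  fixes A :: "nat \<Rightarrow> 'j \<Rightarrow> real"
  assumes "finite J" "N < card J"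
  shows "\<exists>c. (\<exists>j\<in>J. c j \<noteq> 0) \<and> (\<forall>i<N. (\<Sum>j\<in>J. A i j * c j) = 0)"
  using assms
proof (induction N arbitrary: A J)
  case 0
  then have "J \<noteq> {}" by auto
  then show ?case by (intro exI[of _ "\<lambda>_. 1"]) auto
next
  case (Suc N)
  show ?case
  proof (cases "\<forall>j\<in>J. A N j = 0")
    case True
    have "N < card J" using Suc.prems by simp
    from Suc.IH[OF Suc.prems(1) this, of A] obtain c
      where c: "\<exists>j\<in>J. c j \<noteq> 0" "\<forall>i<N. (\<Sum>j\<in>J. A i j * c j) = 0" by blast
    have "(\<Sum>j\<in>J. A i j * c j) = 0" if "i < Suc N" for i
      using that c(2) True by (cases "i = N") auto
    then show ?thesis using c(1) by blast
  next
    case False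
    then obtain p where p: "p \<in> J" "A N p \<noteq> 0" by blast
    let ?J = "J - {p}"
    define B where "B i j = A i j - A i p * A N j / A N p" for i j
    have "finite ?J" "N < card ?J" using Suc.prems p by auto
    from Suc.IH[OF this, of B] obtain c
      where c: "\<exists>j\<in>?J. c j \<noteq> 0" "\<forall>i<N. (\<Sum>j\<in>?J. B i j * c j) = 0" by blast
    define d where "d = c(p := - (\<Sum>j\<in>?J. A N j * c j) / A N p)"
    have split: "(\<Sum>j\<in>J. A i j * d j) = A i p * d p + (\<Sum>j\<in>?J. A i j * c j)" for i
      using p(1) Suc.prems(1) by (subst sum.remove[of _ p]) (auto simp: d_def intro!: sum.cong)
    have "(\<Sum>j\<in>J. A i j * d j) = 0" if "i < Suc N" for i
    proof (cases "i = N")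
      case True
      then show ?thesis using split[of N] p by (simp add: d_def)
    next
      case False
      then have "0 = (\<Sum>j\<in>?J. B i j * c j)" using c(2) that by simp
      also have "\<dots> = (\<Sum>j\<in>?J. A i j * c j) - A i p / A N p * (\<Sum>j\<in>?J. A N j * c j)"
        by (simp add: B_def algebra_simps sum_subtractf sum_distrib_left)
      finally show ?thesis using split[of i] by (simp add: d_def)
    qed
    moreover have "\<exists>j\<in>J. d j \<noteq> 0" using c(1) by (auto simp: d_def)
    ultimately show ?thesis by blast
  qed
qed

section \<open>Poincare inequalities on an interval\<close>

definition C1 :: "(real \<Rightarrow> real) \<Rightarrow> (real \<Rightarrow> real) \<Rightarrow> bool" where
  "C1 f f' \<longleftrightarrow> (\<forall>x. (f has_real_derivative f' x) (at x)) \<and> continuous_on UNIV f'"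

lemma C1_deriv: "C1 f f' \<Longrightarrow> (f has_real_derivative f' x) (at x within S)"
  by (auto simp: C1_def intro: has_field_derivative_at_within)

lemma C1_cont: "C1 f f' \<Longrightarrow> continuous_on S f"
  by (auto simp: C1_def intro!: continuous_at_imp_continuous_on DERIV_isCont)

lemma C1_cont': "C1 f f' \<Longrightarrow> continuous_on S f'"
  by (auto simp: C1_def intro: continuous_on_subset)

lemma C1_add: "C1 f f' \<Longrightarrow> C1 g g' \<Longrightarrow> C1 (\<lambda>x. f x + g x) (\<lambda>x. f' x + g' x)"
  by (auto simp: C1_def intro!: derivative_intros continuous_intros)

lemma C1_scale: "C1 f f' \<Longrightarrow> C1 (\<lambda>x. c * f x) (\<lambda>x. c * f' x)"
  unfolding C1_def by (auto intro!: derivative_eq_intros continuous_intros)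

lemma C1_sum: "finite I \<Longrightarrow> (\<And>i. i \<in> I \<Longrightarrow> C1 (f i) (f' i)) \<Longrightarrow>
    C1 (\<lambda>x. \<Sum>i\<in>I. f i x) (\<lambda>x. \<Sum>i\<in>I. f' i x)"
proof (induction I rule: finite_induct)
  case empty
  show ?case by (simp add: C1_def)
next
  case (insert i I)
  then show ?case by (simp add: C1_add)
qed

lemma C1_affine: "C1 f f' \<Longrightarrow> C1 (\<lambda>x. f (s * x + c)) (\<lambda>x. s * f' (s * x + c))"
proof -
  assume f: "C1 f f'"
  have "((\<lambda>x. f (s * x + c)) has_real_derivative (f' (s * x + c) * s)) (at x)" for x
    by (rule DERIV_chain2[where g="\<lambda>x. s * x + c"]) (auto intro!: derivative_eq_intros C1_deriv[OF f])
  moreover have "continuous_on UNIV (\<lambda>x. s * f' (s * x + c))"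
    by (intro continuous_intros continuous_on_compose2[OF C1_cont'[OF f, of UNIV]]) auto
  ultimately show ?thesis by (simp add: C1_def mult.commute)
qed

lemma C1_mult: "C1 f f' \<Longrightarrow> C1 g g' \<Longrightarrow> C1 (\<lambda>x. f x * g x) (\<lambda>x. f' x * g x + g' x * f x)"
  using C1_cont[of f f' UNIV] C1_cont[of g g' UNIV]
  unfolding C1_def by (auto intro!: derivative_eq_intros continuous_intros)

lemma FTC_has_integral:
  assumes "a \<le> b" "\<And>x. x \<in> {a..b} \<Longrightarrow> (f has_real_derivative f' x) (at x within {a..b})"
  shows "(f' has_integral (f b - f a)) {a..b}"
  using assms by (intro fundamental_theorem_of_calculus)
    (auto simp: has_real_derivative_iff_has_vector_derivative)

text \<open>
  If \<open>p' = - \<kappa>\<^sup>2 - p\<^sup>2\<close>, then \<open>(g' - p g)\<^sup>2 = g'\<^sup>2 - \<kappa>\<^sup>2 g\<^sup>2 - (p g\<^sup>2)'\<close>, and the left-hand side is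
  nonnegative.
\<close>

lemma riccati_inequality:
  assumes g: "C1 g g'" and ab: "a \<le> b"
    and p: "\<And>x. x \<in> {a..b} \<Longrightarrow> (p has_real_derivative (- \<kappa>\<^sup>2 - (p x)\<^sup>2)) (at x)"
  shows "\<kappa>\<^sup>2 * integral {a..b} (\<lambda>x. (g x)\<^sup>2) + ((g b)\<^sup>2 * p b - (g a)\<^sup>2 * p a)
           \<le> integral {a..b} (\<lambda>x. (g' x)\<^sup>2)"
proof -
  have cg: "continuous_on {a..b} g" "continuous_on {a..b} g'" using g C1_cont C1_cont' by blast+
  have D: "((\<lambda>x. 2 * g x * g' x * p x + (g x)\<^sup>2 * (- \<kappa>\<^sup>2 - (p x)\<^sup>2)) has_integral
             ((g b)\<^sup>2 * p b - (g a)\<^sup>2 * p a)) {a..b}"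
    by (rule FTC_has_integral[OF ab])
      (auto intro!: derivative_eq_intros C1_deriv[OF g] has_field_derivative_at_within[OF p])
  have i: "((\<lambda>x. \<kappa>\<^sup>2 * (g x)\<^sup>2) has_integral (\<kappa>\<^sup>2 * integral {a..b} (\<lambda>x. (g x)\<^sup>2))) {a..b}"
    by (intro has_integral_mult_right integrable_integral integrable_continuous_interval continuous_intros cg)
  have "(\<lambda>x. (g' x)\<^sup>2) integrable_on {a..b}"
    by (intro integrable_continuous_interval continuous_intros cg)
  moreover have "\<kappa>\<^sup>2 * (g x)\<^sup>2 + (2 * g x * g' x * p x + (g x)\<^sup>2 * (- \<kappa>\<^sup>2 - (p x)\<^sup>2)) \<le> (g' x)\<^sup>2" for x
    using sum_squares_bound[of "g x * p x" "g' x"] by (simp add: algebra_simps power2_eq_square)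
  ultimately show ?thesis
    using has_integral_le[OF has_integral_add[OF i D] integrable_integral] by auto
qed

text \<open>
  A function that vanishes at one end of an interval of length \<open>\<delta>\<close> satisfies this inequality for all
  \<open>\<kappa> < \<pi> / (2 \<delta>)\<close>; here the two halves of a cell have the common end \<open>m\<close>. The Riccati function for
  each half is chosen to vanish at the outer end, where nothing is known about \<open>g\<close>, and the boundary
  term at \<open>m\<close> vanishes with \<open>g\<close>.
\<close>

lemma poincare_midpoint:
  assumes g: "C1 g g'" and "g m = 0" and d: "\<delta> > 0" and k: "\<kappa> > 0" "\<kappa> * \<delta> < pi / 2"
  shows "\<kappa>\<^sup>2 * integral {m-\<delta>..m+\<delta>} (\<lambda>x. (g x)\<^sup>2) \<le> integral {m-\<delta>..m+\<delta>} (\<lambda>x. (g' x)\<^sup>2)"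
proof -
  define p where "p c x = - \<kappa> * tan (\<kappa> * (x - c))" for c x
  have p: "(p c has_real_derivative (- \<kappa>\<^sup>2 - (p c x)\<^sup>2)) (at x)" if "\<bar>x - c\<bar> \<le> \<delta>" for c x
  proof -
    have "\<kappa> * \<bar>x - c\<bar> < pi / 2"
      using k that mult_left_mono[of "\<bar>x - c\<bar>" \<delta> \<kappa>] by linarith
    then have "\<bar>\<kappa> * (x - c)\<bar> < pi / 2" using k by (simp add: abs_mult)
    then have c: "cos (\<kappa> * (x - c)) > 0" by (intro cos_gt_zero_pi) auto
    have "(p c has_real_derivative (- \<kappa> * (inverse ((cos (\<kappa> * (x - c)))\<^sup>2) * \<kappa>))) (at x)"
      unfolding p_def by (rule derivative_eq_intros refl | use c in simp)+
    moreover have "inverse ((cos (\<kappa> * (x - c)))\<^sup>2) = 1 + (tan (\<kappa> * (x - c)))\<^sup>2"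
      using c by (subst tan_sec) (auto simp: power_inverse)
    ultimately show ?thesis by (simp add: p_def algebra_simps power2_eq_square)
  qed
  have R: "\<kappa>\<^sup>2 * integral {m..m+\<delta>} (\<lambda>x. (g x)\<^sup>2) \<le> integral {m..m+\<delta>} (\<lambda>x. (g' x)\<^sup>2)"
    using riccati_inequality[OF g, of m "m+\<delta>" "p (m+\<delta>)" \<kappa>] p[of _ "m+\<delta>"] d \<open>g m = 0\<close>
    by (auto simp: p_def)
  have L: "\<kappa>\<^sup>2 * integral {m-\<delta>..m} (\<lambda>x. (g x)\<^sup>2) \<le> integral {m-\<delta>..m} (\<lambda>x. (g' x)\<^sup>2)"
    using riccati_inequality[OF g, of "m-\<delta>" m "p (m-\<delta>)" \<kappa>] p[of _ "m-\<delta>"] d \<open>g m = 0\<close>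
    by (auto simp: p_def)
  have "integral {m-\<delta>..m} f + integral {m..m+\<delta>} f = integral {m-\<delta>..m+\<delta>} f"
    if "continuous_on UNIV f" for f :: "real \<Rightarrow> real"
    using d that by (intro Henstock_Kurzweil_Integration.integral_combine integrable_continuous_interval)
       (auto intro: continuous_on_subset)
  from this[of "\<lambda>x. (g x)\<^sup>2"] this[of "\<lambda>x. (g' x)\<^sup>2"] add_mono[OF L R] show ?thesis
    using C1_cont[OF g, of UNIV] C1_cont'[OF g, of UNIV]
    by (simp add: continuous_on_power flip: distrib_left)
qed

text \<open>
  The interval is cut into \<open>N\<close> equal cells. For the comparison with Robin modes it is essential that
  \<open>N\<close> linear conditions on \<open>g\<close> give the inequality up to the sharp bound \<open>N \<pi> / l\<close>, which lies above the
  first \<open>N\<close> Robin frequencies.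
\<close>

lemma poincare_vanishing_at_cell_midpoints:
  assumes g: "C1 g g'" and l: "l > 0" and k: "\<kappa> > 0" "\<kappa> * l < real N * pi"
    and z: "\<And>j. j < N \<Longrightarrow> g ((real j + 1/2) * (l / real N)) = 0"
  shows "\<kappa>\<^sup>2 * integral {0..l} (\<lambda>x. (g x)\<^sup>2) \<le> integral {0..l} (\<lambda>x. (g' x)\<^sup>2)"
proof -
  have N: "N > 0" using k mult_pos_pos[OF k(1) l] by (cases N) auto
  define h where "h = l / real N"
  have h: "h > 0" using l N by (simp add: h_def)
  have kh: "\<kappa> * (h/2) < pi / 2" using k N by (simp add: h_def field_simps)
  have comb: "integral {0..real j*h} f + integral {real j*h..real (Suc j)*h} f = integral {0..real (Suc j)*h} f"
    if "continuous_on UNIV f" for f :: "real \<Rightarrow> real" and j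
    using h that by (intro Henstock_Kurzweil_Integration.integral_combine integrable_continuous_interval)
       (auto intro: continuous_on_subset simp: algebra_simps)
  have "j \<le> N \<Longrightarrow> \<kappa>\<^sup>2 * integral {0..real j*h} (\<lambda>x. (g x)\<^sup>2) \<le> integral {0..real j*h} (\<lambda>x. (g' x)\<^sup>2)" for j
  proof (induction j)
    case (Suc j)
    have e: "(real j + 1/2) * h - h/2 = real j*h" "(real j + 1/2) * h + h/2 = real (Suc j) * h"
      by (auto simp: algebra_simps)
    have "\<kappa>\<^sup>2 * integral {real j*h..real (Suc j)*h} (\<lambda>x. (g x)\<^sup>2)
        \<le> integral {real j*h..real (Suc j)*h} (\<lambda>x. (g' x)\<^sup>2)"
      using poincare_midpoint[OF g _ _ k(1) kh, of "(real j + 1/2) * h"] z[of j] Suc.prems h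
      unfolding e by (auto simp: h_def)
    moreover have "\<kappa>\<^sup>2 * integral {0..real j*h} (\<lambda>x. (g x)\<^sup>2) \<le> integral {0..real j*h} (\<lambda>x. (g' x)\<^sup>2)"
      using Suc by simp
    ultimately have "\<kappa>\<^sup>2 * (integral {0..real j*h} (\<lambda>x. (g x)\<^sup>2) + integral {real j*h..real (Suc j)*h} (\<lambda>x. (g x)\<^sup>2))
        \<le> integral {0..real j*h} (\<lambda>x. (g' x)\<^sup>2) + integral {real j*h..real (Suc j)*h} (\<lambda>x. (g' x)\<^sup>2)"
      unfolding distrib_left by (rule add_mono[rotated])
    then show ?case
      unfolding comb[OF continuous_on_power[OF C1_cont[OF g]]] comb[OF continuous_on_power[OF C1_cont'[OF g]]] .
  qed simp
  from this[of N] N show ?thesis by (simp add: h_def)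
qed

section \<open>The Robin problem on an interval\<close>

text \<open>
  The phase form of the secular equation \<open>(\<alpha>\<^sup>2 - k\<^sup>2) sin(kl) + 2 \<alpha> k cos(kl) = 0\<close>. The left-hand side
  is strictly increasing in \<open>k\<close>. The right-hand side is \<open>(i+1) \<pi>\<close> because the multiple \<open>0\<close> belongs to
  \<open>k = 0\<close>, for which the mode vanishes identically.
\<close>

definition robin_freq :: "real \<Rightarrow> real \<Rightarrow> nat \<Rightarrow> real" where
  "robin_freq l \<alpha> i = (THE k. k * l + 2 * arctan (k / \<alpha>) = (real i + 1) * pi)"

definition robin_mode :: "real \<Rightarrow> real \<Rightarrow> nat \<Rightarrow> real \<Rightarrow> real" where
  "robin_mode l \<alpha> i x = (let k = robin_freq l \<alpha> i in k * cos (k * x) + \<alpha> * sin (k * x))"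

definition robin_mode' :: "real \<Rightarrow> real \<Rightarrow> nat \<Rightarrow> real \<Rightarrow> real" where
  "robin_mode' l \<alpha> i x = (let k = robin_freq l \<alpha> i in k * (\<alpha> * cos (k * x) - k * sin (k * x)))"

lemma C1_robin_mode: "C1 (robin_mode l \<alpha> i) (robin_mode' l \<alpha> i)"
  unfolding C1_def robin_mode_def robin_mode'_def Let_def
  by (auto intro!: derivative_eq_intros continuous_intros simp: algebra_simps)

lemma C1_robin_mode': "C1 (robin_mode' l \<alpha> i) (\<lambda>x. - (robin_freq l \<alpha> i)\<^sup>2 * robin_mode l \<alpha> i x)"
  unfolding C1_def robin_mode_def robin_mode'_def Let_def
  by (auto intro!: derivative_eq_intros continuous_intros simp: algebra_simps power2_eq_square)

lemma robin_mode_left: "robin_mode' l \<alpha> i 0 = \<alpha> * robin_mode l \<alpha> i 0"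
  by (simp add: robin_mode_def robin_mode'_def Let_def)

lemma integral_square_add:
  fixes u v :: "real \<Rightarrow> real"
  assumes "continuous_on {0..l} u" "continuous_on {0..l} v"
  shows "integral {0..l} (\<lambda>x. (u x + a * v x)\<^sup>2) = integral {0..l} (\<lambda>x. (u x)\<^sup>2)
      + 2 * a * integral {0..l} (\<lambda>x. u x * v x) + a\<^sup>2 * integral {0..l} (\<lambda>x. (v x)\<^sup>2)"
proof -
  have "((\<lambda>x. (u x)\<^sup>2 + 2 * a * (u x * v x) + a\<^sup>2 * (v x)\<^sup>2) has_integral
      (integral {0..l} (\<lambda>x. (u x)\<^sup>2)
      + 2 * a * integral {0..l} (\<lambda>x. u x * v x) + a\<^sup>2 * integral {0..l} (\<lambda>x. (v x)\<^sup>2))) {0..l}"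
    by (intro has_integral_add has_integral_mult_right integrable_integral
        integrable_continuous_interval continuous_intros assms)
  then show ?thesis by (simp add: integral_unique power2_sum power_mult_distrib algebra_simps)
qed

context
  fixes l \<alpha> :: real
  assumes l: "l > 0" and \<alpha>: "\<alpha> > 0"
begin

abbreviation (input) "freq \<equiv> robin_freq l \<alpha>"
abbreviation (input) "mode \<equiv> robin_mode l \<alpha>"
abbreviation (input) "mode' \<equiv> robin_mode' l \<alpha>"

lemma phase_strict_mono: "x < y \<Longrightarrow> x * l + 2 * arctan (x / \<alpha>) < y * l + 2 * arctan (y / \<alpha>)"
  using l \<alpha> by (intro add_strict_mono) (auto simp: arctan_less_iff divide_strict_right_mono)

lemma robin_freq_phase: "freq i * l + 2 * arctan (freq i / \<alpha>) = (real i + 1) * pi"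
proof -
  define F where "F x = x * l + 2 * arctan (x / \<alpha>)" for x
  have "\<exists>x\<ge>0. x \<le> (real i + 1) * pi / l \<and> F x = (real i + 1) * pi"
    using l \<alpha> by (intro IVT') (auto simp: F_def intro!: continuous_intros)
  then obtain x where "F x = (real i + 1) * pi" by auto
  moreover have "y = x" if "F y = F x" for y
    using that phase_strict_mono[of x y] phase_strict_mono[of y x] by (cases x y rule: linorder_cases) (auto simp: F_def)
  ultimately show ?thesis
    unfolding robin_freq_def F_def by (metis (mono_tags, lifting) the_equality)
qed

lemma robin_freq_pos: "freq i > 0"
proof (rule ccontr)
  assume "\<not> freq i > 0"
  then have "freq i * l \<le> 0" "arctan (freq i / \<alpha>) \<le> 0"
    using l \<alpha> by (auto simp: mult_le_0_iff arctan_le_zero_iff divide_le_0_iff)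
  with robin_freq_phase[of i] show False
    by (smt (verit) mult_pos_pos of_nat_0_le_iff pi_gt_zero)
qed

lemma robin_freq_less: "freq i < (real i + 1) * pi / l"
proof -
  have "arctan (freq i / \<alpha>) > 0" using robin_freq_pos[of i] \<alpha> by simp
  with robin_freq_phase[of i] have "freq i * l < (real i + 1) * pi" by linarith
  then show ?thesis using l by (simp add: pos_less_divide_eq)
qed

lemma robin_freq_greater: "real i * pi / l < freq i"
proof -
  have "2 * arctan (freq i / \<alpha>) < pi" using arctan_ubound[of "freq i / \<alpha>"] by simp
  then have "real i * pi < freq i * l" using robin_freq_phase[of i] by (simp add: algebra_simps)
  then show ?thesis using l by (simp add: pos_divide_less_eq)
qed

lemma robin_freq_strict_mono: "strict_mono freq"
proof (rule strict_monoI_Suc)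
  fix i
  show "freq i < freq (Suc i)"
    using robin_freq_less[of i] robin_freq_greater[of "Suc i"] by (simp add: add.commute)
qed

lemma robin_mode_right: "mode' i l = - \<alpha> * mode i l"
proof -
  define t where "t = arctan (freq i / \<alpha>)"
  have s: "sin t * \<alpha> = freq i * cos t"
    using tan_arctan[of "freq i / \<alpha>"] cos_arctan_not_zero[of "freq i / \<alpha>"] \<alpha>
    by (simp add: t_def tan_def field_simps)
  have kl: "freq i * l = real (Suc i) * pi - 2 * t"
    using robin_freq_phase[of i] by (simp add: t_def algebra_simps)
  have c: "cos t \<noteq> 0" by (simp add: t_def)
  have S: "sin (freq i * l) = - cos (real (Suc i) * pi) * (2 * sin t * cos t)"
    unfolding kl sin_diff by (simp add: sin_npi sin_double del: of_nat_Suc)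
  have C: "cos (freq i * l) = cos (real (Suc i) * pi) * ((cos t)\<^sup>2 - (sin t)\<^sup>2)"
    unfolding kl cos_diff by (simp add: sin_npi cos_double del: of_nat_Suc)
  \<comment> \<open>The factor \<open>(cos t)\<^sup>2\<close> allows to replace \<open>k cos t\<close> by \<open>\<alpha> sin t\<close> in every term.\<close>
  have "((\<alpha>\<^sup>2 - (freq i)\<^sup>2) * (2 * sin t * cos t)) * (cos t)^2 = (2 * \<alpha> * freq i * ((cos t)\<^sup>2 - (sin t)\<^sup>2)) * (cos t)^2"
  proof -
    have "freq i * cos t = sin t * \<alpha>" using s by simp
    then show ?thesis by algebra
  qed
  then have "(\<alpha>\<^sup>2 - (freq i)\<^sup>2) * (2 * sin t * cos t) = 2 * \<alpha> * freq i * ((cos t)\<^sup>2 - (sin t)\<^sup>2)"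
    using c by simp
  then have "(\<alpha>\<^sup>2 - (freq i)\<^sup>2) * sin (freq i * l) + 2 * \<alpha> * freq i * cos (freq i * l) = 0"
    unfolding S C by algebra
  then show ?thesis
    by (simp add: robin_mode_def robin_mode'_def Let_def algebra_simps power2_eq_square)
qed

lemma robin_mode_norm_pos: "integral {0..l} (\<lambda>x. (mode i x)\<^sup>2) > 0"
proof -
  have c: "continuous_on {0..l} (\<lambda>x. (mode i x)\<^sup>2)"
    using C1_cont[OF C1_robin_mode] by (intro continuous_intros)
  have "integral {0..l} (\<lambda>x. (mode i x)\<^sup>2) \<noteq> 0"
  proof
    assume "integral {0..l} (\<lambda>x. (mode i x)\<^sup>2) = 0"
    then have "(mode i 0)\<^sup>2 = 0" using integral_eq_0_iff[OF c] l by auto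
    then show False using robin_freq_pos[of i] by (simp add: robin_mode_def Let_def)
  qed
  moreover have "integral {0..l} (\<lambda>x. (mode i x)\<^sup>2) \<ge> 0" by (intro integral_nonneg integrable_continuous_interval c) auto
  ultimately show ?thesis by simp
qed

text \<open>
  Integration by parts puts all derivatives on the mode, whose boundary conditions cancel the boundary
  terms. The identity therefore holds for every \<open>C\<^sup>1\<close> function \<open>u\<close>, whatever its boundary values.
\<close>

lemma robin_form_mode:
  assumes u: "C1 u u'"
  shows "integral {0..l} (\<lambda>x. u' x * mode' i x) + \<alpha> * (u 0 * mode i 0 + u l * mode i l)
           = (freq i)\<^sup>2 * integral {0..l} (\<lambda>x. u x * mode i x)"
proof -
  note cont = C1_cont[OF u] C1_cont'[OF u] C1_cont[OF C1_robin_mode] C1_cont[OF C1_robin_mode']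
  have "((\<lambda>x. u' x * mode' i x + u x * (- (freq i)\<^sup>2 * mode i x)) has_integral (u l * mode' i l - u 0 * mode' i 0)) {0..l}"
    by (rule FTC_has_integral) (use l in \<open>auto intro!: derivative_eq_intros C1_deriv[OF u] C1_deriv[OF C1_robin_mode']\<close>)
  moreover have "((\<lambda>x. u' x * mode' i x + (- (freq i)\<^sup>2) * (u x * mode i x)) has_integral
      (integral {0..l} (\<lambda>x. u' x * mode' i x) + (- (freq i)\<^sup>2) * integral {0..l} (\<lambda>x. u x * mode i x))) {0..l}"
    by (intro has_integral_add has_integral_mult_right integrable_integral
        integrable_continuous_interval continuous_intros cont)
  ultimately have "u l * mode' i l - u 0 * mode' i 0 =
      integral {0..l} (\<lambda>x. u' x * mode' i x) + (- (freq i)\<^sup>2) * integral {0..l} (\<lambda>x. u x * mode i x)"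
    by (intro has_integral_unique) (simp_all add: mult_ac)
  then show ?thesis by (simp add: robin_mode_left robin_mode_right algebra_simps)
qed

lemma robin_mode_orthogonal:
  assumes "i \<noteq> j"
  shows "integral {0..l} (\<lambda>x. mode i x * mode j x) = 0"
proof -
  have "(freq i)\<^sup>2 * integral {0..l} (\<lambda>x. mode i x * mode j x) = (freq j)\<^sup>2 * integral {0..l} (\<lambda>x. mode i x * mode j x)"
  proof -
    have "(\<lambda>x. mode j x * mode i x) = (\<lambda>x. mode i x * mode j x)" "(\<lambda>x. mode' j x * mode' i x) = (\<lambda>x. mode' i x * mode' j x)"
      by (simp_all add: mult.commute)
    with robin_form_mode[OF C1_robin_mode[of l \<alpha> i], of j] robin_form_mode[OF C1_robin_mode[of l \<alpha> j], of i]
    show ?thesis by (simp only: mult.commute[of "mode j 0"] mult.commute[of "mode j l"])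
  qed
  moreover have "freq i \<noteq> freq j" using robin_freq_strict_mono assms by (auto dest: strict_mono_eq)
  then have "(freq i)\<^sup>2 \<noteq> (freq j)\<^sup>2" using robin_freq_pos[of i] robin_freq_pos[of j] by simp
  ultimately show ?thesis by simp
qed

text \<open>
  The quadratic form of the Robin Laplacian minus \<open>\<kappa>\<^sup>2\<close>.
\<close>

definition shifted_energy :: "real \<Rightarrow> (real \<Rightarrow> real) \<Rightarrow> (real \<Rightarrow> real) \<Rightarrow> real" where
  "shifted_energy \<kappa> u u' = integral {0..l} (\<lambda>x. (u' x)\<^sup>2) + \<alpha> * ((u 0)\<^sup>2 + (u l)\<^sup>2)
     - \<kappa>\<^sup>2 * integral {0..l} (\<lambda>x. (u x)\<^sup>2)"

lemma shifted_energy_add_mode: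
  assumes u: "C1 u u'" and "integral {0..l} (\<lambda>x. u x * mode i x) = 0"
  shows "shifted_energy \<kappa> (\<lambda>x. u x + a * mode i x) (\<lambda>x. u' x + a * mode' i x)
    = shifted_energy \<kappa> u u' + a\<^sup>2 * ((freq i)\<^sup>2 - \<kappa>\<^sup>2) * integral {0..l} (\<lambda>x. (mode i x)\<^sup>2)"
proof -
  note cont = C1_cont[OF u] C1_cont'[OF u] C1_cont[OF C1_robin_mode] C1_cont[OF C1_robin_mode']
  have 1: "integral {0..l} (\<lambda>x. u' x * mode' i x) = - \<alpha> * (u 0 * mode i 0 + u l * mode i l)"
    using robin_form_mode[OF u, of i] assms(2) by simp
  have 2: "integral {0..l} (\<lambda>x. (mode' i x)\<^sup>2) =
      (freq i)\<^sup>2 * integral {0..l} (\<lambda>x. (mode i x)\<^sup>2) - \<alpha> * ((mode i 0)\<^sup>2 + (mode i l)\<^sup>2)"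
    using robin_form_mode[OF C1_robin_mode[of l \<alpha> i], of i] by (simp add: power2_eq_square algebra_simps)
  show ?thesis
    unfolding shifted_energy_def integral_square_add[OF cont(1,3)] integral_square_add[OF cont(2,4)] 1 2 assms(2)
    by (simp add: algebra_simps power2_eq_square)
qed

lemma integral_modes_orthogonal:
  assumes u: "C1 u u'" and "finite I" "i \<notin> I" and "integral {0..l} (\<lambda>x. u x * mode i x) = 0"
  shows "integral {0..l} (\<lambda>x. (u x + (\<Sum>j\<in>I. a j * mode j x)) * mode i x) = 0"
proof -
  note cont = C1_cont[OF u] C1_cont[OF C1_robin_mode]
  have "((\<lambda>x. u x * mode i x + (\<Sum>j\<in>I. a j * (mode j x * mode i x))) has_integral
      (integral {0..l} (\<lambda>x. u x * mode i x) + (\<Sum>j\<in>I. a j * integral {0..l} (\<lambda>x. mode j x * mode i x)))) {0..l}"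
    by (intro has_integral_add has_integral_sum has_integral_mult_right integrable_integral
        integrable_continuous_interval continuous_intros cont assms)
  moreover have "(\<Sum>j\<in>I. a j * integral {0..l} (\<lambda>x. mode j x * mode i x)) = 0"
    using assms(3) by (intro sum.neutral) (auto intro!: robin_mode_orthogonal)
  ultimately show ?thesis using assms(4)
    by (simp add: integral_unique distrib_right sum_distrib_right mult.assoc)
qed

lemma C1_add_modes: "C1 u u' \<Longrightarrow> finite I \<Longrightarrow>
    C1 (\<lambda>x. u x + (\<Sum>i\<in>I. a i * mode i x)) (\<lambda>x. u' x + (\<Sum>i\<in>I. a i * mode' i x))"
  by (intro C1_add C1_sum C1_scale C1_robin_mode)

text \<open>
  The form is diagonal: modes are orthogonal to each other and to \<open>u\<close> both in \<open>L\<^sup>2\<close> and, by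
  \<open>robin_form_mode\<close>, with respect to the energy.
\<close>

lemma shifted_energy_add_modes:
  assumes u: "C1 u u'" and "finite I" and "\<And>i. i \<in> I \<Longrightarrow> integral {0..l} (\<lambda>x. u x * mode i x) = 0"
  shows "shifted_energy \<kappa> (\<lambda>x. u x + (\<Sum>i\<in>I. a i * mode i x)) (\<lambda>x. u' x + (\<Sum>i\<in>I. a i * mode' i x))
    = shifted_energy \<kappa> u u' + (\<Sum>i\<in>I. (a i)\<^sup>2 * ((freq i)\<^sup>2 - \<kappa>\<^sup>2) * integral {0..l} (\<lambda>x. (mode i x)\<^sup>2))"
  using assms(2,3)
proof (induction I rule: finite_induct)
  case (insert i I)
  let ?v = "\<lambda>x. u x + (\<Sum>i\<in>I. a i * mode i x)" and ?v' = "\<lambda>x. u' x + (\<Sum>i\<in>I. a i * mode' i x)"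
  have "shifted_energy \<kappa> (\<lambda>x. ?v x + a i * mode i x) (\<lambda>x. ?v' x + a i * mode' i x) =
      shifted_energy \<kappa> ?v ?v' + (a i)\<^sup>2 * ((freq i)\<^sup>2 - \<kappa>\<^sup>2) * integral {0..l} (\<lambda>x. (mode i x)\<^sup>2)"
    using insert by (intro shifted_energy_add_mode C1_add_modes u integral_modes_orthogonal[OF u]) auto
  with insert show ?case by (simp add: algebra_simps)
qed simp

text \<open>
  The dimension count. The \<open>N\<close> midpoint conditions leave a nontrivial combination \<open>g\<close> of the \<open>N + 1\<close>
  functions \<open>r\<close> and \<open>mode i\<close>, \<open>i < N\<close>, and \<open>g\<close> has nonnegative shifted energy. Each mode contributes a
  negative amount, so the contribution of \<open>r\<close> is nonnegative and its coefficient is not zero.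
\<close>

lemma shifted_energy_nonneg:
  assumes r: "C1 r r'" and orth: "\<And>i. i < N \<Longrightarrow> integral {0..l} (\<lambda>x. r x * mode i x) = 0"
    and \<kappa>: "\<And>i. i < N \<Longrightarrow> freq i < \<kappa>" "\<kappa> > 0" "\<kappa> * l < real N * pi"
  shows "shifted_energy \<kappa> r r' \<ge> 0"
proof -
  define m where "m j = (real j + 1/2) * (l / real N)" for j
  obtain c where c: "\<exists>j\<in>{..N}. c j \<noteq> 0"
    "\<And>j. j < N \<Longrightarrow> (\<Sum>i\<le>N. (if i = N then r (m j) else mode i (m j)) * c i) = 0"
    using homogeneous_system_nontrivial_solution[of "{..N}" N "\<lambda>j i. if i = N then r (m j) else mode i (m j)"]
    by auto
  define g where "g x = c N * r x + (\<Sum>i<N. c i * mode i x)" for x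
  define g' where "g' x = c N * r' x + (\<Sum>i<N. c i * mode' i x)" for x
  have g: "C1 g g'" unfolding g_def[abs_def] g'_def[abs_def] by (intro C1_add_modes C1_scale r) auto
  have "g (m j) = 0" if "j < N" for j
    using c(2)[OF that] by (simp add: g_def mult.commute flip: lessThan_Suc_atMost)
  then have *: "\<kappa>\<^sup>2 * integral {0..l} (\<lambda>x. (g x)\<^sup>2) \<le> integral {0..l} (\<lambda>x. (g' x)\<^sup>2)"
    using \<kappa> by (intro poincare_vanishing_at_cell_midpoints[OF g l]) (auto simp: m_def)
  have "0 \<le> shifted_energy \<kappa> g g'"
  proof -
    have "0 \<le> \<alpha> * ((g 0)\<^sup>2 + (g l)\<^sup>2)" using \<alpha> by simp
    with * show ?thesis unfolding shifted_energy_def by linarith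
  qed
  also have "shifted_energy \<kappa> g g' = shifted_energy \<kappa> (\<lambda>x. c N * r x) (\<lambda>x. c N * r' x) +
      (\<Sum>i<N. (c i)\<^sup>2 * ((freq i)\<^sup>2 - \<kappa>\<^sup>2) * integral {0..l} (\<lambda>x. (mode i x)\<^sup>2))"
    unfolding g_def[abs_def] g'_def[abs_def]
    by (intro shifted_energy_add_modes C1_scale r) (auto simp: orth mult.assoc)
  also have "shifted_energy \<kappa> (\<lambda>x. c N * r x) (\<lambda>x. c N * r' x) = (c N)\<^sup>2 * shifted_energy \<kappa> r r'"
    by (simp add: shifted_energy_def power_mult_distrib algebra_simps)
  finally have ge: "0 \<le> (c N)\<^sup>2 * shifted_energy \<kappa> r r' +
      (\<Sum>i<N. (c i)\<^sup>2 * ((freq i)\<^sup>2 - \<kappa>\<^sup>2) * integral {0..l} (\<lambda>x. (mode i x)\<^sup>2))" .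
  have neg: "((freq i)\<^sup>2 - \<kappa>\<^sup>2) * integral {0..l} (\<lambda>x. (mode i x)\<^sup>2) < 0" if "i < N" for i
    using \<kappa>(1)[OF that] robin_freq_pos[of i] robin_mode_norm_pos[of i]
    by (intro mult_neg_pos) (auto intro!: power_strict_mono)
  have le: "(c i)\<^sup>2 * ((freq i)\<^sup>2 - \<kappa>\<^sup>2) * integral {0..l} (\<lambda>x. (mode i x)\<^sup>2) \<le> 0" if "i < N" for i
    unfolding mult.assoc by (rule mult_nonneg_nonpos[OF _ less_imp_le[OF neg[OF that]]]) simp
  have "c N \<noteq> 0"
  proof
    assume 0: "c N = 0"
    then obtain i where i: "i < N" "c i \<noteq> 0" using c(1) by (metis atMost_iff le_neq_implies_less)
    then have "(\<Sum>i<N. (c i)\<^sup>2 * ((freq i)\<^sup>2 - \<kappa>\<^sup>2) * integral {0..l} (\<lambda>x. (mode i x)\<^sup>2)) < (\<Sum>i<N. 0)"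

      using mult_pos_neg[OF _ neg[OF i(1)], of "(c i)\<^sup>2"]
      by (intro sum_strict_mono_ex1) (auto simp: le simp flip: mult.assoc intro!: bexI[of _ i])
    with ge 0 show False by simp
  qed
  moreover have "(\<Sum>i<N. (c i)\<^sup>2 * ((freq i)\<^sup>2 - \<kappa>\<^sup>2) * integral {0..l} (\<lambda>x. (mode i x)\<^sup>2)) \<le> 0"
    by (intro sum_nonpos le) auto
  with ge have "0 \<le> (c N)\<^sup>2 * shifted_energy \<kappa> r r'" by linarith
  ultimately show ?thesis by (simp add: zero_le_mult_iff)
qed

text \<open>
  Since \<open>r(x)\<^sup>2 - r(y)\<^sup>2\<close> is the integral of \<open>2 r r'\<close>, it is at most \<open>\<delta> \<integral>r'\<^sup>2 + (1/\<delta>) \<integral>r\<^sup>2\<close>. Integrating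
  over \<open>y\<close> gives the claim.
\<close>

lemma sup_bound_by_energy:
  assumes r: "C1 r r'" and x: "x \<in> {0..l}" and \<delta>: "\<delta> > 0"
  shows "l * (r x)\<^sup>2 \<le> integral {0..l} (\<lambda>y. (r y)\<^sup>2)
     + l * (\<delta> * integral {0..l} (\<lambda>y. (r' y)\<^sup>2) + integral {0..l} (\<lambda>y. (r y)\<^sup>2) / \<delta>)"
proof -
  note cont = C1_cont[OF r] C1_cont'[OF r]
  define E where "E y = \<delta> * (r' y)\<^sup>2 + (r y)\<^sup>2 / \<delta>" for y
  have E: "\<bar>2 * r y * r' y\<bar> \<le> E y" for y
  proof -
    have "2 * (\<bar>r y\<bar> / sqrt \<delta>) * (sqrt \<delta> * \<bar>r' y\<bar>) \<le> (\<bar>r y\<bar> / sqrt \<delta>)\<^sup>2 + (sqrt \<delta> * \<bar>r' y\<bar>)\<^sup>2"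
      by (rule sum_squares_bound)
    then show ?thesis using \<delta> by (simp add: E_def power_mult_distrib power_divide abs_mult)
  qed
  have Ec: "continuous_on S E" for S unfolding E_def using \<delta> by (intro continuous_intros cont) auto
  have Eint: "E integrable_on {a..b}" for a b by (intro integrable_continuous_interval Ec)
  have E0: "E y \<ge> 0" for y using E[of y] by linarith
  have seg: "\<bar>(r b)\<^sup>2 - (r a)\<^sup>2\<bar> \<le> integral {0..l} E" if "a \<le> b" "0 \<le> a" "b \<le> l" for a b
  proof -
    have "((\<lambda>y. 2 * r y * r' y) has_integral ((r b)\<^sup>2 - (r a)\<^sup>2)) {a..b}"
      by (rule FTC_has_integral[OF that(1)]) (auto intro!: derivative_eq_intros C1_deriv[OF r])
    then have "norm ((r b)\<^sup>2 - (r a)\<^sup>2) \<le> integral {a..b} E"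
      using integral_norm_bound_integral[of "\<lambda>y. 2 * r y * r' y" "{a..b}" E] E Eint
      by (auto simp: has_integral_iff)
    also have "\<dots> \<le> integral {0..l} E"
      using that E0 Eint by (intro integral_subset_le) auto
    finally show ?thesis by simp
  qed
  have pt: "(r x)\<^sup>2 - integral {0..l} E \<le> (r y)\<^sup>2" if "y \<in> {0..l}" for y
    using seg[of x y] seg[of y x] x that by (cases "x \<le> y") auto
  have "integral {0..l} (\<lambda>y. (r x)\<^sup>2 - integral {0..l} E) \<le> integral {0..l} (\<lambda>y. (r y)\<^sup>2)"
    by (intro integral_le pt integrable_continuous_interval continuous_intros cont)
  then have "l * ((r x)\<^sup>2 - integral {0..l} E) \<le> integral {0..l} (\<lambda>y. (r y)\<^sup>2)" using l by simp
  moreover have "integral {0..l} E = \<delta> * integral {0..l} (\<lambda>y. (r' y)\<^sup>2) + integral {0..l} (\<lambda>y. (r y)\<^sup>2) / \<delta>"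
    unfolding E_def divide_inverse mult.commute[of _ "inverse \<delta>"]
    by (intro integral_unique has_integral_add has_integral_mult_right integrable_integral
        integrable_continuous_interval continuous_intros cont)
  ultimately show ?thesis by (simp add: algebra_simps)
qed

text \<open>
  The remainder \<open>r\<^sub>N\<close> of the mode expansion of \<open>g\<close> has at most the energy \<open>Q\<close> of \<open>g\<close>, and by
  \<open>shifted_energy_nonneg\<close> its squared \<open>L\<^sup>2\<close> norm is at most \<open>Q / \<kappa>\<^sup>2\<close> with \<open>\<kappa>\<close> of order \<open>N\<close>. The choice
  \<open>\<delta> = 1/\<kappa>\<close> in \<open>sup_bound_by_energy\<close> turns this into a uniform bound of order \<open>1/\<kappa>\<close> for \<open>r\<^sub>N\<^sup>2\<close>.
\<close>

theorem robin_modes_uniformly_dense: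
  assumes g: "C1 g g'" and e: "e > 0"
  shows "\<exists>N a. \<forall>x\<in>{0..l}. \<bar>g x - (\<Sum>i<N. a i * mode i x)\<bar> < e"
proof -
  define n where "n i = integral {0..l} (\<lambda>x. (mode i x)\<^sup>2)" for i
  have n: "n i > 0" for i using robin_mode_norm_pos by (simp add: n_def)
  define a where "a i = integral {0..l} (\<lambda>x. g x * mode i x) / n i" for i
  define r where "r N x = g x + (\<Sum>i<N. - a i * mode i x)" for N x
  define r' where "r' N x = g' x + (\<Sum>i<N. - a i * mode' i x)" for N x
  have r: "C1 (r N) (r' N)" for N
    unfolding r_def[abs_def] r'_def[abs_def] by (intro C1_add_modes g) auto
  note gc = C1_cont[OF g] C1_cont[OF C1_robin_mode]
  have orth: "integral {0..l} (\<lambda>x. r N x * mode i x) = 0" if "i < N" for i N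
  proof -
    have "integral {0..l} (\<lambda>x. (g x + - a i * mode i x) * mode i x) =
        integral {0..l} (\<lambda>x. g x * mode i x + - a i * (mode i x)\<^sup>2)"
      by (simp add: algebra_simps power2_eq_square)
    also have "\<dots> = integral {0..l} (\<lambda>x. g x * mode i x) + - a i * n i"
      unfolding n_def by (intro integral_unique has_integral_add has_integral_mult_right integrable_integral
        integrable_continuous_interval continuous_intros gc)
    also have "\<dots> = 0" using n[of i] by (simp add: a_def)
    finally have "integral {0..l} (\<lambda>x. (g x + - a i * mode i x) * mode i x) = 0" .
    from integral_modes_orthogonal[OF C1_add[OF g C1_scale[OF C1_robin_mode[of l \<alpha> i], where c="- a i"]], where I="{..<N} - {i}" and i=i and a="\<lambda>i. - a i"] this
    have "integral {0..l} (\<lambda>x. (g x + - a i * mode i x + (\<Sum>j\<in>{..<N} - {i}. - a j * mode j x)) * mode i x) = 0"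
      by simp
    moreover have "r N x = g x + - a i * mode i x + (\<Sum>j\<in>{..<N} - {i}. - a j * mode j x)" for x
      unfolding r_def using that by (subst sum.remove[of _ i]) auto
    ultimately show ?thesis by simp
  qed
  define Q where "Q = shifted_energy 0 g g'"
  have energy: "shifted_energy 0 (r N) (r' N) \<le> Q" for N
  proof -
    have "shifted_energy 0 (\<lambda>x. r N x + (\<Sum>i<N. a i * mode i x)) (\<lambda>x. r' N x + (\<Sum>i<N. a i * mode' i x))
      = shifted_energy 0 (r N) (r' N) + (\<Sum>i<N. (a i)\<^sup>2 * ((freq i)\<^sup>2 - 0\<^sup>2) * n i)"
      unfolding n_def by (rule shifted_energy_add_modes[OF r]) (use orth in auto)
    moreover have "(\<Sum>i<N. (a i)\<^sup>2 * ((freq i)\<^sup>2 - 0\<^sup>2) * n i) \<ge> 0"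
      using n by (intro sum_nonneg mult_nonneg_nonneg) (auto simp: less_imp_le)
    moreover have "(\<lambda>x. r N x + (\<Sum>i<N. a i * mode i x)) = g" "(\<lambda>x. r' N x + (\<Sum>i<N. a i * mode' i x)) = g'"
      by (auto simp: r_def r'_def sum_negf)
    ultimately show ?thesis by (simp add: Q_def)
  qed
  have sup: "(r N x)\<^sup>2 \<le> Q / (l * \<kappa>\<^sup>2) + 2 * Q / \<kappa>"
    if N: "N > 0" and \<kappa>: "freq (N - 1) < \<kappa>" "\<kappa> < real N * pi / l" and x: "x \<in> {0..l}" for N \<kappa> x
  proof -
    have \<kappa>0: "\<kappa> > 0" using \<kappa>(1) robin_freq_pos[of "N - 1"] by linarith
    have "0 \<le> shifted_energy \<kappa> (r N) (r' N)"
    proof (rule shifted_energy_nonneg[OF r, of N])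
      show "freq i < \<kappa>" if "i < N" for i
      proof -
        have "freq i \<le> freq (N - 1)"
          using that by (subst strict_mono_less_eq[OF robin_freq_strict_mono]) simp
        with \<kappa> show ?thesis by simp
      qed
      show "\<kappa> * l < real N * pi" using \<kappa> l by (simp add: pos_less_divide_eq)
    qed (use orth \<kappa>0 in auto)
    moreover have nn: "integral {0..l} (\<lambda>x. (r' N x)\<^sup>2) \<ge> 0" "integral {0..l} (\<lambda>x. (r N x)\<^sup>2) \<ge> 0"
      by (intro integral_nonneg integrable_continuous_interval continuous_intros C1_cont[OF r] C1_cont'[OF r]; simp)+
    moreover have "\<alpha> * ((r N 0)\<^sup>2 + (r N l)\<^sup>2) \<ge> 0" using \<alpha> by simp
    ultimately have 1: "\<kappa>\<^sup>2 * integral {0..l} (\<lambda>x. (r N x)\<^sup>2) \<le> Q"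
      and 2: "integral {0..l} (\<lambda>x. (r' N x)\<^sup>2) \<le> Q"
      using energy[of N] unfolding shifted_energy_def by auto
    have 3: "integral {0..l} (\<lambda>x. (r N x)\<^sup>2) \<le> Q / \<kappa>\<^sup>2" using 1 \<kappa>0 by (simp add: field_simps)
    have "l * (r N x)\<^sup>2 \<le> integral {0..l} (\<lambda>y. (r N y)\<^sup>2)
      + l * ((1/\<kappa>) * integral {0..l} (\<lambda>y. (r' N y)\<^sup>2) + integral {0..l} (\<lambda>y. (r N y)\<^sup>2) / (1/\<kappa>))"
      using \<kappa>0 by (intro sup_bound_by_energy[OF r x]) auto
    also have "\<dots> \<le> Q / \<kappa>\<^sup>2 + l * ((1/\<kappa>) * Q + (Q / \<kappa>\<^sup>2) / (1/\<kappa>))"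
      using 2 3 l \<kappa>0 by (intro add_mono mult_left_mono divide_right_mono) auto
    also have "\<dots> = l * (Q / (l * \<kappa>\<^sup>2) + 2 * Q / \<kappa>)"
      using l \<kappa>0 by (simp add: field_simps power2_eq_square)
    finally show ?thesis using l by simp
  qed
  have "((\<lambda>\<kappa>. Q / (l * \<kappa>\<^sup>2) + 2 * Q / \<kappa>) \<longlongrightarrow> 0) at_top"
  proof -
    have "filterlim (\<lambda>\<kappa>::real. l * \<kappa>\<^sup>2) at_top at_top"
      using l by (intro filterlim_tendsto_pos_mult_at_top[OF tendsto_const] filterlim_pow_at_top filterlim_ident) auto
    then have "((\<lambda>\<kappa>. Q / (l * \<kappa>\<^sup>2)) \<longlongrightarrow> 0) at_top"
      by (intro tendsto_divide_0[OF tendsto_const] filterlim_at_top_imp_at_infinity)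
    moreover have "((\<lambda>\<kappa>. 2 * Q / \<kappa>) \<longlongrightarrow> 0) at_top"
      by (intro tendsto_divide_0[OF tendsto_const] filterlim_at_top_imp_at_infinity filterlim_ident)
    ultimately show ?thesis using tendsto_add by fastforce
  qed
  then have "\<forall>\<^sub>F \<kappa> in at_top. Q / (l * \<kappa>\<^sup>2) + 2 * Q / \<kappa> < e\<^sup>2"
    using e by (intro order_tendstoD) auto
  then obtain K where K: "\<And>\<kappa>. \<kappa> \<ge> K \<Longrightarrow> Q / (l * \<kappa>\<^sup>2) + 2 * Q / \<kappa> < e\<^sup>2"
    by (auto simp: eventually_at_top_linorder)
  obtain M where M: "real M > K * l / pi" using reals_Archimedean2 by blast
  \<comment> \<open>Above the first \<open>M + 1\<close> frequencies and below the bound of the midpoint inequality for \<open>M + 1\<close> cells.\<close>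
  obtain \<kappa> where \<kappa>: "freq M < \<kappa>" "\<kappa> < real (Suc M) * pi / l"
    using dense[OF robin_freq_less[of M]] by (auto simp: add.commute)
  have "K < real M * pi / l" using M l by (simp add: field_simps)
  then have "\<kappa> \<ge> K" using robin_freq_greater[of M] \<kappa> by linarith
  have "\<bar>g x - (\<Sum>i<Suc M. a i * mode i x)\<bar> < e" if x: "x \<in> {0..l}" for x
  proof -
    have "(r (Suc M) x)\<^sup>2 < e\<^sup>2" using sup[of "Suc M" \<kappa> x] K[OF \<open>\<kappa> \<ge> K\<close>] \<kappa> x by auto
    then have "\<bar>r (Suc M) x\<bar> < e" using e by (metis abs_of_pos power2_less_imp_less abs_ge_zero power2_abs less_imp_le)
    then show ?thesis by (simp add: r_def sum_negf)
  qed
  then show ?thesis by blast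
qed

end

section \<open>Smooth approximations of indicator functions of boxes\<close>

text \<open>
  The boxes form a generator of the Borel sets that is stable under intersections.
\<close>

lemma AE_zero_if_box_integrals_zero:
  fixes f :: "'a::euclidean_space \<Rightarrow> 'b::{second_countable_topology, banach}"
  assumes f: "integrable lborel f" and box: "\<And>a b. (LINT x:box a b|lborel. f x) = 0"
  shows "AE x in lborel. f x = 0"
proof (rule sigma_finite_measure.density_zero[OF sigma_finite_lborel f])
  have int: "set_integrable lborel A f" if "A \<in> sets borel" for A
    using f that by (auto simp: set_integrable_def intro: integrable_mult_indicator)
  let ?A = "\<lambda>n::nat. box (- (real n *\<^sub>R One)) (real n *\<^sub>R One) :: 'a set"
  have "(\<lambda>n. LINT x:?A n|lborel. f x) \<longlonglongrightarrow> (LINT x:(\<Union>n. ?A n)|lborel. f x)"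
  proof (rule set_integral_cont_up)
    show "incseq ?A" by (auto simp: incseq_def box_def inner_Basis; force)
  qed (auto intro: int)
  then have total: "(LINT x:UNIV|lborel. f x) = 0"
    using LIMSEQ_unique[OF _ tendsto_const] by (auto simp: box UN_box_eq_UNIV)
  fix A :: "'a set" assume "A \<in> sets lborel"
  then have A: "A \<in> sigma_sets UNIV (range (\<lambda>(a, b). box a b))" by (simp add: borel_eq_box)
  have "Int_stable (range (\<lambda>(a, b). box a b::'a set))"
    by (auto simp: Int_stable_def box_Int_box)
  moreover have "range (\<lambda>(a, b). box a b) \<subseteq> Pow (UNIV :: 'a set)" by simp
  moreover note A
  ultimately show "(LINT x:A|lborel. f x) = 0"
  proof (induction rule: sigma_sets_induct_disjoint)
    case (compl A)
    then have A: "A \<in> sets borel" by (simp add: borel_eq_box)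
    have "(LINT x:A \<union> (UNIV - A)|lborel. f x) = (LINT x:A|lborel. f x) + (LINT x:UNIV - A|lborel. f x)"
      using A by (intro set_integral_Un int) auto
    then show ?case using compl total by simp
  next
    case (union A)
    then have A: "A i \<in> sets borel" for i by (auto simp: borel_eq_box)
    then have "(LINT x:(\<Union>i. A i)|lborel. f x) = (\<Sum>i. LINT x:A i|lborel. f x)"
      using union(1) by (intro lebesgue_integral_countable_add int) (auto simp: disjoint_family_on_def)
    then show ?case using union by simp
  qed (auto simp: box, simp add: set_lebesgue_integral_def)
qed

text \<open>
  The case \<open>m = 0\<close> is the standard smooth function that is flat at \<open>0\<close>. All its derivatives are linear
  combinations of the functions of this family.
\<close>

definition flat :: "nat \<Rightarrow> real \<Rightarrow> real" where
  "flat m t = (if t > 0 then (1 / t) ^ m * exp (- 1 / t) else 0)"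

lemma flat_tendsto_0: "(flat m \<longlongrightarrow> 0) (at 0)"
proof (rule filterlim_split_at_real)
  show "(flat m \<longlongrightarrow> 0) (at_left 0)"
    by (rule tendsto_eventually) (auto simp: flat_def eventually_at_filter)
  have "((\<lambda>t::real. inverse t ^ m / exp (inverse t)) \<longlongrightarrow> 0) (at_right 0)"
    by (rule filterlim_compose[OF tendsto_power_div_exp_0 filterlim_inverse_at_top_right])
  then show "(flat m \<longlongrightarrow> 0) (at_right 0)"
    by (rule Lim_transform_eventually)
      (auto simp: flat_def eventually_at_filter exp_minus divide_inverse)
qed

lemma flat_deriv:
  "(flat m has_real_derivative (flat (m + 2) t - real m * flat (m + 1) t)) (at t)"
proof (cases t "0::real" rule: linorder_cases)
  case less
  have "((\<lambda>_. 0) has_real_derivative 0) (at t)" by simp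
  then have "(flat m has_real_derivative 0) (at t)"
    by (rule has_field_derivative_transform_within_open[of _ _ _ "{..<0}"]) (use less in \<open>auto simp: flat_def\<close>)
  then show ?thesis using less by (simp add: flat_def)
next
  case equal
  have "((\<lambda>h. flat m h / h) \<longlongrightarrow> 0) (at 0)"
    by (rule Lim_transform_eventually[OF flat_tendsto_0[of "Suc m"]])
      (auto simp: flat_def eventually_at_filter)
  then show ?thesis by (simp add: equal DERIV_def flat_def)
next
  case greater
  have "((\<lambda>t. (1 / t) ^ m) has_real_derivative (- real m * (1 / t) ^ (m + 1))) (at t)"
  proof (cases m)
    case (Suc j)
    show ?thesis unfolding Suc
      by (rule DERIV_cong[OF DERIV_power_Suc[where D="- (1 / t\<^sup>2)"]])
        (use greater in \<open>auto intro!: derivative_eq_intros simp: field_simps power2_eq_square\<close>)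
  qed simp
  moreover have "((\<lambda>t. exp (- 1 / t)) has_real_derivative (exp (- 1 / t) * (1 / t\<^sup>2))) (at t)"
    using greater by (auto intro!: derivative_eq_intros simp: power2_eq_square)
  ultimately have "((\<lambda>t. (1 / t) ^ m * exp (- 1 / t)) has_real_derivative
      ((1 / t) ^ m * (exp (- 1 / t) * (1 / t\<^sup>2)) - real m * ((1 / t) ^ (m + 1)) * exp (- 1 / t))) (at t)"
    by (rule DERIV_cong[OF DERIV_mult]) (simp add: algebra_simps)
  then have "(flat m has_real_derivative
      ((1 / t) ^ m * (exp (- 1 / t) * (1 / t\<^sup>2)) - real m * ((1 / t) ^ (m + 1)) * exp (- 1 / t))) (at t)"
    by (rule has_field_derivative_transform_within_open[of _ _ _ "{0<..}"]) (use greater in \<open>auto simp: flat_def\<close>)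
  then show ?thesis using greater by (simp add: flat_def power_add power2_eq_square mult_ac)
qed

text \<open>
  An algebra of functions that is closed under partial derivatives by construction; this is the
  invariant for the coinductive definition of \<open>smooth\<close>.
\<close>

inductive flat_algebra :: "('a::euclidean_space \<Rightarrow> real) \<Rightarrow> bool" where
  flat: "flat_algebra (\<lambda>x. flat m (inner v x + c))"
| const: "flat_algebra (\<lambda>_. c)"
| add: "flat_algebra f \<Longrightarrow> flat_algebra g \<Longrightarrow> flat_algebra (\<lambda>x. f x + g x)"
| mult: "flat_algebra f \<Longrightarrow> flat_algebra g \<Longrightarrow> flat_algebra (\<lambda>x. f x * g x)"

lemma flat_algebra_gradient:
  "flat_algebra f \<Longrightarrow> \<exists>g. (\<forall>x. GDERIV f x :> g x) \<and> (\<forall>b. flat_algebra (\<lambda>x. g x \<bullet> b))"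
proof (induction rule: flat_algebra.induct)
  case (flat m v c)
  let ?d = "\<lambda>x. flat (m + 2) (v \<bullet> x + c) - real m * flat (m + 1) (v \<bullet> x + c)"
  have lin: "GDERIV (\<lambda>x. v \<bullet> x + c) x :> v" for x
    unfolding gderiv_def by (auto intro!: derivative_eq_intros simp: inner_commute)
  have "GDERIV (\<lambda>x. flat m (v \<bullet> x + c)) x :> ?d x *\<^sub>R v" for x
    by (rule GDERIV_DERIV_compose[OF lin flat_deriv])
  moreover have "flat_algebra (\<lambda>x. (?d x *\<^sub>R v) \<bullet> b)" for b
  proof -
    have "flat_algebra (\<lambda>x. (flat (m + 2) (v \<bullet> x + c) + (- real m) * flat (m + 1) (v \<bullet> x + c)) * (v \<bullet> b))"
      by (intro flat_algebra.intros)
    then show ?thesis by simp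
  qed
  ultimately show ?case by (intro exI[of _ "\<lambda>x. ?d x *\<^sub>R v"]) blast
next
  case (const c)
  show ?case by (intro exI[of _ "\<lambda>_. 0"]) (auto simp: GDERIV_const intro: flat_algebra.const)
next
  case (add f g)
  then obtain f' g' where "\<forall>x. GDERIV f x :> f' x" "\<forall>b. flat_algebra (\<lambda>x. f' x \<bullet> b)"
     "\<forall>x. GDERIV g x :> g' x" "\<forall>b. flat_algebra (\<lambda>x. g' x \<bullet> b)" by blast
  then show ?case
    by (intro exI[of _ "\<lambda>x. f' x + g' x"]) (auto simp: inner_add_left intro: GDERIV_add flat_algebra.add)
next
  case (mult f g)
  then obtain f' g' where "\<forall>x. GDERIV f x :> f' x" "\<forall>b. flat_algebra (\<lambda>x. f' x \<bullet> b)"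
     "\<forall>x. GDERIV g x :> g' x" "\<forall>b. flat_algebra (\<lambda>x. g' x \<bullet> b)" by blast
  moreover from this mult.hyps have "flat_algebra (\<lambda>x. f x * (g' x \<bullet> b) + g x * (f' x \<bullet> b))" for b
    by (intro flat_algebra.add flat_algebra.mult) auto
  ultimately show ?case
    by (intro exI[of _ "\<lambda>x. f x *\<^sub>R g' x + g x *\<^sub>R f' x"])
      (auto simp: inner_add_left intro: GDERIV_mult)
qed

lemma smooth_flat_algebra: "flat_algebra f \<Longrightarrow> smooth f"
proof (coinduction arbitrary: f)
  case smooth
  then show ?case using flat_algebra_gradient by blast
qed

text \<open>
  Increases to the indicator function of \<open>(a,b)\<close> as \<open>n \<rightarrow> \<infinity>\<close>. The shift by \<open>1\<close> moves the support
  to \<open>[a + 1/n, b - 1/n]\<close>, a compact subset of the open interval.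
\<close>

definition cutoff :: "real \<Rightarrow> real \<Rightarrow> nat \<Rightarrow> real \<Rightarrow> real" where
  "cutoff a b n x = flat 0 (real n * (x - a) - 1) * flat 0 (real n * (b - x) - 1)"

lemma flat_0_range: "0 \<le> flat 0 t" "flat 0 t \<le> 1"
  by (auto simp: flat_def)

lemma cutoff_range: "0 \<le> cutoff a b n x" "cutoff a b n x \<le> 1"
  unfolding cutoff_def using flat_0_range by (auto intro: mult_le_one)

lemma flat_0_tendsto_1: "x > 0 \<Longrightarrow> (\<lambda>n. flat 0 (real n * x - 1)) \<longlonglongrightarrow> 1"
proof -
  assume x: "x > 0"
  have top: "filterlim (\<lambda>n. real n * x - 1) at_top sequentially"
  proof -
    have "filterlim (\<lambda>n. - 1 + real n * x) at_top sequentially"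
      by (intro filterlim_tendsto_add_at_top[OF tendsto_const]
          filterlim_at_top_mult_tendsto_pos[OF tendsto_const x] filterlim_real_sequentially)
    then show ?thesis by simp
  qed
  have "(\<lambda>n. exp (- 1 / (real n * x - 1))) \<longlonglongrightarrow> exp 0"
    by (intro tendsto_exp tendsto_divide_0[OF tendsto_const] filterlim_at_top_imp_at_infinity top)
  moreover have "\<forall>\<^sub>F n in sequentially. real n * x - 1 > 0"
    using top unfolding filterlim_at_top_dense by blast
  ultimately show ?thesis
    by (auto simp: flat_def elim!: Lim_transform_eventually eventually_mono)
qed

lemma cutoff_zero: "x \<le> a + 1 / real (Suc n) \<or> b - 1 / real (Suc n) \<le> x \<Longrightarrow> cutoff a b (Suc n) x = 0"
  by (auto simp: cutoff_def flat_def field_simps)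

lemma cutoff_tendsto: "(\<lambda>n. cutoff a b n x) \<longlonglongrightarrow> indicat_real {a<..<b} x"
proof (cases "x \<in> {a<..<b}")
  case True
  then have "(\<lambda>n. cutoff a b n x) \<longlonglongrightarrow> 1 * 1"
    unfolding cutoff_def by (intro tendsto_mult flat_0_tendsto_1) auto
  with True show ?thesis by simp
next
  case False
  then have "cutoff a b n x = 0" for n
    by (auto simp: cutoff_def flat_def not_less) (smt (verit) mult_nonneg_nonpos of_nat_0_le_iff)+
  with False show ?thesis by simp
qed

lemma C1_flat: "C1 (flat m) (\<lambda>t. flat (m + 2) t - real m * flat (m + 1) t)"
proof -
  have "continuous_on UNIV (flat n)" for n
    using flat_deriv by (intro continuous_at_imp_continuous_on) (blast intro: DERIV_isCont)
  then show ?thesis unfolding C1_def by (intro conjI allI flat_deriv continuous_intros) auto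
qed

lemma C1_cutoff: "\<exists>c'. C1 (cutoff a b n) c'"
proof -
  have "C1 (\<lambda>x. flat 0 (real n * x + (- real n * a - 1)) * flat 0 (- real n * x + (real n * b - 1)))
     (\<lambda>x. (real n * (flat (0 + 2) (real n * x + (- real n * a - 1)) - real 0 * flat (0 + 1) (real n * x + (- real n * a - 1))))
       * flat 0 (- real n * x + (real n * b - 1)) +
       (- real n * (flat (0 + 2) (- real n * x + (real n * b - 1)) - real 0 * flat (0 + 1) (- real n * x + (real n * b - 1))))
       * flat 0 (real n * x + (- real n * a - 1)))"
    by (intro C1_mult C1_affine[OF C1_flat])
  moreover have "(\<lambda>x. flat 0 (real n * x + (- real n * a - 1)) * flat 0 (- real n * x + (real n * b - 1))) = cutoff a b n"
    by (rule ext) (simp add: cutoff_def algebra_simps)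
  ultimately show ?thesis by metis
qed

lemma mem_box_pair: "box (a, c) (b, d) = {a<..<b} \<times> {c<..<d::real}" for a b :: real
  by (auto simp: mem_box Basis_prod_def)

lemma test_function_cutoff:
  assumes "0 \<le> a" "b \<le> l" "0 \<le> c" "d \<le> L"
  shows "test_function (rect l L) (\<lambda>p. cutoff a b (Suc n) (fst p) * cutoff c d (Suc n) (snd p))"
proof -
  let ?\<psi> = "\<lambda>p. cutoff a b (Suc n) (fst p) * cutoff c d (Suc n) (snd p)"
  define N where "N = real (Suc n)"
  have N: "N > 0" by (simp add: N_def)
  let ?F = "\<lambda>(v::real\<times>real) c p. flat 0 (v \<bullet> p + c)"
  have "flat_algebra (\<lambda>p. (?F (N, 0) (- N * a - 1) p * ?F (- N, 0) (N * b - 1) p) *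
      (?F (0, N) (- N * c - 1) p * ?F (0, - N) (N * d - 1) p))"
    by (intro flat_algebra.intros)
  also have "(\<lambda>p. (?F (N, 0) (- N * a - 1) p * ?F (- N, 0) (N * b - 1) p) *
      (?F (0, N) (- N * c - 1) p * ?F (0, - N) (N * d - 1) p)) = ?\<psi>"
    by (rule ext) (simp add: cutoff_def inner_prod_def N_def[symmetric] algebra_simps del: of_nat_Suc)
  finally have smooth: "smooth ?\<psi>" by (rule smooth_flat_algebra)
  define e where "e = 1 / N"
  have e: "e > 0" using N by (simp add: e_def)
  let ?K = "{a + e..b - e} \<times> {c + e..d - e}"
  have "{p. ?\<psi> p \<noteq> 0} \<subseteq> ?K"
    using cutoff_zero[of _ a n b] cutoff_zero[of _ c n d] by (force simp: N_def e_def not_le simp del: of_nat_Suc)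
  then have cl: "closure {p. ?\<psi> p \<noteq> 0} \<subseteq> ?K"
    by (rule closure_minimal) (intro closed_Times closed_atLeastAtMost)
  have "compact ?K" by (intro compact_Times compact_Icc)
  then have "compact (closure {p. ?\<psi> p \<noteq> 0})"
    using cl by (meson bounded_subset closed_closure compact_eq_bounded_closed)
  moreover have "?K \<subseteq> rect l L"
  proof
    fix p assume "p \<in> ?K"
    then show "p \<in> rect l L" using assms e unfolding rect_def mem_Times_iff by auto
  qed
  ultimately show ?thesis using smooth cl unfolding test_function_def by blast
qed

lemma rect_sets [measurable, simp]: "rect l L \<in> sets borel"
  unfolding rect_def by (intro borel_open open_Times) auto

text \<open>
  By dominated convergence the integrals over all boxes contained in the rectangle vanish. Every box
  meets the rectangle in such a box or not at all.
\<close>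

lemma AE_zero_if_orthogonal_to_cutoffs:
  fixes f :: "real \<times> real \<Rightarrow> 'b::{second_countable_topology, banach}"
  assumes f: "set_integrable lborel (rect l L) f"
    and orth: "\<And>a b c d n. 0 \<le> a \<Longrightarrow> b \<le> l \<Longrightarrow> 0 \<le> c \<Longrightarrow> d \<le> L \<Longrightarrow>
        (LINT p:rect l L|lborel. (cutoff a b (Suc n) (fst p) * cutoff c d (Suc n) (snd p)) *\<^sub>R f p) = 0"
  shows "AE p\<in>rect l L in lborel. f p = 0"
proof -
  define F where "F p = indicat_real (rect l L) p *\<^sub>R f p" for p
  have F: "integrable lborel F" using f by (simp add: F_def[abs_def] set_integrable_def)
  note [measurable] = borel_measurable_integrable[OF F]
  have cm: "continuous_on UNIV (cutoff a b n)" for a b n using C1_cutoff[of a b n] C1_cont by blast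
  have [measurable]: "(\<lambda>p. cutoff a b n (fst p) * cutoff c d n (snd p)) \<in> borel_measurable borel" for a b c d n
    by (intro borel_measurable_continuous_onI continuous_intros continuous_on_compose2[OF cm]) auto
  have [measurable]: "box A B \<in> sets borel" for A B :: "real \<times> real" by (intro borel_open open_box)
  have "AE p in lborel. F p = 0"
  proof (rule AE_zero_if_box_integrals_zero[OF F])
    fix A B :: "real \<times> real"
    define a b c d where "a = max 0 (fst A)" and "b = min l (fst B)" and "c = max 0 (snd A)" and "d = min L (snd B)"
    let ?\<psi> = "\<lambda>n p. cutoff a b (Suc n) (fst p) * cutoff c d (Suc n) (snd p)"
    have "(\<lambda>n. LINT p|lborel. ?\<psi> n p *\<^sub>R F p) \<longlonglongrightarrow> (LINT p|lborel. indicat_real (box (a, c) (b, d)) p *\<^sub>R F p)"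
    proof (rule integral_dominated_convergence[where w="\<lambda>p. norm (F p)"])
      show "AE p in lborel. (\<lambda>n. ?\<psi> n p *\<^sub>R F p) \<longlonglongrightarrow> indicat_real (box (a, c) (b, d)) p *\<^sub>R F p"
      proof (rule AE_I2, rule tendsto_scaleR)
        fix p :: "real \<times> real"
        have "(\<lambda>n. ?\<psi> n p) \<longlonglongrightarrow> indicat_real {a<..<b} (fst p) * indicat_real {c<..<d} (snd p)"
          by (intro tendsto_mult cutoff_tendsto[THEN LIMSEQ_Suc])
        also have "indicat_real {a<..<b} (fst p) * indicat_real {c<..<d} (snd p) = indicat_real (box (a, c) (b, d)) p"
          by (cases p) (auto simp: mem_box_pair indicator_def)
        finally show "(\<lambda>n. ?\<psi> n p) \<longlonglongrightarrow> indicat_real (box (a, c) (b, d)) p" .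
      qed auto
      show "AE p in lborel. norm (?\<psi> n p *\<^sub>R F p) \<le> norm (F p)" for n
        using cutoff_range by (auto intro!: AE_I2 mult_left_le_one_le mult_le_one simp: abs_mult)
    qed (use F in auto)
    moreover have "(LINT p|lborel. ?\<psi> n p *\<^sub>R F p) = 0" for n
      using orth[of a b c d n]
      by (simp add: F_def set_lebesgue_integral_def a_def b_def c_def d_def mult.commute)
    ultimately have "(LINT p|lborel. indicat_real (box (a, c) (b, d)) p *\<^sub>R F p) = 0"
      using LIMSEQ_unique[OF _ tendsto_const] by auto
    also have "(\<lambda>p. indicat_real (box (a, c) (b, d)) p *\<^sub>R F p) = (\<lambda>p. indicat_real (box A B) p *\<^sub>R F p)"
      by (cases A; cases B) (auto simp: F_def mem_box_pair rect_def indicator_def a_def b_def c_def d_def)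
    finally show "(LINT p:box A B|lborel. F p) = 0" by (simp add: set_lebesgue_integral_def)
  qed
  then show ?thesis by eventually_elim (auto simp: F_def indicator_def)
qed

section \<open>Green's formula for continuously differentiable functions\<close>

definition C1_gradient :: "('a::euclidean_space \<Rightarrow> real) \<Rightarrow> ('a \<Rightarrow> 'a) \<Rightarrow> bool" where
  "C1_gradient w D \<longleftrightarrow> (\<forall>x. GDERIV w x :> D x) \<and> continuous_on UNIV D"

lemma C1_gradient_cont: "C1_gradient w D \<Longrightarrow> continuous_on S w"
  unfolding C1_gradient_def gderiv_def
  by (meson continuous_at_imp_continuous_on has_derivative_continuous)

lemma C1_gradient_cont': "C1_gradient w D \<Longrightarrow> continuous_on S D"
  unfolding C1_gradient_def by (auto intro: continuous_on_subset)

lemma C1_gradient_mult: "C1_gradient u D \<Longrightarrow> C1_gradient v E \<Longrightarrow>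
    C1_gradient (\<lambda>x. u x * v x) (\<lambda>x. u x *\<^sub>R E x + v x *\<^sub>R D x)"
  using C1_gradient_cont[of u D UNIV] C1_gradient_cont[of v E UNIV]
  unfolding C1_gradient_def by (auto intro!: GDERIV_mult continuous_intros)

lemma C1_gradient_partial:
  fixes w :: "real \<times> real \<Rightarrow> real"
  assumes "C1_gradient w D"
  shows "((\<lambda>x. w (x, y)) has_real_derivative fst (D (x, y))) (at x within S)"
    and "((\<lambda>y. w (x, y)) has_real_derivative snd (D (x, y))) (at y within T)"
proof -
  have w: "(w has_derivative (\<lambda>h. h \<bullet> D (x, y))) (at (x, y))"
    using assms by (simp add: C1_gradient_def gderiv_def)
  have "((\<lambda>x. (x, y)) has_derivative (\<lambda>h. (h, 0))) (at x within S)"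
    by (auto intro!: derivative_eq_intros)
  from has_derivative_compose[OF this w]
  show "((\<lambda>x. w (x, y)) has_real_derivative fst (D (x, y))) (at x within S)"
    by (simp add: has_field_derivative_def inner_prod_def mult_commute_abs)
  have "((\<lambda>y. (x, y)) has_derivative (\<lambda>h. (0, h))) (at y within T)"
    by (auto intro!: derivative_eq_intros)
  from has_derivative_compose[OF this w]
  show "((\<lambda>y. w (x, y)) has_real_derivative snd (D (x, y))) (at y within T)"
    by (simp add: has_field_derivative_def inner_prod_def mult_commute_abs)
qed

lemma C1_gradient_product:
  assumes f: "C1 f f'" and g: "C1 g g'"
  shows "C1_gradient (\<lambda>p. f (fst p) * g (snd p)) (\<lambda>p. (f' (fst p) * g (snd p), f (fst p) * g' (snd p)))"
  unfolding C1_gradient_def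
proof (intro conjI allI)
  fix p :: "real \<times> real"
  have "((\<lambda>p. f (fst p)) has_derivative (\<lambda>h. f' (fst p) * fst h)) (at p)"
    using has_derivative_compose[OF has_derivative_fst[OF has_derivative_ident], of f "\<lambda>h. f' (fst p) * h" p UNIV]
      C1_deriv[OF f] by (simp add: has_field_derivative_def)
  moreover have "((\<lambda>p. g (snd p)) has_derivative (\<lambda>h. g' (snd p) * snd h)) (at p)"
    using has_derivative_compose[OF has_derivative_snd[OF has_derivative_ident], of g "\<lambda>h. g' (snd p) * h" p UNIV]
      C1_deriv[OF g] by (simp add: has_field_derivative_def)
  ultimately show "GDERIV (\<lambda>p. f (fst p) * g (snd p)) p :> (f' (fst p) * g (snd p), f (fst p) * g' (snd p))"
    unfolding gderiv_def by (auto intro!: derivative_eq_intros simp: inner_prod_def algebra_simps)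
next
  have "continuous_on UNIV (\<lambda>p. h (fst p))" "continuous_on UNIV (\<lambda>p. h (snd p))"
    if "continuous_on UNIV h" for h :: "real \<Rightarrow> real"
    using that by (auto intro!: continuous_intros continuous_on_compose2[OF that])
  then show "continuous_on UNIV (\<lambda>p. (f' (fst p) * g (snd p), f (fst p) * g' (snd p)))"
    using C1_cont[OF f] C1_cont[OF g] C1_cont'[OF f] C1_cont'[OF g] by (intro continuous_intros) auto
qed

lemma rect_subset_cbox: "rect l L \<subseteq> cbox (0, 0) (l, L)"
  by (auto simp: rect_def cbox_Pair_eq)

lemma rect_eq_box: "rect l L = box (0, 0) (l, L)"
  by (simp add: rect_def mem_box_pair)

lemma set_integrable_rect_continuous:
  fixes f :: "real \<times> real \<Rightarrow> 'b::{banach, second_countable_topology}"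
  assumes "continuous_on UNIV f"
  shows "set_integrable lborel (rect l L) f"
proof (rule set_integrable_subset[OF _ _ rect_subset_cbox])
  show "set_integrable lborel (cbox (0, 0) (l, L)) f"
    unfolding set_integrable_def
    by (rule borel_integrable_compact[OF compact_cbox]) (rule continuous_on_subset[OF assms], simp)
qed simp

lemma set_integrable_interval_continuous:
  fixes f :: "real \<Rightarrow> 'b::{banach, second_countable_topology}"
  assumes "continuous_on {a..b} f"
  shows "set_integrable lborel {a..b} f"
  unfolding set_integrable_def by (rule borel_integrable_compact[OF compact_Icc assms])

lemma set_integral_interval_continuous:
  fixes f :: "real \<Rightarrow> real"
  assumes "continuous_on {a..b} f"
  shows "(LINT x:{a..b}|lborel. f x) = integral {a..b} f"
  by (rule set_borel_integral_eq_integral(2)[OF set_integrable_interval_continuous[OF assms]])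

lemma rect_integral_iterated:
  fixes f :: "real \<times> real \<Rightarrow> real"
  assumes "continuous_on UNIV f"
  shows "(LINT p:rect l L|lborel. f p) = integral {0..l} (\<lambda>x. integral {0..L} (\<lambda>y. f (x, y)))"
    and "(LINT p:rect l L|lborel. f p) = integral {0..L} (\<lambda>y. integral {0..l} (\<lambda>x. f (x, y)))"
proof -
  have c: "continuous_on S f" for S using assms continuous_on_subset by blast
  have "(LINT p:rect l L|lborel. f p) = integral (rect l L) f"
    by (rule set_borel_integral_eq_integral(2)[OF set_integrable_rect_continuous[OF assms]])
  also have "\<dots> = integral (cbox (0, 0) (l, L)) f" unfolding rect_eq_box by (rule integral_open_interval)
  also have "\<dots> = integral (cbox 0 l) (\<lambda>x. integral (cbox 0 L) (\<lambda>y. f (x, y)))"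
    by (rule integral_prod_continuous[OF c])
  finally show 1: "(LINT p:rect l L|lborel. f p) = integral {0..l} (\<lambda>x. integral {0..L} (\<lambda>y. f (x, y)))"
    by simp
  also have "\<dots> = integral {0..L} (\<lambda>y. integral {0..l} (\<lambda>x. f (x, y)))"
    using integral_swap_continuous[of 0 0 l L "\<lambda>x y. f (x, y)"] c by simp
  finally show "(LINT p:rect l L|lborel. f p) = integral {0..L} (\<lambda>y. integral {0..l} (\<lambda>x. f (x, y)))" .
qed

lemma rect_integral_product:
  fixes f g :: "real \<Rightarrow> real"
  assumes "continuous_on UNIV f" "continuous_on UNIV g"
  shows "(LINT p:rect l L|lborel. f (fst p) * g (snd p)) = integral {0..l} f * integral {0..L} g"
  by (subst rect_integral_iterated(1))
    (auto intro!: continuous_intros continuous_on_compose2[OF assms(1)] continuous_on_compose2[OF assms(2)])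

text \<open>
  The integral of \<open>S F \<bullet> \<nu>\<close> over the boundary, with outer unit normal \<open>\<nu>\<close>.
\<close>

definition boundary_flux :: "real \<Rightarrow> real \<Rightarrow> (real \<times> real \<Rightarrow> real) \<Rightarrow> (real \<times> real \<Rightarrow> real \<times> real) \<Rightarrow> real" where
  "boundary_flux l L S F =
     ((LINT y:{0..L}|lborel. S (l, y) * fst (F (l, y))) - (LINT y:{0..L}|lborel. S (0, y) * fst (F (0, y)))) +
     ((LINT x:{0..l}|lborel. S (x, L) * snd (F (x, L))) - (LINT x:{0..l}|lborel. S (x, 0) * snd (F (x, 0))))"

lemma continuous_on_edges:
  assumes "continuous_on UNIV (f :: real \<times> real \<Rightarrow> 'b::topological_space)"
  shows "continuous_on S (\<lambda>x. f (x, c))" "continuous_on S (\<lambda>y. f (c, y))"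
  by (auto intro!: continuous_on_compose2[OF assms] continuous_intros)

text \<open>
  The divergence theorem for the field \<open>w F\<close>: Fubini's theorem and the fundamental theorem of calculus
  in each of the two directions.
\<close>

lemma green_C1:
  assumes w: "C1_gradient w Dw"
    and F: "C1_gradient (\<lambda>p. fst (F p)) D1" "C1_gradient (\<lambda>p. snd (F p)) D2" and l: "l \<ge> 0" and L: "L \<ge> 0"
  shows "(LINT p:rect l L|lborel. Dw p \<bullet> F p + w p * (fst (D1 p) + snd (D2 p))) = boundary_flux l L w F"
proof -
  note wF = C1_gradient_mult[OF w F(1)] C1_gradient_mult[OF w F(2)]
  let ?A = "\<lambda>p. fst (w p *\<^sub>R D1 p + fst (F p) *\<^sub>R Dw p)" and ?B = "\<lambda>p. snd (w p *\<^sub>R D2 p + snd (F p) *\<^sub>R Dw p)"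
  note c = wF[THEN C1_gradient_cont'] wF[THEN C1_gradient_cont]
  have cA: "continuous_on UNIV ?A" and cB: "continuous_on UNIV ?B"
    using c(1,2) by (auto intro!: continuous_on_fst continuous_on_snd simp del: fst_add snd_add)
  have "(LINT p:rect l L|lborel. Dw p \<bullet> F p + w p * (fst (D1 p) + snd (D2 p))) = (LINT p:rect l L|lborel. ?A p + ?B p)"
    by (simp add: inner_prod_def algebra_simps)
  also have "\<dots> = (LINT p:rect l L|lborel. ?A p) + (LINT p:rect l L|lborel. ?B p)"
    by (rule set_integral_add(2)[OF set_integrable_rect_continuous[OF cA] set_integrable_rect_continuous[OF cB]])
  also have "(LINT p:rect l L|lborel. ?A p) = integral {0..L} (\<lambda>y. w (l, y) * fst (F (l, y)) - w (0, y) * fst (F (0, y)))"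
    unfolding rect_integral_iterated(2)[OF cA]
    by (intro integral_cong integral_unique FTC_has_integral[OF l] C1_gradient_partial(1)[OF wF(1)])
  also have "\<dots> = (LINT y:{0..L}|lborel. w (l, y) * fst (F (l, y))) - (LINT y:{0..L}|lborel. w (0, y) * fst (F (0, y)))"
    using continuous_on_edges(2)[OF c(3)]
    by (subst integral_diff) (auto intro!: integrable_continuous_interval simp: set_integral_interval_continuous)
  also have "(LINT p:rect l L|lborel. ?B p) = integral {0..l} (\<lambda>x. w (x, L) * snd (F (x, L)) - w (x, 0) * snd (F (x, 0)))"
    unfolding rect_integral_iterated(1)[OF cB]
    by (intro integral_cong integral_unique FTC_has_integral[OF L] C1_gradient_partial(2)[OF wF(2)])
  also have "\<dots> = (LINT x:{0..l}|lborel. w (x, L) * snd (F (x, L))) - (LINT x:{0..l}|lborel. w (x, 0) * snd (F (x, 0)))"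
    using continuous_on_edges(1)[OF c(4)]
    by (subst integral_diff) (auto intro!: integrable_continuous_interval simp: set_integral_interval_continuous)
  finally show ?thesis unfolding boundary_flux_def .
qed

section \<open>Square integrable functions on sets of finite measure\<close>

lemma L2_set_integrable:
  assumes "L2 A u" "A \<in> sets borel" "emeasure lborel A < \<infinity>"
  shows "set_integrable lborel A u"
  unfolding set_integrable_def
proof (rule Bochner_Integration.integrable_bound)
  have "set_integrable lborel A (\<lambda>x. 1 + (norm (u x))\<^sup>2)"
    using assms by (intro set_integral_add) (auto simp: L2_def set_integrable_def)
  then show "integrable lborel (\<lambda>x. indicat_real A x *\<^sub>R (1 + (norm (u x))\<^sup>2))" by (simp add: set_integrable_def)
  have "norm (u x) \<le> 1 + (norm (u x))\<^sup>2" for x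
    using sum_squares_bound[of "norm (u x)" 1] norm_ge_zero[of "u x"] by (smt (verit) power_one)
  then show "AE x in lborel. norm (indicat_real A x *\<^sub>R u x) \<le> norm (indicat_real A x *\<^sub>R (1 + (norm (u x))\<^sup>2))"
    by (auto intro!: AE_I2 simp: indicator_def)
qed (use assms in \<open>auto simp: L2_def set_borel_measurable_def\<close>)

lemma set_borel_measurable_continuous:
  fixes v :: "'a::euclidean_space \<Rightarrow> 'b::euclidean_space"
  assumes "continuous_on A v" "A \<in> sets borel"
  shows "set_borel_measurable lborel A v"
  using borel_measurable_continuous_on_indicator[OF assms(2,1)]
  by (simp add: set_borel_measurable_def)

lemma set_integrable_dominated:
  fixes u :: "'a::euclidean_space \<Rightarrow> 'b::euclidean_space" and w :: "'a \<Rightarrow> 'c::euclidean_space"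
  assumes u: "set_integrable lborel A u" and w: "set_borel_measurable lborel A w"
    and B: "\<And>x. x \<in> A \<Longrightarrow> norm (w x) \<le> B * norm (u x)"
  shows "set_integrable lborel A w"
  unfolding set_integrable_def
proof (rule Bochner_Integration.integrable_bound)
  show "integrable lborel (\<lambda>x. B *\<^sub>R norm (indicat_real A x *\<^sub>R u x))"
    using u unfolding set_integrable_def by (intro integrable_scaleR_right integrable_norm)
  have "norm (w x) \<le> \<bar>B\<bar> * norm (u x)" if "x \<in> A" for x
    using B[OF that] by (meson abs_ge_self mult_right_mono norm_ge_zero order_trans)
  then show "AE x in lborel. norm (indicat_real A x *\<^sub>R w x) \<le> norm (B *\<^sub>R norm (indicat_real A x *\<^sub>R u x))"
    by (auto intro!: AE_I2 simp: indicator_def abs_mult)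
qed (use w in \<open>simp add: set_borel_measurable_def\<close>)

lemma set_integrable_measurable:
  "set_integrable lborel A u \<Longrightarrow> set_borel_measurable lborel A u"
  by (auto simp: set_integrable_def set_borel_measurable_def dest: borel_measurable_integrable)

lemma set_integrable_inner_bounded:
  fixes u v :: "'a::euclidean_space \<Rightarrow> 'b::euclidean_space"
  assumes u: "set_integrable lborel A u" and v: "set_borel_measurable lborel A v"
    and B: "\<And>x. x \<in> A \<Longrightarrow> norm (v x) \<le> B"
  shows "set_integrable lborel A (\<lambda>x. u x \<bullet> v x)"
proof (rule set_integrable_dominated[OF u])
  have "(\<lambda>x. (indicat_real A x *\<^sub>R u x) \<bullet> (indicat_real A x *\<^sub>R v x)) \<in> borel_measurable lborel"
    by (rule borel_measurable_inner[OF set_integrable_measurable[OF u, unfolded set_borel_measurable_def]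
          v[unfolded set_borel_measurable_def]])
  also have "(\<lambda>x. (indicat_real A x *\<^sub>R u x) \<bullet> (indicat_real A x *\<^sub>R v x)) = (\<lambda>x. indicat_real A x *\<^sub>R (u x \<bullet> v x))"
    by (auto simp: indicator_def)
  finally show "set_borel_measurable lborel A (\<lambda>x. u x \<bullet> v x)" by (simp add: set_borel_measurable_def)
  show "norm (u x \<bullet> v x) \<le> B * norm (u x)" if "x \<in> A" for x
    using Cauchy_Schwarz_ineq2[of "u x" "v x"] mult_left_mono[OF B[OF that], of "norm (u x)"]
    by (simp add: mult.commute)
qed

lemma set_integrable_scaleR_bounded:
  fixes u :: "'a::euclidean_space \<Rightarrow> 'b::euclidean_space" and v :: "'a \<Rightarrow> real"
  assumes u: "set_integrable lborel A u" and v: "set_borel_measurable lborel A v"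
    and B: "\<And>x. x \<in> A \<Longrightarrow> \<bar>v x\<bar> \<le> B"
  shows "set_integrable lborel A (\<lambda>x. v x *\<^sub>R u x)"
proof (rule set_integrable_dominated[OF u])
  have "(\<lambda>x. (indicat_real A x *\<^sub>R v x) *\<^sub>R (indicat_real A x *\<^sub>R u x)) \<in> borel_measurable lborel"
    by (rule borel_measurable_scaleR[OF v[unfolded set_borel_measurable_def]
          set_integrable_measurable[OF u, unfolded set_borel_measurable_def]])
  also have "(\<lambda>x. (indicat_real A x *\<^sub>R v x) *\<^sub>R (indicat_real A x *\<^sub>R u x)) = (\<lambda>x. indicat_real A x *\<^sub>R (v x *\<^sub>R u x))"
    by (auto simp: indicator_def)
  finally show "set_borel_measurable lborel A (\<lambda>x. v x *\<^sub>R u x)" by (simp add: set_borel_measurable_def)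
  show "norm (v x *\<^sub>R u x) \<le> B * norm (u x)" if "x \<in> A" for x
    using mult_right_mono[OF B[OF that], of "norm (u x)"] by simp
qed

text \<open>
  A replacement for the Cauchy--Schwarz inequality on a set of finite measure:
  \<open>\<bar>q\<bar> \<le> d + q\<^sup>2 / d\<close> for every \<open>d > 0\<close>. The bound on \<open>q\<^sup>2\<close> is by a multiple of \<open>p\<close>, so that one lemma
  serves for products of converging functions with a fixed bounded factor.
\<close>

lemma set_integral_tendsto_0_by_squares:
  fixes q p :: "nat \<Rightarrow> 'a::euclidean_space \<Rightarrow> real"
  assumes A: "A \<in> sets borel" "emeasure lborel A < \<infinity>"
    and p: "\<And>k. set_integrable lborel A (p k)" and lim: "(\<lambda>k. LINT x:A|lborel. p k x) \<longlonglongrightarrow> 0"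
    and q: "\<And>k x. x \<in> A \<Longrightarrow> (q k x)\<^sup>2 \<le> B * p k x"
  shows "(\<lambda>k. LINT x:A|lborel. q k x) \<longlonglongrightarrow> 0"
proof (rule LIMSEQ_I)
  fix e :: real assume e: "e > 0"
  define m where "m = measure lborel A"
  define d where "d = e / (2 * (m + 1))"
  have m: "m \<ge> 0" by (simp add: m_def)
  have d: "d > 0" using e m by (simp add: d_def)
  have "(\<lambda>k. (B / d) * (LINT x:A|lborel. p k x)) \<longlonglongrightarrow> (B / d) * 0"
    by (intro tendsto_intros lim)
  then obtain K where K: "\<And>k. k \<ge> K \<Longrightarrow> \<bar>(B / d) * (LINT x:A|lborel. p k x)\<bar> < e / 2"
    using LIMSEQ_D[of "\<lambda>k. (B / d) * (LINT x:A|lborel. p k x)" 0 "e / 2"] e by auto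
  have const: "set_integrable lborel A (\<lambda>_. d)" using A by (simp add: set_integrable_def)
  have bound: "\<bar>q k x\<bar> \<le> d + (B / d) * p k x" if "x \<in> A" for k x
  proof -
    have "2 * \<bar>q k x\<bar> * d \<le> (q k x)\<^sup>2 + d\<^sup>2"
      using sum_squares_bound[of "\<bar>q k x\<bar>" d] by simp
    moreover have "\<bar>q k x\<bar> * d \<ge> 0" using d by simp
    ultimately have "\<bar>q k x\<bar> * d \<le> d\<^sup>2 + B * p k x" using q[OF that, of k] by linarith
    then have "\<bar>q k x\<bar> \<le> (d\<^sup>2 + B * p k x) / d" using d by (simp add: pos_le_divide_eq)
    then show ?thesis using d by (simp add: add_divide_distrib power2_eq_square)
  qed
  have key: "\<bar>LINT x:A|lborel. q k x\<bar> \<le> d * m + (B / d) * (LINT x:A|lborel. p k x)" for k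
  proof -
    have int: "set_integrable lborel A (\<lambda>x. d + (B / d) * p k x)"
      by (intro set_integral_add const set_integrable_mult_right p)
    have "\<bar>LINT x:A|lborel. q k x\<bar> \<le> (LINT x|lborel. norm (indicat_real A x *\<^sub>R q k x))"
      unfolding set_lebesgue_integral_def real_norm_def[symmetric] by (rule integral_norm_bound)
    also have "\<dots> \<le> (LINT x|lborel. indicat_real A x *\<^sub>R (d + (B / d) * p k x))"
      using int bound unfolding set_integrable_def
      by (intro integral_mono') (auto simp: indicator_def intro: order_trans[OF abs_ge_zero])
    also have "\<dots> = (LINT x:A|lborel. d) + (LINT x:A|lborel. (B / d) * p k x)"
      unfolding set_lebesgue_integral_def[symmetric]
      by (intro set_integral_add const set_integrable_mult_right p)
    also have "\<dots> = d * m + (B / d) * (LINT x:A|lborel. p k x)"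
      using A by (simp add: m_def set_lebesgue_integral_def mult.commute)
    finally show ?thesis .
  qed
  have "d * m < e / 2" using e m by (simp add: d_def field_simps)
  then have "norm ((LINT x:A|lborel. q k x) - 0) < e" if "k \<ge> K" for k
    using K[OF that] key[of k] unfolding real_norm_def diff_zero by linarith
  then show "\<exists>no. \<forall>n\<ge>no. norm ((LINT x:A|lborel. q n x) - 0) < e" by blast
qed

section \<open>Weak gradients and traces\<close>

lemma L2_diff:
  fixes u v :: "'a::euclidean_space \<Rightarrow> 'b::euclidean_space"
  assumes u: "L2 A u" and v: "L2 A v"
  shows "L2 A (\<lambda>x. u x - v x)"
proof -
  have m: "set_borel_measurable lborel A (\<lambda>x. u x - v x)"
    using u v by (auto simp: L2_def set_borel_measurable_def scaleR_diff_right)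
  have "(\<lambda>x. (norm (indicat_real A x *\<^sub>R (u x - v x)))\<^sup>2) \<in> borel_measurable lborel"
    using m unfolding set_borel_measurable_def by measurable
  also have "(\<lambda>x. (norm (indicat_real A x *\<^sub>R (u x - v x)))\<^sup>2) = (\<lambda>x. indicat_real A x *\<^sub>R (norm (u x - v x))\<^sup>2)"
    by (auto simp: indicator_def)
  finally have m2: "set_borel_measurable lborel A (\<lambda>x. (norm (u x - v x))\<^sup>2)"
    by (simp add: set_borel_measurable_def)
  have "set_integrable lborel A (\<lambda>x. (norm (u x))\<^sup>2 + (norm (v x))\<^sup>2)"
    using u v by (intro set_integral_add) (auto simp: L2_def)
  then have "set_integrable lborel A (\<lambda>x. (norm (u x - v x))\<^sup>2)"
  proof (rule set_integrable_dominated[OF _ m2])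
    show "norm ((norm (u x - v x))\<^sup>2) \<le> 2 * norm ((norm (u x))\<^sup>2 + (norm (v x))\<^sup>2)" for x
  proof -
    have "(norm (u x - v x))\<^sup>2 \<le> (norm (u x) + norm (v x))\<^sup>2"
      by (intro power_mono norm_triangle_ineq4) auto
    also have "\<dots> \<le> 2 * ((norm (u x))\<^sup>2 + (norm (v x))\<^sup>2)"
      using sum_squares_bound[of "norm (u x)" "norm (v x)"] by (simp add: power2_sum)
    finally show ?thesis by simp
  qed
  qed
  with m show ?thesis by (simp add: L2_def)
qed

lemma L2_rect_continuous:
  fixes f :: "real \<times> real \<Rightarrow> 'b::euclidean_space"
  assumes "continuous_on UNIV f"
  shows "L2 (rect l L) f"
  unfolding L2_def
proof
  show "set_borel_measurable lborel (rect l L) f"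
    by (rule set_borel_measurable_continuous[OF continuous_on_subset[OF assms]]) auto
  show "set_integrable lborel (rect l L) (\<lambda>x. (norm (f x))\<^sup>2)"
    by (intro set_integrable_rect_continuous continuous_intros assms)
qed

lemma L2_interval_continuous:
  fixes f :: "real \<Rightarrow> 'b::euclidean_space"
  assumes "continuous_on UNIV f"
  shows "L2 {a..b} f"
  unfolding L2_def
proof
  have c: "continuous_on {a..b} f" by (rule continuous_on_subset[OF assms]) simp
  show "set_borel_measurable lborel {a..b} f"
    by (rule set_borel_measurable_continuous[OF c]) auto
  show "set_integrable lborel {a..b} (\<lambda>x. (norm (f x))\<^sup>2)"
    by (intro set_integrable_interval_continuous continuous_intros c)
qed

lemma emeasure_rect: "emeasure lborel (rect l L) < \<infinity>"
  unfolding rect_eq_box using emeasure_lborel_box_finite by (simp add: top.not_eq_extremum)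

lemma emeasure_interval: "emeasure lborel {a..b::real} < \<infinity>"
  by (cases "a \<le> b") auto

lemma continuous_bounded_rect:
  fixes f :: "real \<times> real \<Rightarrow> 'b::real_normed_vector"
  assumes "continuous_on UNIV f"
  obtains B where "B \<ge> 0" "\<And>p. p \<in> rect l L \<Longrightarrow> norm (f p) \<le> B"
proof -
  have "bounded (f ` cbox (0, 0) (l, L))"
    by (intro compact_imp_bounded compact_continuous_image continuous_on_subset[OF assms]) auto
  then obtain B where "\<And>p. p \<in> cbox (0, 0) (l, L) \<Longrightarrow> norm (f p) \<le> B"
    unfolding bounded_iff by blast
  then have "norm (f p) \<le> max B 0" if "p \<in> rect l L" for p
    using rect_subset_cbox[of l L] that by fastforce
  with that[of "max B 0"] show thesis by simp
qed

lemma continuous_bounded_interval: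
  fixes f :: "real \<Rightarrow> real"
  assumes "continuous_on UNIV f"
  obtains B where "B \<ge> 0" "\<And>p. p \<in> {a..b} \<Longrightarrow> \<bar>f p\<bar> \<le> B"
proof -
  have "bounded (f ` {a..b})"
    by (intro compact_imp_bounded compact_continuous_image continuous_on_subset[OF assms]) auto
  then obtain B where "\<And>p. p \<in> {a..b} \<Longrightarrow> norm (f p) \<le> B"
    unfolding bounded_iff by blast
  then have "\<bar>f p\<bar> \<le> max B 0" if "p \<in> {a..b}" for p
    using that by fastforce
  with that[of "max B 0"] show thesis by simp
qed

lemma smooth_C1_gradient:
  fixes f :: "'a::euclidean_space \<Rightarrow> real"
  assumes "smooth f"
  shows "\<exists>D. C1_gradient f D"
proof -
  from assms obtain g where g: "\<And>x. GDERIV f x :> g x" and s: "\<And>b. b \<in> Basis \<Longrightarrow> smooth (\<lambda>x. g x \<bullet> b)"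
    by (cases rule: smooth.cases) blast
  have "continuous_on UNIV (\<lambda>x. g x \<bullet> b)" if "b \<in> Basis" for b
  proof -
    from s[OF that] obtain h where "\<And>x. GDERIV (\<lambda>x. g x \<bullet> b) x :> h x"
      by (cases rule: smooth.cases) blast
    then show ?thesis unfolding gderiv_def
      by (meson continuous_at_imp_continuous_on has_derivative_continuous)
  qed
  then have "continuous_on UNIV g" using continuous_on_componentwise by blast
  with g show ?thesis by (auto simp: C1_gradient_def)
qed

lemma gderiv_unique: "GDERIV f x :> D \<Longrightarrow> GDERIV f x :> E \<Longrightarrow> D = E"
  for f :: "'a::euclidean_space \<Rightarrow> real"
proof -
  assume "GDERIV f x :> D" "GDERIV f x :> E"
  then have "(\<lambda>h. h \<bullet> D) = (\<lambda>h. h \<bullet> E)" unfolding gderiv_def by (rule has_derivative_unique)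
  then have "h \<bullet> D = h \<bullet> E" for h by metis
  then show ?thesis by (metis vector_eq_ldot)
qed

text \<open>
  Two weak gradients have the same integrals against all test functions, in particular against the
  products of cutoffs.
\<close>

lemma weak_gradient_unique:
  assumes g: "H1_gradient (rect l L) u g" and h: "H1_gradient (rect l L) u h"
  shows "AE p\<in>rect l L in lborel. g p = h p"
proof -
  have gi: "set_integrable lborel (rect l L) g" "set_integrable lborel (rect l L) h"
    using g h by (auto simp: H1_gradient_def intro!: L2_set_integrable emeasure_rect)
  have "AE p\<in>rect l L in lborel. g p - h p = 0"
  proof (rule AE_zero_if_orthogonal_to_cutoffs)
    show "set_integrable lborel (rect l L) (\<lambda>p. g p - h p)" by (intro set_integral_diff gi)
    fix a b c d :: real and n assume "0 \<le> a" "b \<le> l" "0 \<le> c" "d \<le> L"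
    define \<psi> where "\<psi> p = cutoff a b (Suc n) (fst p) * cutoff c d (Suc n) (snd p)" for p
    have \<psi>: "test_function (rect l L) \<psi>"
      unfolding \<psi>_def[abs_def] by (rule test_function_cutoff) fact+
    then obtain D where D: "C1_gradient \<psi> D" using smooth_C1_gradient by (auto simp: test_function_def)
    then have "\<forall>x. GDERIV \<psi> x :> D x" by (simp add: C1_gradient_def)
    with g h \<psi> have "(LINT p:rect l L|lborel. u p *\<^sub>R D p) = - (LINT p:rect l L|lborel. \<psi> p *\<^sub>R g p)"
      "(LINT p:rect l L|lborel. u p *\<^sub>R D p) = - (LINT p:rect l L|lborel. \<psi> p *\<^sub>R h p)"
      unfolding H1_gradient_def by blast+
    then have eq: "(LINT p:rect l L|lborel. \<psi> p *\<^sub>R g p) = (LINT p:rect l L|lborel. \<psi> p *\<^sub>R h p)"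
      by simp
    have "\<bar>\<psi> p\<bar> \<le> 1" for p
      unfolding \<psi>_def abs_mult using cutoff_range by (intro mult_le_one) auto
    then have i: "set_integrable lborel (rect l L) (\<lambda>p. \<psi> p *\<^sub>R g p)" "set_integrable lborel (rect l L) (\<lambda>p. \<psi> p *\<^sub>R h p)"
      by (auto intro!: set_integrable_scaleR_bounded[where B=1] gi set_borel_measurable_continuous C1_gradient_cont[OF D])
    show "(LINT p:rect l L|lborel. (cutoff a b (Suc n) (fst p) * cutoff c d (Suc n) (snd p)) *\<^sub>R (g p - h p)) = 0"
      using set_integral_diff(2)[OF i] eq by (simp add: \<psi>_def scaleR_diff_right)
  qed
  then show ?thesis by simp
qed

lemma set_integral_cong_AE_rect:
  fixes f g :: "real \<times> real \<Rightarrow> real"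
  assumes "AE p\<in>rect l L in lborel. f p = g p"
    and "set_borel_measurable lborel (rect l L) f" "set_borel_measurable lborel (rect l L) g"
  shows "(LINT p:rect l L|lborel. f p) = (LINT p:rect l L|lborel. g p)"
  unfolding set_lebesgue_integral_def using assms unfolding set_borel_measurable_def
  by (intro integral_cong_AE) (auto simp: indicator_def elim: eventually_mono)

text \<open>
  The passage to the limit on one side of the rectangle.
\<close>

lemma edge_integral_tendsto:
  fixes s \<phi> :: "real \<Rightarrow> real"
  assumes s: "L2 {a..b} s" and \<phi>: "continuous_on UNIV \<phi>" and \<omega>: "\<And>k. continuous_on UNIV (\<omega> k)"
    and lim: "(\<lambda>k. LINT x:{a..b}|lborel. (\<omega> k x - s x)\<^sup>2) \<longlonglongrightarrow> 0"
  shows "(\<lambda>k. LINT x:{a..b}|lborel. \<omega> k x * \<phi> x) \<longlonglongrightarrow> (LINT x:{a..b}|lborel. s x * \<phi> x)"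
proof -
  obtain B where B: "\<And>p. p \<in> {a..b} \<Longrightarrow> \<bar>\<phi> p\<bar> \<le> B" using continuous_bounded_interval[OF \<phi>] by blast
  have m: "set_borel_measurable lborel {a..b} \<phi>"
    using continuous_on_subset[OF \<phi>] by (intro set_borel_measurable_continuous) auto
  have si: "set_integrable lborel {a..b} s" using s by (intro L2_set_integrable emeasure_interval) auto
  have i1: "set_integrable lborel {a..b} (\<lambda>x. s x * \<phi> x)"
    using set_integrable_inner_bounded[OF si m, of B] B by simp
  have i2: "set_integrable lborel {a..b} (\<lambda>x. \<omega> k x * \<phi> x)" for k
    by (intro set_integrable_interval_continuous continuous_intros continuous_on_subset[OF \<phi>] continuous_on_subset[OF \<omega>]) auto
  have "(\<lambda>k. LINT x:{a..b}|lborel. (\<omega> k x - s x) * \<phi> x) \<longlonglongrightarrow> 0"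
  proof (rule set_integral_tendsto_0_by_squares[OF _ emeasure_interval _ lim, where B="B\<^sup>2"])
    show "set_integrable lborel {a..b} (\<lambda>x. (\<omega> k x - s x)\<^sup>2)" for k
      using L2_diff[OF L2_interval_continuous[OF \<omega>] s, of k] by (simp add: L2_def)
    show "((\<omega> k x - s x) * \<phi> x)\<^sup>2 \<le> B\<^sup>2 * (\<omega> k x - s x)\<^sup>2" if "x \<in> {a..b}" for k x
    proof -
      have "(\<phi> x)\<^sup>2 \<le> B\<^sup>2" using B[OF that] by (simp add: abs_le_square_iff[symmetric])
      then show ?thesis unfolding power_mult_distrib using mult_right_mono[of "(\<phi> x)\<^sup>2" "B\<^sup>2" "(\<omega> k x - s x)\<^sup>2"]
        by (simp add: mult.commute)
    qed
  qed auto
  then have "(\<lambda>k. (LINT x:{a..b}|lborel. \<omega> k x * \<phi> x) - (LINT x:{a..b}|lborel. s x * \<phi> x)) \<longlonglongrightarrow> 0"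
    using set_integral_diff(2)[OF i2 i1] by (simp add: left_diff_distrib)
  then show ?thesis by (simp add: LIM_zero_iff)
qed

text \<open>
  Green's formula holds for the \<open>C\<^sup>1\<close> functions that define the trace, and both sides are continuous
  under the convergence required there, since \<open>F\<close> and its divergence are bounded on the rectangle. The
  trace refers to a weak gradient of its own; it equals \<open>h\<close> almost everywhere.
\<close>

theorem green_H1:
  assumes uh: "H1_gradient (rect l L) u h" and tr: "has_trace l L u S"
    and F: "C1_gradient (\<lambda>p. fst (F p)) D1" "C1_gradient (\<lambda>p. snd (F p)) D2" and l: "l \<ge> 0" and L: "L \<ge> 0"
  shows "(LINT p:rect l L|lborel. h p \<bullet> F p + u p * (fst (D1 p) + snd (D2 p))) = boundary_flux l L S F"
proof -
  from tr have S: "boundary_L2 l L S" unfolding has_trace_def by (rule conjunct1)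
  from tr[unfolded has_trace_def, THEN conjunct2] obtain g w Dw where ug: "H1_gradient (rect l L) u g"
    and w1: "\<forall>k x. GDERIV (w k) x :> Dw k x" "\<forall>k. continuous_on UNIV (Dw k)"
    and lim: "(\<lambda>k. LINT p:rect l L|lborel. (w k p - u p)\<^sup>2 + (norm (Dw k p - g p))\<^sup>2) \<longlonglongrightarrow> 0"
    and blim: "(\<lambda>k. boundary_integral l L (\<lambda>x. (w k x - S x)\<^sup>2)) \<longlonglongrightarrow> 0"
    by (elim exE conjE)
  have w: "C1_gradient (w k) (Dw k)" for k using w1 by (simp add: C1_gradient_def)
  define d where "d p = fst (D1 p) + snd (D2 p)" for p
  have cF: "continuous_on UNIV F"
    using continuous_on_Pair[OF F[THEN C1_gradient_cont], of UNIV] by simp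
  have cd: "continuous_on UNIV d" unfolding d_def[abs_def]
    using F[THEN C1_gradient_cont', of UNIV] by (intro continuous_intros)
  obtain B1 where B1: "B1 \<ge> 0" "\<And>p. p \<in> rect l L \<Longrightarrow> norm (F p) \<le> B1" using continuous_bounded_rect[OF cF] by blast
  obtain B2 where B2: "B2 \<ge> 0" "\<And>p. p \<in> rect l L \<Longrightarrow> norm (d p) \<le> B2" using continuous_bounded_rect[OF cd] by blast
  have mF: "set_borel_measurable lborel (rect l L) F" and md: "set_borel_measurable lborel (rect l L) d"
    using continuous_on_subset[OF cF] continuous_on_subset[OF cd] by (auto intro!: set_borel_measurable_continuous)
  have i: "set_integrable lborel (rect l L) (\<lambda>p. f p \<bullet> F p + u p * d p)" if "H1_gradient (rect l L) u f" for f
  proof -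
    have "set_integrable lborel (rect l L) u" "set_integrable lborel (rect l L) f"
      using that by (auto simp: H1_gradient_def intro!: L2_set_integrable emeasure_rect)
    then show ?thesis
      using set_integrable_inner_bounded[OF _ mF B1(2)] set_integrable_inner_bounded[OF _ md B2(2)]
      by (intro set_integral_add) auto
  qed
  have "(LINT p:rect l L|lborel. h p \<bullet> F p + u p * d p) = (LINT p:rect l L|lborel. g p \<bullet> F p + u p * d p)"
    using weak_gradient_unique[OF uh ug] set_integrable_measurable[OF i[OF uh]] set_integrable_measurable[OF i[OF ug]]
    by (intro set_integral_cong_AE_rect) auto
  also have "\<dots> = boundary_flux l L S F"
  proof (rule LIMSEQ_unique)
    let ?I = "\<lambda>k. LINT p:rect l L|lborel. Dw k p \<bullet> F p + w k p * d p"
    have ik: "set_integrable lborel (rect l L) (\<lambda>p. Dw k p \<bullet> F p + w k p * d p)" for k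
      using C1_gradient_cont[OF w] C1_gradient_cont'[OF w] cF cd
      by (intro set_integrable_rect_continuous continuous_intros)
    have "(\<lambda>k. LINT p:rect l L|lborel. (Dw k p \<bullet> F p + w k p * d p) - (g p \<bullet> F p + u p * d p)) \<longlonglongrightarrow> 0"
    proof (rule set_integral_tendsto_0_by_squares[OF _ emeasure_rect _ lim, where B="2 * (B1\<^sup>2 + B2\<^sup>2)"])
      fix k
      have "L2 (rect l L) (\<lambda>p. w k p - u p)" "L2 (rect l L) (\<lambda>p. Dw k p - g p)"
        using ug unfolding H1_gradient_def
        by (blast intro: L2_diff L2_rect_continuous C1_gradient_cont[OF w] C1_gradient_cont'[OF w])+
      then show "set_integrable lborel (rect l L) (\<lambda>p. (w k p - u p)\<^sup>2 + (norm (Dw k p - g p))\<^sup>2)"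
        by (intro set_integral_add) (auto simp: L2_def)
      fix p assume p: "p \<in> rect l L"
      define x y where "x = (w k p - u p) * d p" and "y = (Dw k p - g p) \<bullet> F p"
      have "\<bar>x\<bar> \<le> B2 * \<bar>w k p - u p\<bar>"
        using mult_left_mono[OF B2(2)[OF p], of "\<bar>w k p - u p\<bar>"] by (simp add: x_def abs_mult mult.commute)
      then have x: "x\<^sup>2 \<le> B2\<^sup>2 * (w k p - u p)\<^sup>2"
        using power_mono[of "\<bar>x\<bar>" "B2 * \<bar>w k p - u p\<bar>" 2] by (simp add: power_mult_distrib)
      have "\<bar>y\<bar> \<le> B1 * norm (Dw k p - g p)"
        using Cauchy_Schwarz_ineq2[of "Dw k p - g p" "F p"] mult_left_mono[OF B1(2)[OF p], of "norm (Dw k p - g p)"]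
        by (simp add: y_def mult.commute)
      then have y: "y\<^sup>2 \<le> B1\<^sup>2 * (norm (Dw k p - g p))\<^sup>2"
        using power_mono[of "\<bar>y\<bar>" "B1 * norm (Dw k p - g p)" 2] by (simp add: power_mult_distrib)
      have eq: "(Dw k p \<bullet> F p + w k p * d p) - (g p \<bullet> F p + u p * d p) = x + y"
        by (simp add: x_def y_def algebra_simps)
      have "(x + y)\<^sup>2 \<le> 2 * (x\<^sup>2 + y\<^sup>2)" using sum_squares_bound[of x y] by (simp add: power2_sum)
      also have "\<dots> \<le> 2 * (B2\<^sup>2 * (w k p - u p)\<^sup>2 + B1\<^sup>2 * (norm (Dw k p - g p))\<^sup>2)"
        using x y by simp
      also have "\<dots> \<le> 2 * (B1\<^sup>2 + B2\<^sup>2) * ((w k p - u p)\<^sup>2 + (norm (Dw k p - g p))\<^sup>2)"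
      proof -
        have *: "B2\<^sup>2 * s + B1\<^sup>2 * t \<le> (B1\<^sup>2 + B2\<^sup>2) * (s + t)" if "s \<ge> 0" "t \<ge> 0" for s t
          using that by (simp add: distrib_left distrib_right)
        show ?thesis unfolding mult.assoc by (intro mult_left_mono *) auto
      qed
      finally show "((Dw k p \<bullet> F p + w k p * d p) - (g p \<bullet> F p + u p * d p))\<^sup>2
          \<le> 2 * (B1\<^sup>2 + B2\<^sup>2) * ((w k p - u p)\<^sup>2 + (norm (Dw k p - g p))\<^sup>2)"
        unfolding eq .
    qed simp
    then show "?I \<longlonglongrightarrow> (LINT p:rect l L|lborel. g p \<bullet> F p + u p * d p)"
      unfolding set_integral_diff(2)[OF ik i[OF ug]] by (rule LIM_zero_cancel)
    let ?e = "\<lambda>k. boundary_integral l L (\<lambda>x. (w k x - S x)\<^sup>2)"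
    have nn: "0 \<le> (LINT x:A|lborel. (f x)\<^sup>2)" for A and f :: "real \<Rightarrow> real"
      unfolding set_lebesgue_integral_def by (intro integral_nonneg_AE) auto
    have small: "f \<longlonglongrightarrow> 0" if "\<And>k. 0 \<le> f k" "\<And>k. f k \<le> ?e k" for f
      by (rule tendsto_sandwich[OF always_eventually always_eventually tendsto_const blim]) (use that in auto)
    have e: "(\<lambda>k. LINT x:{0..l}|lborel. (w k (x, 0) - S (x, 0))\<^sup>2) \<longlonglongrightarrow> 0"
      "(\<lambda>k. LINT x:{0..l}|lborel. (w k (x, L) - S (x, L))\<^sup>2) \<longlonglongrightarrow> 0"
      "(\<lambda>k. LINT y:{0..L}|lborel. (w k (0, y) - S (0, y))\<^sup>2) \<longlonglongrightarrow> 0"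
      "(\<lambda>k. LINT y:{0..L}|lborel. (w k (l, y) - S (l, y))\<^sup>2) \<longlonglongrightarrow> 0"
      by (rule small; simp add: boundary_integral_def nn add_nonneg_nonneg add_increasing)+
    have "(\<lambda>k. boundary_flux l L (w k) F) \<longlonglongrightarrow> boundary_flux l L S F"
      unfolding boundary_flux_def using S[unfolded boundary_L2_def]
        continuous_on_edges[OF C1_gradient_cont[OF w]]
        continuous_on_edges[OF C1_gradient_cont[OF F(1)]] continuous_on_edges[OF C1_gradient_cont[OF F(2)]]
      by (intro tendsto_add tendsto_diff edge_integral_tendsto e) blast+
    then show "?I \<longlonglongrightarrow> boundary_flux l L S F"
      using green_C1[OF w F l L] by (simp add: d_def)
  qed
  finally show ?thesis by (simp add: d_def)
qed

text \<open>
  For a test function \<open>\<psi>\<close> the two components of the integral of \<open>v D\<psi> + \<psi> Dv\<close> are instances of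
  \<open>green_C1\<close> with the fields \<open>(v, 0)\<close> and \<open>(0, v)\<close>; the flux vanishes with \<open>\<psi>\<close> on the boundary.
\<close>

lemma H1_gradient_C1:
  assumes v: "C1_gradient v Dv" and l: "l \<ge> 0" and L: "L \<ge> 0"
  shows "H1_gradient (rect l L) v Dv"
  unfolding H1_gradient_def
proof (intro conjI allI impI)
  show "L2 (rect l L) v" "L2 (rect l L) Dv"
    using C1_gradient_cont[OF v] C1_gradient_cont'[OF v] by (auto intro: L2_rect_continuous)
  fix \<psi> D assume \<psi>: "test_function (rect l L) \<psi>" and D: "\<forall>x. GDERIV \<psi> x :> D x"
  obtain E where E: "C1_gradient \<psi> E" using \<psi> smooth_C1_gradient by (auto simp: test_function_def)
  have "D = E" using D E gderiv_unique unfolding C1_gradient_def by blast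
  with E have \<psi>D: "C1_gradient \<psi> D" by simp
  have "\<psi> p = 0" if "p \<notin> rect l L" for p
    using \<psi> that closure_subset[of "{x. \<psi> x \<noteq> 0}"] by (auto simp: test_function_def)
  then have flux: "boundary_flux l L \<psi> F = 0" for F
    by (simp add: boundary_flux_def rect_def)
  note ci = C1_gradient_cont[OF v] C1_gradient_cont'[OF v] C1_gradient_cont[OF \<psi>D] C1_gradient_cont'[OF \<psi>D]
  have zero: "C1_gradient (\<lambda>p::real\<times>real. 0) (\<lambda>p. 0)" by (auto simp: C1_gradient_def GDERIV_const)
  have int: "set_integrable lborel (rect l L) (\<lambda>p. v p *\<^sub>R D p)" "set_integrable lborel (rect l L) (\<lambda>p. \<psi> p *\<^sub>R Dv p)"
    by (intro set_integrable_rect_continuous continuous_intros ci)+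
  have split: "(LINT p:rect l L|lborel. (v p *\<^sub>R D p + \<psi> p *\<^sub>R Dv p) \<bullet> b)
      = (LINT p:rect l L|lborel. v p *\<^sub>R D p) \<bullet> b + (LINT p:rect l L|lborel. \<psi> p *\<^sub>R Dv p) \<bullet> b" for b
    using integral_inner_left[of b lborel "\<lambda>p. indicat_real (rect l L) p *\<^sub>R (v p *\<^sub>R D p + \<psi> p *\<^sub>R Dv p)"]
      set_integral_add[OF int]
    by (simp add: set_lebesgue_integral_def set_integrable_def inner_add_left)
  have b1: "(LINT p:rect l L|lborel. (v p *\<^sub>R D p + \<psi> p *\<^sub>R Dv p) \<bullet> (1, 0)) = 0"
    using green_C1[OF \<psi>D, of "\<lambda>p. (v p, 0)" Dv "\<lambda>_. 0", OF _ _ l L] v zero flux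
    by (simp add: inner_prod_def mult.commute)
  have b2: "(LINT p:rect l L|lborel. (v p *\<^sub>R D p + \<psi> p *\<^sub>R Dv p) \<bullet> (0, 1)) = 0"
    using green_C1[OF \<psi>D, of "\<lambda>p. (0, v p)" "\<lambda>_. 0" Dv, OF _ _ l L] v zero flux
    by (simp add: inner_prod_def mult.commute)
  show "(LINT p:rect l L|lborel. v p *\<^sub>R D p) = - (LINT p:rect l L|lborel. \<psi> p *\<^sub>R Dv p)"
    using b1 b2 unfolding split
    by (intro prod_eqI) (auto simp: inner_prod_def)
qed

lemma has_trace_C1:
  assumes v: "C1_gradient v Dv" and l: "l \<ge> 0" and L: "L \<ge> 0"
  shows "has_trace l L v v"
proof -
  have "boundary_L2 l L v"
    using C1_gradient_cont[OF v, of UNIV] by (auto simp: boundary_L2_def intro!: L2_interval_continuous continuous_on_edges)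
  moreover have "H1_gradient (rect l L) v Dv" by (rule H1_gradient_C1[OF v l L])
  ultimately show ?thesis
    unfolding has_trace_def using v
    by (intro conjI exI[of _ Dv] exI[of _ "\<lambda>_. v"] exI[of _ "\<lambda>_. Dv"])
      (auto simp: C1_gradient_def boundary_integral_def)
qed

section \<open>Product modes on the rectangle\<close>

lemma set_integrable_sum:
  fixes f :: "'i \<Rightarrow> 'a \<Rightarrow> 'b::{banach, second_countable_topology}"
  assumes "\<And>i. i \<in> I \<Longrightarrow> set_integrable M A (f i)"
  shows "set_integrable M A (\<lambda>x. \<Sum>i\<in>I. f i x)"
  using assms unfolding set_integrable_def scaleR_sum_right by (intro Bochner_Integration.integrable_sum)

lemma set_integral_sum:
  fixes f :: "'i \<Rightarrow> 'a \<Rightarrow> 'b::{banach, second_countable_topology}"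
  assumes "\<And>i. i \<in> I \<Longrightarrow> set_integrable M A (f i)"
  shows "(LINT x:A|M. (\<Sum>i\<in>I. f i x)) = (\<Sum>i\<in>I. LINT x:A|M. f i x)"
  using assms unfolding set_integrable_def set_lebesgue_integral_def scaleR_sum_right
  by (intro Bochner_Integration.integral_sum)

lemma set_integrable_mult_continuous:
  fixes f g :: "real \<times> real \<Rightarrow> real"
  assumes f: "set_integrable lborel (rect l L) f" and g: "continuous_on UNIV g"
  shows "set_integrable lborel (rect l L) (\<lambda>p. f p * g p)"
proof -
  obtain B where B: "\<And>p. p \<in> rect l L \<Longrightarrow> norm (g p) \<le> B" using continuous_bounded_rect[OF g] by blast
  have "set_integrable lborel (rect l L) (\<lambda>p. f p \<bullet> g p)"
    by (rule set_integrable_inner_bounded[OF f set_borel_measurable_continuous[OF continuous_on_subset[OF g]] B]) simp_all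
  then show ?thesis by simp
qed

lemma continuous_on_product:
  assumes "continuous_on UNIV f" "continuous_on UNIV g"
  shows "continuous_on UNIV (\<lambda>p. f (fst p) * g (snd p) :: real)"
  by (intro continuous_intros continuous_on_compose2[OF assms(1)] continuous_on_compose2[OF assms(2)]) auto

definition rect_mode :: "real \<Rightarrow> real \<Rightarrow> real \<Rightarrow> nat \<times> nat \<Rightarrow> real \<times> real \<Rightarrow> real" where
  "rect_mode l L \<alpha> q p = robin_mode l \<alpha> (fst q) (fst p) * robin_mode L \<alpha> (snd q) (snd p)"

definition rect_mode' :: "real \<Rightarrow> real \<Rightarrow> real \<Rightarrow> nat \<times> nat \<Rightarrow> real \<times> real \<Rightarrow> real \<times> real" where
  "rect_mode' l L \<alpha> q p =
     (robin_mode' l \<alpha> (fst q) (fst p) * robin_mode L \<alpha> (snd q) (snd p),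
      robin_mode l \<alpha> (fst q) (fst p) * robin_mode' L \<alpha> (snd q) (snd p))"

definition rect_value :: "real \<Rightarrow> real \<Rightarrow> real \<Rightarrow> nat \<times> nat \<Rightarrow> real" where
  "rect_value l L \<alpha> q = (robin_freq l \<alpha> (fst q))\<^sup>2 + (robin_freq L \<alpha> (snd q))\<^sup>2"

context
  fixes l L \<alpha> :: real
  assumes l: "l > 0" and L: "L > 0" and \<alpha>: "\<alpha> > 0"
begin

abbreviation (input) "M \<equiv> rect_mode l L \<alpha>"
abbreviation (input) "M' \<equiv> rect_mode' l L \<alpha>"
abbreviation (input) "\<Lambda> \<equiv> rect_value l L \<alpha>"

lemma rect_mode_gradient: "C1_gradient (M q) (M' q)"
  unfolding rect_mode_def[abs_def] rect_mode'_def[abs_def]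
  by (rule C1_gradient_product[OF C1_robin_mode C1_robin_mode])

lemma H1_gradient_rect_mode: "H1_gradient (rect l L) (M q) (M' q)"
  using H1_gradient_C1[OF rect_mode_gradient] l L by simp

lemma has_trace_rect_mode: "has_trace l L (M q) (M q)"
  using has_trace_C1[OF rect_mode_gradient] l L by simp

text \<open>
  On each side the normal derivative of a mode is \<open>-\<alpha>\<close> times the mode.
\<close>

lemma rect_mode_boundary_flux:
  "boundary_flux l L S (M' q) = - \<alpha> * boundary_integral l L (\<lambda>p. S p * M q p)"
proof -
  have pull: "(LINT x:A|lborel. f x) = c * (LINT x:A|lborel. g x)" if "\<And>x. f x = c * g x"
    for A :: "real set" and f g :: "real \<Rightarrow> real" and c
    by (simp only: that set_integral_mult_right)
  note edges = robin_mode_left robin_mode_right[OF l \<alpha>] robin_mode_right[OF L \<alpha>]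
  have "(LINT y:{0..L}|lborel. S (l, y) * fst (M' q (l, y))) = - \<alpha> * (LINT y:{0..L}|lborel. S (l, y) * M q (l, y))"
    "(LINT y:{0..L}|lborel. S (0, y) * fst (M' q (0, y))) = \<alpha> * (LINT y:{0..L}|lborel. S (0, y) * M q (0, y))"
    "(LINT x:{0..l}|lborel. S (x, L) * snd (M' q (x, L))) = - \<alpha> * (LINT x:{0..l}|lborel. S (x, L) * M q (x, L))"
    "(LINT x:{0..l}|lborel. S (x, 0) * snd (M' q (x, 0))) = \<alpha> * (LINT x:{0..l}|lborel. S (x, 0) * M q (x, 0))"
    by (rule pull; simp add: rect_mode_def rect_mode'_def edges)+
  then show ?thesis
    unfolding boundary_flux_def boundary_integral_def by (simp only:) (simp add: algebra_simps)
qed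

text \<open>
  Green's formula for the field \<open>F = \<nabla>M\<^sub>q\<close>, whose divergence is \<open>-\<Lambda>\<^sub>q M\<^sub>q\<close>. It shows at once that
  modes are eigenfunctions and, because it holds for every \<open>u \<in> H\<^sup>1\<close>, that eigenfunctions are
  orthogonal to modes of other eigenvalues.
\<close>

lemma robin_form_rect_mode:
  assumes u: "H1_gradient (rect l L) u h" and S: "has_trace l L u S"
  shows "(LINT p:rect l L|lborel. h p \<bullet> M' q p) + \<alpha> * boundary_integral l L (\<lambda>p. S p * M q p)
     = \<Lambda> q * (LINT p:rect l L|lborel. u p * M q p)"
proof -
  obtain i j where q: "q = (i, j)" by fastforce
  let ?D1 = "\<lambda>p. (- (robin_freq l \<alpha> i)\<^sup>2 * robin_mode l \<alpha> i (fst p) * robin_mode L \<alpha> j (snd p),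
      robin_mode' l \<alpha> i (fst p) * robin_mode' L \<alpha> j (snd p))"
  let ?D2 = "\<lambda>p. (robin_mode' l \<alpha> i (fst p) * robin_mode' L \<alpha> j (snd p),
      robin_mode l \<alpha> i (fst p) * (- (robin_freq L \<alpha> j)\<^sup>2 * robin_mode L \<alpha> j (snd p)))"
  have F: "C1_gradient (\<lambda>p. fst (M' q p)) ?D1" "C1_gradient (\<lambda>p. snd (M' q p)) ?D2"
    unfolding rect_mode'_def q fst_conv snd_conv
    by (rule C1_gradient_product C1_robin_mode C1_robin_mode')+
  have i: "set_integrable lborel (rect l L) u" "set_integrable lborel (rect l L) h"
    using u by (auto simp: H1_gradient_def intro!: L2_set_integrable emeasure_rect)
  note c = C1_gradient_cont[OF rect_mode_gradient] C1_gradient_cont'[OF rect_mode_gradient]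
  obtain B1 where B1: "\<And>p. p \<in> rect l L \<Longrightarrow> norm (M' q p) \<le> B1" using continuous_bounded_rect[OF c(2)] by blast
  obtain B2 where B2: "\<And>p. p \<in> rect l L \<Longrightarrow> norm (M q p) \<le> B2" using continuous_bounded_rect[OF c(1)] by blast
  have i1: "set_integrable lborel (rect l L) (\<lambda>p. h p \<bullet> M' q p)"
    by (rule set_integrable_inner_bounded[OF i(2) set_borel_measurable_continuous[OF c(2)] B1]) simp_all
  have "set_integrable lborel (rect l L) (\<lambda>p. u p \<bullet> M q p)"
    by (rule set_integrable_inner_bounded[OF i(1) set_borel_measurable_continuous[OF c(1)] B2]) simp_all
  then have i2: "set_integrable lborel (rect l L) (\<lambda>p. - \<Lambda> q * (u p * M q p))" by (intro set_integrable_mult_right) simp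
  have "(LINT p:rect l L|lborel. h p \<bullet> M' q p + - \<Lambda> q * (u p * M q p)) = boundary_flux l L S (M' q)"
    using green_H1[OF u S F] l L
    by (simp add: rect_value_def rect_mode_def q algebra_simps)
  then have "(LINT p:rect l L|lborel. h p \<bullet> M' q p) + (LINT p:rect l L|lborel. - \<Lambda> q * (u p * M q p))
      = - \<alpha> * boundary_integral l L (\<lambda>p. S p * M q p)"
    using set_integral_add(2)[OF i1 i2] by (simp add: rect_mode_boundary_flux)
  then show ?thesis by (simp only: set_integral_mult_right)
qed

lemma rect_mode_in_eigenspace: "M q \<in> robin_eigenspace l L \<alpha> (\<Lambda> q)"
  unfolding robin_eigenspace_def H1_def
proof (intro CollectI conjI exI ballI allI impI)
  show "H1_gradient (rect l L) (M q) (M' q)" by (rule H1_gradient_rect_mode)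
  then show "H1_gradient (rect l L) (M q) (M' q)" .
  show "has_trace l L (M q) (M q)" by (rule has_trace_rect_mode)
  fix v h S assume "H1_gradient (rect l L) v h" "has_trace l L v S"
  then show "(LINT p:rect l L|lborel. M' q p \<bullet> h p) + \<alpha> * boundary_integral l L (\<lambda>p. M q p * S p)
     = \<Lambda> q * (LINT p:rect l L|lborel. M q p * v p)"
    using robin_form_rect_mode[of v h S q] by (simp add: inner_commute mult.commute)
qed

lemma eigenfunction_orthogonal_to_modes:
  assumes \<phi>: "\<phi> \<in> robin_eigenspace l L \<alpha> \<mu>" and "\<Lambda> q \<noteq> \<mu>"
  shows "(LINT p:rect l L|lborel. \<phi> p * M q p) = 0"
proof -
  from \<phi> obtain g T where gT: "H1_gradient (rect l L) \<phi> g" "has_trace l L \<phi> T"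
    and eq: "\<forall>v\<in>H1 (rect l L). \<forall>h S. H1_gradient (rect l L) v h \<longrightarrow> has_trace l L v S \<longrightarrow>
          (LINT x:rect l L|lborel. g x \<bullet> h x) + \<alpha> * boundary_integral l L (\<lambda>x. T x * S x)
            = \<mu> * (LINT x:rect l L|lborel. \<phi> x * v x)"
    unfolding robin_eigenspace_def by blast
  have "M q \<in> H1 (rect l L)" using H1_gradient_rect_mode[of q] unfolding H1_def by blast
  then have E: "(LINT x:rect l L|lborel. g x \<bullet> M' q x) + \<alpha> * boundary_integral l L (\<lambda>x. T x * M q x)
            = \<mu> * (LINT x:rect l L|lborel. \<phi> x * M q x)"
    using eq H1_gradient_rect_mode has_trace_rect_mode by blast
  have "\<Lambda> q * (LINT x:rect l L|lborel. \<phi> x * M q x) = \<mu> * (LINT x:rect l L|lborel. \<phi> x * M q x)"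
    by (rule trans[OF robin_form_rect_mode[OF gT, symmetric] E])
  with assms(2) show ?thesis by (metis mult_cancel_right)
qed

lemma rect_mode_integral_product:
  "(LINT p:rect l L|lborel. M q p * M r p) =
     integral {0..l} (\<lambda>x. robin_mode l \<alpha> (fst q) x * robin_mode l \<alpha> (fst r) x) *
     integral {0..L} (\<lambda>y. robin_mode L \<alpha> (snd q) y * robin_mode L \<alpha> (snd r) y)"
proof -
  have "M q p * M r p = (\<lambda>x. robin_mode l \<alpha> (fst q) x * robin_mode l \<alpha> (fst r) x) (fst p) *
      (\<lambda>y. robin_mode L \<alpha> (snd q) y * robin_mode L \<alpha> (snd r) y) (snd p)" for p
    by (simp add: rect_mode_def)
  then show ?thesis
    by (simp only:) (intro rect_integral_product continuous_intros C1_cont[OF C1_robin_mode])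
qed

lemma rect_modes_orthogonal: "q \<noteq> r \<Longrightarrow> (LINT p:rect l L|lborel. M q p * M r p) = 0"
  unfolding rect_mode_integral_product
  using robin_mode_orthogonal[OF l \<alpha>, of "fst q" "fst r"] robin_mode_orthogonal[OF L \<alpha>, of "snd q" "snd r"]
  by (cases "fst q = fst r") (auto simp: prod_eq_iff)

lemma rect_mode_norm_pos: "(LINT p:rect l L|lborel. M q p * M q p) > 0"
  unfolding rect_mode_integral_product
  using robin_mode_norm_pos[OF l \<alpha>, of "fst q"] robin_mode_norm_pos[OF L \<alpha>, of "snd q"]
  by (simp add: power2_eq_square)

text \<open>
  Both factors are uniform limits of combinations of interval modes, and uniform convergence suffices
  because \<open>f\<close> is integrable.
\<close>

lemma orthogonal_to_modes_imp_orthogonal_to_products: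
  assumes f: "set_integrable lborel (rect l L) f" and orth: "\<And>q. (LINT p:rect l L|lborel. f p * M q p) = 0"
    and a: "C1 a a'" and b: "C1 b b'"
  shows "(LINT p:rect l L|lborel. f p * (a (fst p) * b (snd p))) = 0"
proof -
  obtain A where A: "\<And>x. x \<in> {0..l} \<Longrightarrow> \<bar>a x\<bar> \<le> A" "A \<ge> 0" using continuous_bounded_interval[OF C1_cont[OF a]] by blast
  obtain B where B: "\<And>x. x \<in> {0..L} \<Longrightarrow> \<bar>b x\<bar> \<le> B" "B \<ge> 0" using continuous_bounded_interval[OF C1_cont[OF b]] by blast
  define I where "I = (LINT p:rect l L|lborel. f p * (a (fst p) * b (snd p)))"
  define N where "N = (LINT p:rect l L|lborel. \<bar>f p\<bar>)"
  have N: "N \<ge> 0" unfolding N_def set_lebesgue_integral_def by (intro integral_nonneg_AE) auto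
  have bound: "\<bar>I\<bar> \<le> N * (A + B + 1) * e" if e: "0 < e" "e \<le> 1" for e
  proof -
    obtain m c where c: "\<And>x. x \<in> {0..l} \<Longrightarrow> \<bar>a x - (\<Sum>i<m. c i * robin_mode l \<alpha> i x)\<bar> < e"
      using robin_modes_uniformly_dense[OF l \<alpha> a e(1)] by blast
    obtain n d where d: "\<And>y. y \<in> {0..L} \<Longrightarrow> \<bar>b y - (\<Sum>j<n. d j * robin_mode L \<alpha> j y)\<bar> < e"
      using robin_modes_uniformly_dense[OF L \<alpha> b e(1)] by blast
    define ah bh where "ah x = (\<Sum>i<m. c i * robin_mode l \<alpha> i x)" and "bh y = (\<Sum>j<n. d j * robin_mode L \<alpha> j y)" for x y
    have ch: "continuous_on UNIV ah" "continuous_on UNIV bh"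
      unfolding ah_def[abs_def] bh_def[abs_def] by (intro continuous_intros C1_cont[OF C1_robin_mode])+
    have i1: "set_integrable lborel (rect l L) (\<lambda>p. f p * (a (fst p) * b (snd p)))"
      by (intro set_integrable_mult_continuous f continuous_on_product C1_cont[OF a] C1_cont[OF b])
    have i2: "set_integrable lborel (rect l L) (\<lambda>p. f p * (ah (fst p) * bh (snd p)))"
      by (intro set_integrable_mult_continuous f continuous_on_product ch)
    have iM: "set_integrable lborel (rect l L) (\<lambda>p. c i * d j * (f p * M (i, j) p))" for i j
      by (intro set_integrable_mult_right set_integrable_mult_continuous f C1_gradient_cont[OF rect_mode_gradient])
    have "f p * (ah (fst p) * bh (snd p)) = (\<Sum>i<m. \<Sum>j<n. c i * d j * (f p * M (i, j) p))" for p
      unfolding ah_def bh_def sum_product unfolding sum_distrib_left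
      by (intro sum.cong refl) (simp add: rect_mode_def mult_ac)
    then have "(LINT p:rect l L|lborel. f p * (ah (fst p) * bh (snd p))) =
        (LINT p:rect l L|lborel. (\<Sum>i<m. \<Sum>j<n. c i * d j * (f p * M (i, j) p)))" by simp
    also have "\<dots> = (\<Sum>i<m. \<Sum>j<n. LINT p:rect l L|lborel. c i * d j * (f p * M (i, j) p))"
      by (simp only: set_integral_sum[OF set_integrable_sum[OF iM]] set_integral_sum[OF iM])
    also have "\<dots> = 0" using orth by (simp only: set_integral_mult_right) simp
    finally have "I = (LINT p:rect l L|lborel. f p * (a (fst p) * b (snd p)) - f p * (ah (fst p) * bh (snd p)))"
      using set_integral_diff(2)[OF i1 i2] by (simp add: I_def)
    also have "\<bar>\<dots>\<bar> \<le> (LINT p|lborel. norm (indicat_real (rect l L) p *\<^sub>R (f p * (a (fst p) * b (snd p)) - f p * (ah (fst p) * bh (snd p)))))"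
      unfolding set_lebesgue_integral_def real_norm_def[symmetric] by (rule integral_norm_bound)
    also have "\<dots> \<le> (LINT p|lborel. (A + B + 1) * e * (indicat_real (rect l L) p *\<^sub>R \<bar>f p\<bar>))"
    proof (rule integral_mono')
      show "integrable lborel (\<lambda>p. (A + B + 1) * e * (indicat_real (rect l L) p *\<^sub>R \<bar>f p\<bar>))"
        using set_integrable_abs[OF f] unfolding set_integrable_def by (intro integrable_mult_right)
      fix p :: "real \<times> real"
      show "0 \<le> (A + B + 1) * e * (indicat_real (rect l L) p *\<^sub>R \<bar>f p\<bar>)" using A B e by simp
      show "norm (indicat_real (rect l L) p *\<^sub>R (f p * (a (fst p) * b (snd p)) - f p * (ah (fst p) * bh (snd p))))
          \<le> (A + B + 1) * e * (indicat_real (rect l L) p *\<^sub>R \<bar>f p\<bar>)"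
      proof (cases "p \<in> rect l L")
        case True
        obtain x y where p: "p = (x, y)" by fastforce
        have x: "x \<in> {0..l}" and y: "y \<in> {0..L}" using True by (auto simp: rect_def p)
        have "\<bar>a x\<bar> * \<bar>b y - bh y\<bar> \<le> A * e"
          using A(1)[OF x] A(2) d[OF y] by (intro mult_mono) (auto simp: bh_def)
        moreover have "\<bar>bh y\<bar> \<le> B + 1" using B(1)[OF y] d[OF y] e by (simp add: bh_def)
        then have "\<bar>a x - ah x\<bar> * \<bar>bh y\<bar> \<le> e * (B + 1)"
          using c[OF x] e by (intro mult_mono) (auto simp: ah_def)
        moreover have "a x * b y - ah x * bh y = a x * (b y - bh y) + (a x - ah x) * bh y"
          by (simp add: algebra_simps)
        then have "\<bar>a x * b y - ah x * bh y\<bar> \<le> \<bar>a x\<bar> * \<bar>b y - bh y\<bar> + \<bar>a x - ah x\<bar> * \<bar>bh y\<bar>"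
          using abs_triangle_ineq[of "a x * (b y - bh y)" "(a x - ah x) * bh y"]
          by (simp only: abs_mult)
        moreover have "A * e + e * (B + 1) = (A + B + 1) * e" by (simp add: algebra_simps)
        ultimately have "\<bar>a x * b y - ah x * bh y\<bar> \<le> (A + B + 1) * e" by linarith
        then have "\<bar>f p\<bar> * \<bar>a x * b y - ah x * bh y\<bar> \<le> \<bar>f p\<bar> * ((A + B + 1) * e)"
          by (intro mult_left_mono) auto
        then show ?thesis using True by (simp add: p abs_mult[symmetric] right_diff_distrib mult.commute)
      qed simp
    qed
    also have "\<dots> = N * (A + B + 1) * e" by (simp add: N_def set_lebesgue_integral_def)
    finally show ?thesis .
  qed
  have "\<bar>I\<bar> \<le> 0"
  proof (rule field_le_epsilon)
    fix e :: real assume e: "e > 0"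
    define K where "K = N * (A + B + 1)"
    have K: "K \<ge> 0" using N A B by (simp add: K_def)
    \<comment> \<open>The summand \<open>1\<close> keeps the denominator positive, since \<open>K = 0\<close> for \<open>f = 0\<close>.\<close>
    define e' where "e' = min 1 (e / (K + 1))"
    have "\<bar>I\<bar> \<le> K * e'" using bound[of e'] e K by (simp add: e'_def K_def)
    also have "\<dots> \<le> (K + 1) * (e / (K + 1))" using e K by (intro mult_mono) (auto simp: e'_def)
    also have "\<dots> = e" using K by simp
    finally show "\<bar>I\<bar> \<le> 0 + e" by simp
  qed
  then show ?thesis by (simp add: I_def)
qed

theorem rect_modes_complete:
  assumes f: "set_integrable lborel (rect l L) f" and orth: "\<And>q. (LINT p:rect l L|lborel. f p * M q p) = 0"
  shows "AE p\<in>rect l L in lborel. f p = 0"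
proof (rule AE_zero_if_orthogonal_to_cutoffs[OF f])
  fix a b c d :: real and n
  obtain u' v' where "C1 (cutoff a b (Suc n)) u'" "C1 (cutoff c d (Suc n)) v'" using C1_cutoff by meson
  from orthogonal_to_modes_imp_orthogonal_to_products[OF f orth this]
  show "(LINT p:rect l L|lborel. (cutoff a b (Suc n) (fst p) * cutoff c d (Suc n) (snd p)) *\<^sub>R f p) = 0"
    by (simp add: mult.commute)
qed

lemma rect_mode_combination_integral:
  assumes P: "finite P"
  shows "(LINT p:rect l L|lborel. (\<Sum>r\<in>P. c r * M r p) * M q p) = (if q \<in> P then c q * (LINT p:rect l L|lborel. M q p * M q p) else 0)"
proof -
  have i: "set_integrable lborel (rect l L) (\<lambda>p. c r * (M r p * M q p))" for r
    by (intro set_integrable_rect_continuous continuous_intros C1_gradient_cont[OF rect_mode_gradient])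
  have "(LINT p:rect l L|lborel. (\<Sum>r\<in>P. c r * M r p) * M q p) = (LINT p:rect l L|lborel. (\<Sum>r\<in>P. c r * (M r p * M q p)))"
    by (simp add: sum_distrib_right mult.assoc)
  also have "\<dots> = (\<Sum>r\<in>P. LINT p:rect l L|lborel. c r * (M r p * M q p))"
    by (rule set_integral_sum[OF i])
  also have "\<dots> = (\<Sum>r\<in>P. c r * (LINT p:rect l L|lborel. M r p * M q p))"
    by (simp only: set_integral_mult_right)
  also have "\<dots> = (\<Sum>r\<in>P. if r = q then c q * (LINT p:rect l L|lborel. M q p * M q p) else 0)"
    by (intro sum.cong) (auto simp: rect_modes_orthogonal)
  also have "\<dots> = (if q \<in> P then c q * (LINT p:rect l L|lborel. M q p * M q p) else 0)"
    using P by simp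
  finally show ?thesis .
qed

lemma rect_modes_independent:
  assumes P: "finite P" and z: "AE p\<in>rect l L in lborel. (\<Sum>r\<in>P. c r * M r p) = 0" and q: "q \<in> P"
  shows "c q = 0"
proof -
  note ci = continuous_intros C1_gradient_cont[OF rect_mode_gradient]
  have "set_integrable lborel (rect l L) (\<lambda>p. (\<Sum>r\<in>P. c r * M r p) * M q p)"
    by (intro set_integrable_rect_continuous ci)
  then have "(LINT p:rect l L|lborel. (\<Sum>r\<in>P. c r * M r p) * M q p) = (LINT p:rect l L|lborel. 0)"
    using z by (intro set_integral_cong_AE_rect set_integrable_measurable)
      (auto elim: eventually_mono simp: set_integrable_def)
  then have "c q * (LINT p:rect l L|lborel. M q p * M q p) = 0"
    using q by (simp add: rect_mode_combination_integral[OF P])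
  with rect_mode_norm_pos[of q] show ?thesis by simp
qed

text \<open>
  Subtracting the projection onto the finitely many modes of the eigenvalue \<open>\<mu>\<close> leaves a function
  orthogonal to all modes.
\<close>

lemma eigenfunction_expansion:
  assumes \<phi>: "\<phi> \<in> robin_eigenspace l L \<alpha> \<mu>" and P: "finite {q. \<Lambda> q = \<mu>}"
  shows "\<exists>c. AE p\<in>rect l L in lborel. \<phi> p = (\<Sum>q | \<Lambda> q = \<mu>. c q * M q p)"
proof -
  define n where "n q = (LINT p:rect l L|lborel. M q p * M q p)" for q
  define c where "c q = (LINT p:rect l L|lborel. \<phi> p * M q p) / n q" for q
  let ?s = "\<lambda>p. \<Sum>q | \<Lambda> q = \<mu>. c q * M q p"
  note ci = continuous_intros C1_gradient_cont[OF rect_mode_gradient]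
  have i: "set_integrable lborel (rect l L) \<phi>"
    using \<phi> by (auto simp: robin_eigenspace_def H1_gradient_def intro!: L2_set_integrable emeasure_rect)
  have sint: "set_integrable lborel (rect l L) ?s" by (intro set_integrable_rect_continuous ci)
  have "AE p\<in>rect l L in lborel. \<phi> p - ?s p = 0"
  proof (rule rect_modes_complete)
    show "set_integrable lborel (rect l L) (\<lambda>p. \<phi> p - ?s p)" by (intro set_integral_diff i sint)
    fix q
    have "(LINT p:rect l L|lborel. (\<phi> p - ?s p) * M q p) = (LINT p:rect l L|lborel. \<phi> p * M q p) - (LINT p:rect l L|lborel. ?s p * M q p)"
      unfolding left_diff_distrib
      by (intro set_integral_diff set_integrable_mult_continuous i sint C1_gradient_cont[OF rect_mode_gradient])
    also have "(LINT p:rect l L|lborel. ?s p * M q p) = (if \<Lambda> q = \<mu> then c q * n q else 0)"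
      unfolding rect_mode_combination_integral[OF P] n_def by simp
    also have "(LINT p:rect l L|lborel. \<phi> p * M q p) - (if \<Lambda> q = \<mu> then c q * n q else 0) = 0"
      using eigenfunction_orthogonal_to_modes[OF \<phi>, of q] rect_mode_norm_pos[of q]
      by (auto simp: c_def n_def)
    finally show "(LINT p:rect l L|lborel. (\<phi> p - ?s p) * M q p) = 0" .
  qed
  then show ?thesis by (intro exI[of _ c]) simp
qed

end

section \<open>Eigenvalues and their multiplicities\<close>

text \<open>
  If \<open>m > k\<close>, the \<open>m\<close> coefficient vectors of the second basis with respect to the first are linearly
  dependent.
\<close>

lemma has_ae_dim_le:
  assumes V: "has_ae_dim D V k" and W: "has_ae_dim D V m"
  shows "m \<le> k"
proof (rule ccontr)
  assume "\<not> m \<le> k"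
  from V obtain b where b: "\<And>i. i < k \<Longrightarrow> b i \<in> V" "\<And>u. u \<in> V \<Longrightarrow> \<exists>c. AE x\<in>D in lborel. u x = (\<Sum>i<k. c i * b i x)"
    unfolding has_ae_dim_def by blast
  from W obtain d where d: "\<And>i. i < m \<Longrightarrow> d i \<in> V"
    "\<And>c. (AE x\<in>D in lborel. (\<Sum>i<m. c i * d i x) = 0) \<Longrightarrow> (\<forall>i<m. c i = 0)"
    unfolding has_ae_dim_def by blast
  have "\<forall>j. \<exists>c. j < m \<longrightarrow> (AE x\<in>D in lborel. d j x = (\<Sum>i<k. c i * b i x))" using b(2) d(1) by blast
  then obtain A where A: "\<And>j. j < m \<Longrightarrow> AE x\<in>D in lborel. d j x = (\<Sum>i<k. A j i * b i x)" by metis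
  have "k < card {..<m}" using \<open>\<not> m \<le> k\<close> by simp
  from homogeneous_system_nontrivial_solution[OF finite_lessThan this, of "\<lambda>i j. A j i"]
  obtain c where c: "\<exists>j\<in>{..<m}. c j \<noteq> 0" "\<forall>i<k. (\<Sum>j<m. A j i * c j) = 0" by blast
  have "AE x in lborel. \<forall>j\<in>{..<m}. x \<in> D \<longrightarrow> d j x = (\<Sum>i<k. A j i * b i x)"
    using A by (intro AE_finite_allI) auto
  then have "AE x\<in>D in lborel. (\<Sum>j<m. c j * d j x) = 0"
  proof eventually_elim
    case (elim x)
    show ?case
    proof
      assume "x \<in> D"
      then have "(\<Sum>j<m. c j * d j x) = (\<Sum>j<m. c j * (\<Sum>i<k. A j i * b i x))" using elim by simp
      also have "\<dots> = (\<Sum>j<m. \<Sum>i<k. A j i * c j * b i x)" by (simp add: sum_distrib_left mult_ac)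
      also have "\<dots> = (\<Sum>i<k. (\<Sum>j<m. A j i * c j) * b i x)"
        by (subst sum.swap) (simp add: sum_distrib_right)
      also have "\<dots> = 0" using c(2) by simp
      finally show "(\<Sum>j<m. c j * d j x) = 0" .
    qed
  qed
  with d(2) c(1) show False by auto
qed

lemma has_ae_dim_unique: "has_ae_dim D V k \<Longrightarrow> has_ae_dim D V m \<Longrightarrow> k = m"
  by (meson has_ae_dim_le le_antisym)

lemma has_ae_dim_robin_eigenspace:
  assumes pos: "l > 0" "L > 0" "\<alpha> > 0" and P: "finite {q. rect_value l L \<alpha> q = \<mu>}"
  shows "has_ae_dim (rect l L) (robin_eigenspace l L \<alpha> \<mu>) k \<longleftrightarrow> k = card {q. rect_value l L \<alpha> q = \<mu>}"
proof -
  let ?P = "{q. rect_value l L \<alpha> q = \<mu>}"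
  obtain e where e: "bij_betw e {..<card ?P} ?P" using ex_bij_betw_nat_finite[OF P] by (auto simp: lessThan_atLeast0)
  then have eP: "rect_value l L \<alpha> (e i) = \<mu>" if "i < card ?P" for i using that bij_betwE by blast
  define b where "b i = rect_mode l L \<alpha> (e i)" for i
  have sum_e: "(\<Sum>i<card ?P. f (e i)) = sum f ?P" for f :: "_ \<Rightarrow> real"
    by (rule sum.reindex_bij_betw[OF e])
  have dim: "has_ae_dim (rect l L) (robin_eigenspace l L \<alpha> \<mu>) (card ?P)"
    unfolding has_ae_dim_def
  proof (intro exI[of _ b] conjI allI impI ballI)
    fix i assume "i < card ?P"
    then show "b i \<in> robin_eigenspace l L \<alpha> \<mu>"
      using rect_mode_in_eigenspace[OF pos, of "e i"] eP by (simp add: b_def)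
  next
    fix c i assume z: "AE p\<in>rect l L in lborel. (\<Sum>i<card ?P. c i * b i p) = 0" and i: "i < card ?P"
    define c' where "c' q = c (the_inv_into {..<card ?P} e q)" for q
    have c': "c' (e j) = c j" if "j < card ?P" for j
      using e that by (simp add: c'_def bij_betw_def the_inv_into_f_f)
    have "(\<Sum>i<card ?P. c i * b i p) = (\<Sum>q\<in>?P. c' q * rect_mode l L \<alpha> q p)" for p
      by (subst sum_e[symmetric]) (simp add: c' b_def)
    then have "c' (e i) = 0"
      using z eP[OF i] by (intro rect_modes_independent[OF pos P]) auto
    then show "c i = 0" using c' i by simp
  next
    fix u assume "u \<in> robin_eigenspace l L \<alpha> \<mu>"
    then obtain c where c: "AE p\<in>rect l L in lborel. u p = (\<Sum>q\<in>?P. c q * rect_mode l L \<alpha> q p)"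
      using eigenfunction_expansion[OF pos _ P] by blast
    have "(\<Sum>q\<in>?P. c q * rect_mode l L \<alpha> q p) = (\<Sum>i<card ?P. c (e i) * b i p)" for p
      by (subst sum_e[symmetric]) (simp add: b_def)
    then show "\<exists>c. AE p\<in>rect l L in lborel. u p = (\<Sum>i<card ?P. c i * b i p)"
      using c by (intro exI[of _ "\<lambda>i. c (e i)"]) simp
  qed
  then show ?thesis using has_ae_dim_unique by blast
qed

lemma robin_eigenvalue_iff:
  assumes pos: "l > 0" "L > 0" "\<alpha> > 0" and P: "finite {q. rect_value l L \<alpha> q = \<mu>}"
  shows "robin_eigenvalue l L \<alpha> \<mu> \<longleftrightarrow> \<mu> \<in> range (rect_value l L \<alpha>)"
proof
  assume "robin_eigenvalue l L \<alpha> \<mu>"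
  then obtain \<phi> where \<phi>: "\<phi> \<in> robin_eigenspace l L \<alpha> \<mu>" "\<not> (AE p\<in>rect l L in lborel. \<phi> p = 0)"
    by (auto simp: robin_eigenvalue_def)
  then obtain c where "AE p\<in>rect l L in lborel. \<phi> p = (\<Sum>q | rect_value l L \<alpha> q = \<mu>. c q * rect_mode l L \<alpha> q p)"
    using eigenfunction_expansion[OF pos _ P] by blast
  with \<phi>(2) have "{q. rect_value l L \<alpha> q = \<mu>} \<noteq> {}" by (intro notI) simp
  then show "\<mu> \<in> range (rect_value l L \<alpha>)" by blast
next
  assume "\<mu> \<in> range (rect_value l L \<alpha>)"
  then obtain q where q: "\<mu> = rect_value l L \<alpha> q" by blast
  have "\<not> (AE p\<in>rect l L in lborel. rect_mode l L \<alpha> q p = 0)"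
    using rect_modes_independent[OF pos, of "{q}" "\<lambda>_. 1" q] by auto
  then show "robin_eigenvalue l L \<alpha> \<mu>"
    unfolding robin_eigenvalue_def q using rect_mode_in_eigenspace[OF pos] by blast
qed

section \<open>Sorted enumeration of a function with finite sublevel sets\<close>

lemma finite_downward_closed_nat:
  fixes A :: "nat set"
  assumes "finite A" and down: "\<And>m n. n \<in> A \<Longrightarrow> m \<le> n \<Longrightarrow> m \<in> A"
  shows "A = {..<card A}"
proof -
  obtain k where k: "k \<notin> A" using assms(1) infinite_UNIV_nat by (metis ex_new_if_finite)
  define m where "m = (LEAST k. k \<notin> A)"
  have "m \<notin> A" unfolding m_def using k by (rule LeastI)
  moreover have "i \<in> A" if "i < m" for i using that not_less_Least unfolding m_def by blast
  ultimately have "A = {..<m}" using down by (auto simp: not_le) (meson not_le)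
  then show ?thesis by simp
qed

definition counting :: "('p \<Rightarrow> real) \<Rightarrow> real \<Rightarrow> nat" where
  "counting f v = card {p. f p \<le> v}"

text \<open>
  \<open>lam\<close> lists the values of \<open>f\<close> in nondecreasing order, each as often as \<open>f\<close> attains it.
\<close>

definition enumerates :: "('p \<Rightarrow> real) \<Rightarrow> (nat \<Rightarrow> real) \<Rightarrow> bool" where
  "enumerates f lam \<longleftrightarrow> mono lam \<and> range lam = range f \<and>
     (\<forall>\<mu>\<in>range f. finite {n. lam n = \<mu>} \<and> card {n. lam n = \<mu>} = card {p. f p = \<mu>})"

context
  fixes f :: "'p \<Rightarrow> real"
  assumes inf: "infinite (UNIV :: 'p set)" and fin: "\<And>v. finite {p. f p \<le> v}"
begin

lemma finite_level: "finite {p. f p = v}"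
  by (rule finite_subset[OF _ fin[of v]]) auto

lemma finite_below: "finite {p. f p < v}"
  by (rule finite_subset[OF _ fin[of v]]) auto

lemma card_level: "card {p. f p = v} = counting f v - card {p. f p < v}"
proof -
  have "{p. f p = v} = {p. f p \<le> v} - {p. f p < v}" by auto
  then show ?thesis unfolding counting_def by (simp add: card_Diff_subset finite_below less_imp_le subset_iff)
qed

text \<open>
  Both sides describe an initial segment of the natural numbers, and the two segments have the same
  number of elements. The equivalence determines \<open>lam\<close> from the counting function, which gives
  uniqueness; the existence proof constructs \<open>lam\<close> from the same equivalence.
\<close>

lemma enumerates_le_iff:
  assumes lam: "enumerates f lam"
  shows "lam n \<le> v \<longleftrightarrow> n < counting f v"
proof -
  let ?S = "f ` {p. f p \<le> v}"
  have lev: "finite {n. lam n = \<mu>}" "card {n. lam n = \<mu>} = card {p. f p = \<mu>}" if "\<mu> \<in> ?S" for \<mu>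
    using lam that by (auto simp: enumerates_def)
  have U: "{n. lam n \<le> v} = (\<Union>\<mu>\<in>?S. {n. lam n = \<mu>})"
    using lam unfolding enumerates_def by (auto simp: image_iff) (metis rangeE rangeI)
  have "card {n. lam n \<le> v} = (\<Sum>\<mu>\<in>?S. card {n. lam n = \<mu>})"
    unfolding U using fin lev(1) by (intro card_UN_disjoint) auto
  also have "\<dots> = (\<Sum>\<mu>\<in>?S. card {p. f p = \<mu>})" using lev(2) by simp
  also have "\<dots> = card (\<Union>\<mu>\<in>?S. {p. f p = \<mu>})"
    using fin finite_level by (intro card_UN_disjoint[symmetric]) auto
  also have "(\<Union>\<mu>\<in>?S. {p. f p = \<mu>}) = {p. f p \<le> v}" by auto
  finally have card: "card {n. lam n \<le> v} = counting f v" by (simp add: counting_def)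
  have "finite {n. lam n \<le> v}" unfolding U using fin lev(1) by auto
  moreover have "mono lam" using lam by (simp add: enumerates_def)
  ultimately have "{n. lam n \<le> v} = {..<card {n. lam n \<le> v}}"
    by (intro finite_downward_closed_nat) (auto dest: monoD intro: order_trans)
  then show ?thesis unfolding card by blast
qed

lemma enumerates_unique: "enumerates f lam \<Longrightarrow> enumerates f lam' \<Longrightarrow> lam = lam'"
  using enumerates_le_iff by (intro ext antisym) blast+

lemma counting_mono: "v \<le> w \<Longrightarrow> counting f v \<le> counting f w"
  unfolding counting_def using fin by (intro card_mono) auto

text \<open>
  The smallest value whose sublevel set has more than \<open>n\<close> elements. The minimum is taken over the
  finite set of values below some bound \<open>u\<close> that is large enough.
\<close>

lemma enumeration_point: "\<exists>w\<in>range f. \<forall>v. w \<le> v \<longleftrightarrow> n < counting f v"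
proof -
  obtain T :: "'p set" where T: "finite T" "card T = Suc n" using infinite_arbitrarily_large[OF inf] by blast
  define u where "u = Max (f ` T)"
  have "T \<subseteq> {p. f p \<le> u}" using T by (auto simp: u_def)
  then have "card T \<le> counting f u" unfolding counting_def using fin by (intro card_mono) auto
  then have nu: "n < counting f u" using T by simp
  define S where "S = {w \<in> f ` {p. f p \<le> u}. n < counting f w}"
  have S: "finite S" unfolding S_def using fin by auto
  have below: "\<exists>w\<in>f ` {p. f p \<le> v}. n < counting f w" if v: "n < counting f v" for v
  proof -
    let ?F = "f ` {p. f p \<le> v}"
    have "{p. f p \<le> v} \<noteq> {}"
    proof
      assume "{p. f p \<le> v} = {}"
      with v show False by (simp add: counting_def)
    qed
    then have F: "finite ?F" "?F \<noteq> {}" using fin by auto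
    have "Max ?F \<le> v" using Max_in[OF F] by auto
    then have "{p. f p \<le> Max ?F} = {p. f p \<le> v}" using Max_ge[OF F(1)] by force
    then have "n < counting f (Max ?F)" using v by (simp add: counting_def)
    with Max_in[OF F] show ?thesis by blast
  qed
  have ne: "S \<noteq> {}" using below[OF nu] by (auto simp: S_def)
  have "Min S \<le> v \<longleftrightarrow> n < counting f v" for v
  proof
    assume "Min S \<le> v"
    moreover have "n < counting f (Min S)" using Min_in[OF S ne] by (simp add: S_def)
    ultimately show "n < counting f v" using counting_mono[of "Min S" v] by simp
  next
    assume "n < counting f v"
    from below[OF this] obtain w where w: "w \<in> range f" "w \<le> v" "n < counting f w" by auto
    have "Min S \<le> w"
    proof (cases "w \<le> u")
      case True
      then have "w \<in> S" using w by (auto simp: S_def)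
      then show ?thesis by (rule Min_le[OF S])
    next
      case False
      then show ?thesis using Min_in[OF S ne] by (auto simp: S_def)
    qed
    then show "Min S \<le> v" using w by simp
  qed
  moreover have "Min S \<in> range f" using Min_in[OF S ne] by (auto simp: S_def)
  ultimately show ?thesis by blast
qed

lemma enumerates_exists: "\<exists>lam. enumerates f lam"
proof -
  have "\<exists>lam. \<forall>n. lam n \<in> range f \<and> (\<forall>v. lam n \<le> v \<longleftrightarrow> n < counting f v)"
    using enumeration_point by (intro choice) blast
  then obtain lam where rng: "\<And>n. lam n \<in> range f" and le: "\<And>n v. lam n \<le> v \<longleftrightarrow> n < counting f v" by blast
  have less: "lam n < v \<longleftrightarrow> n < card {p. f p < v}" for n v
  proof
    assume a: "lam n < v"
    have "n < counting f (lam n)" using le by blast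
    also have "\<dots> \<le> card {p. f p < v}" unfolding counting_def using a finite_below by (intro card_mono) auto
    finally show "n < card {p. f p < v}" .
  next
    assume a: "n < card {p. f p < v}"
    then have F: "finite (f ` {p. f p < v})" "f ` {p. f p < v} \<noteq> {}" using finite_below by (auto intro: ccontr)
    define w where "w = Max (f ` {p. f p < v})"
    have w: "w < v" using Max_in[OF F] by (auto simp: w_def)
    have "card {p. f p < v} \<le> counting f w"
      unfolding counting_def w_def using fin F by (intro card_mono) auto
    then have "lam n \<le> w" using a le by simp
    with w show "lam n < v" by simp
  qed
  have level: "{n. lam n = v} = {card {p. f p < v}..<counting f v}" for v
  proof -
    have "lam n = v \<longleftrightarrow> card {p. f p < v} \<le> n \<and> n < counting f v" for n
      using le[of n v] less[of n v] by linarith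
    then show ?thesis by (simp add: set_eq_iff)
  qed
  have "mono lam"
  proof (rule monoI)
    fix m n :: nat assume "m \<le> n"
    moreover have "n < counting f (lam n)" using le by blast
    ultimately show "lam m \<le> lam n" using le by simp
  qed
  moreover have "f p \<in> range lam" for p
  proof -
    have "card {p'. f p' = f p} > 0" using finite_level[of "f p"] by (auto simp: card_gt_0_iff)
    then have "card {p'. f p' < f p} \<in> {n. lam n = f p}" unfolding level card_level by simp
    then have "lam (card {p'. f p' < f p}) = f p" by (rule CollectD)
    from this[symmetric] show ?thesis by (rule range_eqI)
  qed
  then have "range lam = range f" using rng by blast
  moreover have "finite {n. lam n = \<mu>} \<and> card {n. lam n = \<mu>} = card {p. f p = \<mu>}" for \<mu>
    unfolding level card_level by simp
  ultimately show ?thesis unfolding enumerates_def by blast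
qed

lemma enumerates_bounded_by_finite_set:
  assumes "enumerates f lam" and "finite T" "n < card T" "\<And>p. p \<in> T \<Longrightarrow> f p \<le> v"
  shows "lam n \<le> v"
proof -
  have "card T \<le> counting f v" unfolding counting_def using assms fin by (intro card_mono) auto
  with assms show ?thesis by (simp add: enumerates_le_iff)
qed

end

section \<open>Simplicity for large Robin parameter\<close>

lemma rect_value_bounds:
  assumes "l > 0" "L > 0" "\<alpha> > 0"
  shows "(real i * pi / l)\<^sup>2 + (real j * pi / L)\<^sup>2 \<le> rect_value l L \<alpha> (i, j)"
    and "rect_value l L \<alpha> (i, j) \<le> ((real i + 1) * pi / l)\<^sup>2 + ((real j + 1) * pi / L)\<^sup>2"
proof -
  note b = robin_freq_pos[OF assms(1,3), of i] robin_freq_greater[OF assms(1,3), of i] robin_freq_less[OF assms(1,3), of i]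
    robin_freq_pos[OF assms(2,3), of j] robin_freq_greater[OF assms(2,3), of j] robin_freq_less[OF assms(2,3), of j]
  show "(real i * pi / l)\<^sup>2 + (real j * pi / L)\<^sup>2 \<le> rect_value l L \<alpha> (i, j)"
    unfolding rect_value_def fst_conv snd_conv using b assms by (intro add_mono power_mono) auto
  show "rect_value l L \<alpha> (i, j) \<le> ((real i + 1) * pi / l)\<^sup>2 + ((real j + 1) * pi / L)\<^sup>2"
    unfolding rect_value_def fst_conv snd_conv using b assms by (intro add_mono power_mono) auto
qed

text \<open>
  The lower bound for the frequencies does not depend on \<open>\<alpha>\<close>, and neither does the finite set.
\<close>

lemma finite_low_rect_values:
  assumes l: "l > 0" and L: "L > 0"
  shows "\<exists>F. finite F \<and> (\<forall>\<alpha>>0. {q. rect_value l L \<alpha> q \<le> v} \<subseteq> F)"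
proof -
  have bd: "\<exists>m. \<forall>i::nat. (real i * pi / c)\<^sup>2 \<le> v \<longrightarrow> i \<le> m" if c: "c > 0" for c :: real
  proof -
    obtain m :: nat where m: "real m > sqrt v * c / pi" using reals_Archimedean2 by blast
    have "i \<le> m" if "(real i * pi / c)\<^sup>2 \<le> v" for i :: nat
    proof -
      have "real i * pi / c \<le> sqrt v" using that by (rule real_le_rsqrt)
      then have "real i \<le> sqrt v * c / pi" using c by (simp add: field_simps)
      then show ?thesis using m by simp
    qed
    then show ?thesis by blast
  qed
  obtain m1 where m1: "\<And>i::nat. (real i * pi / l)\<^sup>2 \<le> v \<Longrightarrow> i \<le> m1" using bd[OF l] by blast
  obtain m2 where m2: "\<And>i::nat. (real i * pi / L)\<^sup>2 \<le> v \<Longrightarrow> i \<le> m2" using bd[OF L] by blast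
  have "q \<in> {..m1} \<times> {..m2}" if "\<alpha> > 0" "rect_value l L \<alpha> q \<le> v" for \<alpha> q
  proof -
    obtain i j where q: "q = (i, j)" by fastforce
    have "(real i * pi / l)\<^sup>2 + (real j * pi / L)\<^sup>2 \<le> v"
      using rect_value_bounds(1)[OF l L that(1), of i j] that(2) q by simp
    then have "(real i * pi / l)\<^sup>2 \<le> v" "(real j * pi / L)\<^sup>2 \<le> v"
      by (smt (verit) zero_le_power2)+
    then show ?thesis using m1 m2 q by simp
  qed
  then show ?thesis by (intro exI[of _ "{..m1} \<times> {..m2}"]) blast
qed

lemma finite_rect_values_le:
  assumes "l > 0" "L > 0" "\<alpha> > 0"
  shows "finite {q. rect_value l L \<alpha> q \<le> v}"
  using finite_low_rect_values[OF assms(1,2), of v] assms(3) finite_subset by blast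

lemma robin_enumeration_iff:
  assumes pos: "l > 0" "L > 0" "\<alpha> > 0"
  shows "robin_enumeration l L \<alpha> lam \<longleftrightarrow> enumerates (rect_value l L \<alpha>) lam"
proof -
  have fin: "finite {q. rect_value l L \<alpha> q = \<mu>}" for \<mu>
    by (rule finite_subset[OF _ finite_rect_values_le[OF pos, of \<mu>]]) auto
  show ?thesis
    unfolding robin_enumeration_def enumerates_def robin_eigenvalue_iff[OF pos fin]
      has_ae_dim_robin_eigenspace[OF pos fin] by auto
qed

lemma enumerates_robin_lambda:
  assumes pos: "l > 0" "L > 0" "\<alpha> > 0"
  shows "enumerates (rect_value l L \<alpha>) (robin_lambda l L \<alpha>)"
proof -
  have inf: "infinite (UNIV :: (nat \<times> nat) set)" by (simp add: finite_prod)
  note fin = finite_rect_values_le[OF pos]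
  obtain lam where lam: "enumerates (rect_value l L \<alpha>) lam" using enumerates_exists[OF inf fin] by blast
  have "robin_lambda l L \<alpha> = lam"
    unfolding robin_lambda_def robin_enumeration_iff[OF pos]
    using lam enumerates_unique[OF inf fin] by (intro the_equality) auto
  with lam show ?thesis by simp
qed

text \<open>
  The dimension of the eigenspace is the number of index pairs with the same eigenvalue.
\<close>

lemma robin_simple_iff:
  assumes pos: "l > 0" "L > 0" "\<alpha> > 0"
  shows "robin_simple l L \<alpha> (rect_value l L \<alpha> q) \<longleftrightarrow>
    (\<forall>r. rect_value l L \<alpha> r = rect_value l L \<alpha> q \<longrightarrow> r = q)"
proof -
  let ?P = "{r. rect_value l L \<alpha> r = rect_value l L \<alpha> q}"
  have fin: "finite ?P"
    by (rule finite_subset[OF _ finite_rect_values_le[OF pos, of "rect_value l L \<alpha> q"]]) auto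
  have "robin_simple l L \<alpha> (rect_value l L \<alpha> q) \<longleftrightarrow> card ?P = 1"
    unfolding robin_simple_def robin_eigenvalue_iff[OF pos fin] has_ae_dim_robin_eigenspace[OF pos fin] by auto
  also have "\<dots> \<longleftrightarrow> ?P = {q}"
  proof
    assume "card ?P = 1"
    then obtain r where r: "?P = {r}" by (auto simp: card_1_singleton_iff)
    have "q \<in> ?P" by simp
    then have "q = r" unfolding r by simp
    then show "?P = {q}" using r by (simp only:)
  qed simp
  finally show ?thesis by auto
qed

text \<open>
  With \<open>t = k / \<alpha> \<rightarrow> 0\<close> the phase equation reads \<open>k = ((i+1) \<pi> - 2 arctan t) / l\<close>, and
  \<open>\<alpha> arctan t = k (arctan t) / t\<close>, where the last quotient tends to \<open>1\<close>.
\<close>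

lemma robin_freq_tendsto:
  assumes l: "l > 0"
  shows "((\<lambda>\<alpha>. robin_freq l \<alpha> i) \<longlongrightarrow> (real i + 1) * pi / l) at_top"
    and "((\<lambda>\<alpha>. \<alpha> * ((real i + 1) * pi / l - robin_freq l \<alpha> i)) \<longlongrightarrow> 2 * ((real i + 1) * pi / l) / l) at_top"
proof -
  define m where "m = (real i + 1) * pi"
  define t where "t \<alpha> = robin_freq l \<alpha> i / \<alpha>" for \<alpha>
  have pos: "\<forall>\<^sub>F \<alpha>::real in at_top. \<alpha> > 0" by (rule eventually_gt_at_top)
  have k: "robin_freq l \<alpha> i = (m - 2 * arctan (t \<alpha>)) / l" if "\<alpha> > 0" for \<alpha>
    using robin_freq_phase[OF l that, of i] l by (simp add: m_def t_def field_simps)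
  have up: "((\<lambda>\<alpha>. m / l / \<alpha>) \<longlongrightarrow> 0) at_top"
    by (intro tendsto_divide_0[OF tendsto_const] filterlim_at_top_imp_at_infinity filterlim_ident)
  have t0: "(t \<longlongrightarrow> 0) at_top"
  proof (rule tendsto_sandwich[OF _ _ tendsto_const up])
    show "\<forall>\<^sub>F \<alpha> in at_top. 0 \<le> t \<alpha>"
      by (rule eventually_mono[OF pos]) (use robin_freq_pos[OF l, of _ i] in \<open>auto simp: t_def less_imp_le\<close>)
    show "\<forall>\<^sub>F \<alpha> in at_top. t \<alpha> \<le> m / l / \<alpha>"
    proof (rule eventually_mono[OF pos])
      fix \<alpha> :: real assume "\<alpha> > 0"
      then show "t \<alpha> \<le> m / l / \<alpha>"
        unfolding t_def m_def by (intro divide_right_mono less_imp_le robin_freq_less l) auto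
    qed
  qed
  have "((\<lambda>\<alpha>. (m - 2 * arctan (t \<alpha>)) / l) \<longlongrightarrow> (m - 2 * arctan 0) / l) at_top"
    using l by (intro tendsto_intros t0) auto
  then have "((\<lambda>\<alpha>. (m - 2 * arctan (t \<alpha>)) / l) \<longlongrightarrow> m / l) at_top" by simp
  then have 1: "((\<lambda>\<alpha>. robin_freq l \<alpha> i) \<longlongrightarrow> m / l) at_top"
    by (rule Lim_transform_eventually) (rule eventually_mono[OF pos], simp add: k)
  then show "((\<lambda>\<alpha>. robin_freq l \<alpha> i) \<longlongrightarrow> (real i + 1) * pi / l) at_top" by (simp add: m_def)
  have tne: "\<forall>\<^sub>F \<alpha> in at_top. t \<alpha> \<noteq> 0"
    by (rule eventually_mono[OF pos]) (use robin_freq_pos[OF l, of _ i] in \<open>force simp: t_def\<close>)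
  have "((\<lambda>h. arctan h / h) \<longlongrightarrow> 1) (at 0)"
    using DERIV_arctan[of 0] by (simp add: DERIV_def)
  then have "((\<lambda>\<alpha>. arctan (t \<alpha>) / t \<alpha>) \<longlongrightarrow> 1) at_top"
    by (rule filterlim_compose) (use t0 tne in \<open>auto simp: filterlim_at\<close>)
  then have "((\<lambda>\<alpha>. 2 * robin_freq l \<alpha> i * (arctan (t \<alpha>) / t \<alpha>) / l) \<longlongrightarrow> 2 * (m / l) * 1 / l) at_top"
    using l by (intro tendsto_intros 1) auto
  then have "((\<lambda>\<alpha>. \<alpha> * (m / l - robin_freq l \<alpha> i)) \<longlongrightarrow> 2 * (m / l) * 1 / l) at_top"
  proof (rule Lim_transform_eventually)
    show "\<forall>\<^sub>F \<alpha> in at_top. 2 * robin_freq l \<alpha> i * (arctan (t \<alpha>) / t \<alpha>) / l = \<alpha> * (m / l - robin_freq l \<alpha> i)"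
      using pos
    proof eventually_elim
      case (elim \<alpha>)
      have f: "robin_freq l \<alpha> i > 0" by (rule robin_freq_pos[OF l elim])
      have "m / l - robin_freq l \<alpha> i = 2 * arctan (t \<alpha>) / l"
        using k[OF elim] by (simp add: diff_divide_distrib)
      moreover have "robin_freq l \<alpha> i = \<alpha> * t \<alpha>" using elim by (simp add: t_def)
      ultimately show ?case using f by (simp add: field_simps)
    qed
  qed
  then show "((\<lambda>\<alpha>. \<alpha> * ((real i + 1) * pi / l - robin_freq l \<alpha> i)) \<longlongrightarrow> 2 * ((real i + 1) * pi / l) / l) at_top"
    by (simp add: m_def)
qed

lemma robin_freq_square_asymptotics:
  assumes l: "l > 0"
  shows "((\<lambda>\<alpha>. \<alpha> * (((real i + 1) * pi / l)\<^sup>2 - (robin_freq l \<alpha> i)\<^sup>2)) \<longlongrightarrow>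
     4 * ((real i + 1) * pi / l)\<^sup>2 / l) at_top"
proof -
  define d where "d = (real i + 1) * pi / l"
  have "((\<lambda>\<alpha>. (\<alpha> * (d - robin_freq l \<alpha> i)) * (d + robin_freq l \<alpha> i)) \<longlongrightarrow> (2 * d / l) * (d + d)) at_top"
    unfolding d_def by (intro tendsto_intros robin_freq_tendsto l)
  moreover have "(\<alpha> * (d - robin_freq l \<alpha> i)) * (d + robin_freq l \<alpha> i) = \<alpha> * (d\<^sup>2 - (robin_freq l \<alpha> i)\<^sup>2)" for \<alpha>
    by (simp add: power2_eq_square algebra_simps)
  moreover have "(2 * d / l) * (d + d) = 4 * d\<^sup>2 / l" by (simp add: power2_eq_square)
  ultimately show ?thesis unfolding d_def[symmetric] by (simp only:)
qed

definition dirichlet_value :: "real \<Rightarrow> real \<Rightarrow> nat \<times> nat \<Rightarrow> real" where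
  "dirichlet_value l L q = ((real (fst q) + 1) * pi / l)\<^sup>2 + ((real (snd q) + 1) * pi / L)\<^sup>2"

text \<open>
  Minus the coefficient of \<open>1/\<alpha>\<close> in the expansion of the eigenvalue at \<open>\<alpha> = \<infinity>\<close>.
\<close>

definition robin_correction :: "real \<Rightarrow> real \<Rightarrow> nat \<times> nat \<Rightarrow> real" where
  "robin_correction l L q = 4 * ((real (fst q) + 1) * pi / l)\<^sup>2 / l + 4 * ((real (snd q) + 1) * pi / L)\<^sup>2 / L"

lemma rect_value_asymptotics:
  assumes l: "l > 0" and L: "L > 0"
  shows "((\<lambda>\<alpha>. rect_value l L \<alpha> q) \<longlongrightarrow> dirichlet_value l L q) at_top"
    and "((\<lambda>\<alpha>. \<alpha> * (dirichlet_value l L q - rect_value l L \<alpha> q)) \<longlongrightarrow> robin_correction l L q) at_top"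
proof -
  show "((\<lambda>\<alpha>. rect_value l L \<alpha> q) \<longlongrightarrow> dirichlet_value l L q) at_top"
    unfolding rect_value_def dirichlet_value_def by (intro tendsto_intros robin_freq_tendsto l L)
  have "((\<lambda>\<alpha>. \<alpha> * (((real (fst q) + 1) * pi / l)\<^sup>2 - (robin_freq l \<alpha> (fst q))\<^sup>2)
        + \<alpha> * (((real (snd q) + 1) * pi / L)\<^sup>2 - (robin_freq L \<alpha> (snd q))\<^sup>2)) \<longlongrightarrow> robin_correction l L q) at_top"
    unfolding robin_correction_def by (intro tendsto_add robin_freq_square_asymptotics l L)
  then show "((\<lambda>\<alpha>. \<alpha> * (dirichlet_value l L q - rect_value l L \<alpha> q)) \<longlongrightarrow> robin_correction l L q) at_top"
    by (simp add: rect_value_def dirichlet_value_def algebra_simps)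
qed

text \<open>
  For the differences \<open>a\<close> and \<open>b\<close> of the squared frequencies in the two directions the hypotheses read
  \<open>a + b = 0\<close> and \<open>a/l + b/L = 0\<close>, a system whose determinant vanishes only for \<open>l = L\<close>.
\<close>

lemma dirichlet_value_correction_inj:
  assumes l: "l > 0" and L: "L > 0" and "l \<noteq> L"
    and "dirichlet_value l L q = dirichlet_value l L r" "robin_correction l L q = robin_correction l L r"
  shows "q = r"
proof -
  define a where "a = ((real (fst q) + 1) * pi / l)\<^sup>2 - ((real (fst r) + 1) * pi / l)\<^sup>2"
  define b where "b = ((real (snd q) + 1) * pi / L)\<^sup>2 - ((real (snd r) + 1) * pi / L)\<^sup>2"
  have "a + b = 0" using assms(4) by (simp add: dirichlet_value_def a_def b_def)
  then have ba: "b = - a" by simp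
  have "a / l + b / L = 0" using assms(5) by (simp add: robin_correction_def a_def b_def diff_divide_distrib)
  then have "a * (1 / l - 1 / L) = 0" by (simp add: ba algebra_simps)
  moreover have "1 / l - 1 / L \<noteq> 0" using assms(1-3) by simp
  ultimately have "a = 0" by simp
  have sq: "i = j" if "((real i + 1) * pi / c)\<^sup>2 = ((real j + 1) * pi / c)\<^sup>2" "c > 0" for i j :: nat and c
  proof -
    have "(real i + 1) * pi / c = (real j + 1) * pi / c"
      by (rule power2_eq_imp_eq[OF that(1)]) (use that(2) in simp_all)
    then show ?thesis using that(2) by simp
  qed
  have "fst q = fst r" by (rule sq[OF _ l]) (use \<open>a = 0\<close> in \<open>simp add: a_def\<close>)
  moreover have "snd q = snd r" by (rule sq[OF _ L]) (use \<open>a = 0\<close> ba in \<open>simp add: b_def\<close>)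
  ultimately show ?thesis by (simp add: prod_eq_iff)
qed

text \<open>
  Different Dirichlet limits separate the two values; if the limits agree, the corrections of order
  \<open>1/\<alpha>\<close> do.
\<close>

lemma eventually_rect_values_distinct:
  assumes l: "l > 0" and L: "L > 0" and "l \<noteq> L" and "q \<noteq> r"
  shows "\<forall>\<^sub>F \<alpha> in at_top. rect_value l L \<alpha> q \<noteq> rect_value l L \<alpha> r"
proof (cases "dirichlet_value l L q = dirichlet_value l L r")
  case False
  have "((\<lambda>\<alpha>. rect_value l L \<alpha> q - rect_value l L \<alpha> r) \<longlongrightarrow> dirichlet_value l L q - dirichlet_value l L r) at_top"
    by (intro tendsto_diff rect_value_asymptotics l L)
  then have "\<forall>\<^sub>F \<alpha> in at_top. rect_value l L \<alpha> q - rect_value l L \<alpha> r \<noteq> 0"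
    using False by (intro tendsto_imp_eventually_ne) auto
  then show ?thesis by simp
next
  case True
  then have "robin_correction l L q \<noteq> robin_correction l L r"
    using dirichlet_value_correction_inj[OF assms(1-3)] assms(4) by blast
  moreover have "((\<lambda>\<alpha>. \<alpha> * (dirichlet_value l L q - rect_value l L \<alpha> q) - \<alpha> * (dirichlet_value l L r - rect_value l L \<alpha> r))
      \<longlongrightarrow> robin_correction l L q - robin_correction l L r) at_top"
    by (intro tendsto_diff rect_value_asymptotics l L)
  ultimately have "\<forall>\<^sub>F \<alpha> in at_top. \<alpha> * (dirichlet_value l L q - rect_value l L \<alpha> q)
      - \<alpha> * (dirichlet_value l L r - rect_value l L \<alpha> r) \<noteq> 0"
    by (intro tendsto_imp_eventually_ne) auto
  then show ?thesis by (rule eventually_mono) (use True in auto)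
qed

theorem corollary1p6:
  fixes l L :: real and n :: nat
  assumes "l > 0" and "L > 0" and "l \<noteq> L"
  shows "\<exists>\<alpha>\<^sub>0>0. \<forall>\<alpha>\<ge>\<alpha>\<^sub>0. robin_simple l L \<alpha> (robin_lambda l L \<alpha> n)"
proof -
  \<comment> \<open>The \<open>n + 1\<close> pairs \<open>(0, 0), ..., (n, 0)\<close> keep the eigenvalue with index \<open>n\<close> below this Dirichlet value.\<close>
  define v where "v = dirichlet_value l L (n, 0)"
  obtain F where F: "finite F" "\<And>\<alpha>. \<alpha> > 0 \<Longrightarrow> {q. rect_value l L \<alpha> q \<le> v} \<subseteq> F"
    using finite_low_rect_values[OF assms(1,2)] by blast
  have "\<forall>\<^sub>F \<alpha> in at_top. \<forall>q\<in>F. \<forall>r\<in>F. q \<noteq> r \<longrightarrow> rect_value l L \<alpha> q \<noteq> rect_value l L \<alpha> r"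
    using F(1) eventually_rect_values_distinct[OF assms] by (intro eventually_ball_finite ballI) auto
  then obtain a where a: "\<And>\<alpha> q r. \<alpha> \<ge> a \<Longrightarrow> q \<in> F \<Longrightarrow> r \<in> F \<Longrightarrow> q \<noteq> r \<Longrightarrow>
      rect_value l L \<alpha> q \<noteq> rect_value l L \<alpha> r"
    unfolding eventually_at_top_linorder by blast
  have "robin_simple l L \<alpha> (robin_lambda l L \<alpha> n)" if \<alpha>: "\<alpha> \<ge> max a 1" for \<alpha>
  proof -
    have pos: "l > 0" "L > 0" "\<alpha> > 0" using assms \<alpha> by auto
    note enum = enumerates_robin_lambda[OF pos]
    have inf: "infinite (UNIV :: (nat \<times> nat) set)" by (simp add: finite_prod)
    have "robin_lambda l L \<alpha> n \<le> v"
    proof (rule enumerates_bounded_by_finite_set[OF inf finite_rect_values_le[OF pos] enum])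
      show "finite ({..n} \<times> {0::nat})" "n < card ({..n} \<times> {0::nat})" by auto
      fix q :: "nat \<times> nat" assume "q \<in> {..n} \<times> {0}"
      then obtain i where q: "q = (i, 0)" "i \<le> n" by auto
      have "rect_value l L \<alpha> q \<le> dirichlet_value l L q"
        using rect_value_bounds(2)[OF pos, of i 0] by (simp add: q dirichlet_value_def)
      also have "\<dots> \<le> v"
        unfolding v_def dirichlet_value_def q using q(2) pos
        by (auto intro!: power_mono divide_right_mono mult_right_mono)
      finally show "rect_value l L \<alpha> q \<le> v" .
    qed
    have "robin_lambda l L \<alpha> n \<in> range (rect_value l L \<alpha>)"
      using enum by (auto simp: enumerates_def)
    then obtain q where q: "robin_lambda l L \<alpha> n = rect_value l L \<alpha> q" by blast
    have "r = q" if "rect_value l L \<alpha> r = rect_value l L \<alpha> q" for r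
    proof -
      have "r \<in> F" "q \<in> F" using F(2)[OF pos(3)] \<open>robin_lambda l L \<alpha> n \<le> v\<close> q that by auto
      then show ?thesis using a[of \<alpha> r q] \<alpha> that by auto
    qed
    then show ?thesis unfolding q robin_simple_iff[OF pos] by blast
  qed
  then show ?thesis by (intro exI[of _ "max a 1"]) auto
qed

end
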